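(* Let $p$ be a prime, $L_0=\overline{\mathbb{F}}_p(t,t^{1/p},t^{1/p^2},\dots)$, $L$ a finite extension of $L_0$ with algebraic closure $\overline{L}$, $d\ge2$ an integer, and $f_\lambda(x)=x^d+\lambda$ for $\lambda\in\overline{L}$. Let $\alpha,\beta\in L$. Assume there exists an infinite sequence $\{\lambda_n\}$ in $\overline{L}$ with $$\lim_{n\to\infty}\hat h_{f_{\lambda_n}}(\alpha)=\lim_{n\to\infty}\hat h_{f_{\lambda_n}}(\beta)=0.$$ Then for each $\lambda\in\overline{L}$ and each $v\in\Omega$, we have $\hat h_{v,\lambda}(\alpha)=\hat h_{v,\lambda}(\beta)$.
   Context: $\Omega$ is the set of places of $L$ lying above the places of $\overline{\mathbb{F}}_p(t)$ (each of which extends uniquely to $L_0$), with absolute values $|\cdot|_v$ normalized so that for every nonzero $x\in L$, $|x|_v=1$ for almost all $v$ and $\prod_{v\in\Omega}|x|_v=1$. For each $v$, $\mathbb{C}_v$ is an algebraically closed field containing $L$, complete with respect to a fixed extension of $|\cdot|_v$, with a fixed embedding $\overline{L}\hookrightarrow\mathbb{C}_v$. For $\lambda,x\in\mathbb{C}_v$ the local canonical height is $\hat h_{v,\lambda}(x)=\lim_{n\to\infty}\frac{\log^+|f_\lambda^n(x)|_v}{d^n}$, where $\log^+z=\log\max\{z,1\}$. The Weil height of $x\in\overline{L}$ is $h(x)=\frac{1}{[L(x):L]}\sum_{v\in\Omega}\sum_y\log^+|y|_v$, $y$ running over the $\mathrm{Gal}(\overline{L}/L)$-orbit of $x$, and the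 global canonical height is $\hat h_{f_\lambda}(x)=\lim_{n\to\infty}h(f^n_\lambda(x))/d^n$. *)

theory Defs
  imports
    "HOL-Algebra.Algebraic_Closure"
    "HOL-Algebra.Generated_Fields"
    "HOL-Analysis.Abstract_Metric_Spaces"
    "HOL-Analysis.Infinite_Sum"
begin

section \<open>The fields\<close>

text \<open>
  All subfields are taken inside a fixed algebraic closure \<open>R\<close> of the field \<open>L\<close>.
\<close>

definition prime_subfield :: "('a, 'm) ring_scheme \<Rightarrow> 'a set" where
  "prime_subfield R = generate_field R {}"

text \<open>
  When \<open>R\<close> is an algebraically closed field of characteristic \<open>p\<close>, the elements algebraic over the
  prime field form an algebraic closure of the field with \<open>p\<close> elements.
\<close>

definition constants :: "('a, 'm) ring_scheme \<Rightarrow> 'a set" where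
  "constants R = {x \<in> carrier R. ring.algebraic R (prime_subfield R) x}"

definition rat_field :: "('a, 'm) ring_scheme \<Rightarrow> 'a \<Rightarrow> 'a set" where
  "rat_field R t = generate_field R (insert t (constants R))"

text \<open>
  In a field of characteristic \<open>p\<close>, the equation \<open>s [^] (p ^ n) = t\<close> has at most one solution,
  so the elements adjoined are the iterated \<open>p\<close>-th roots of \<open>t\<close>, starting with \<open>t\<close> itself.
\<close>

definition perf_rat_field :: "nat \<Rightarrow> ('a, 'm) ring_scheme \<Rightarrow> 'a \<Rightarrow> 'a set" where
  "perf_rat_field p R t =
     generate_field R (constants R \<union> {s \<in> carrier R. \<exists>n::nat. s [^]\<^bsub>R\<^esub> (p ^ n) = t})"


section \<open>Absolute values and places\<close>

definition absolute_value :: "('a, 'm) ring_scheme \<Rightarrow> 'a set \<Rightarrow> ('a \<Rightarrow> real) \<Rightarrow> bool" where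
  "absolute_value R K \<nu> \<longleftrightarrow>
     (\<forall>x\<in>K. 0 \<le> \<nu> x \<and> (\<nu> x = 0 \<longleftrightarrow> x = \<zero>\<^bsub>R\<^esub>)) \<and>
     (\<forall>x\<in>K. \<forall>y\<in>K. \<nu> (x \<otimes>\<^bsub>R\<^esub> y) = \<nu> x * \<nu> y \<and> \<nu> (x \<oplus>\<^bsub>R\<^esub> y) \<le> \<nu> x + \<nu> y)"

definition nontrivial_abs :: "('a, 'm) ring_scheme \<Rightarrow> 'a set \<Rightarrow> ('a \<Rightarrow> real) \<Rightarrow> bool" where
  "nontrivial_abs R K \<nu> \<longleftrightarrow> (\<exists>x\<in>K. x \<noteq> \<zero>\<^bsub>R\<^esub> \<and> \<nu> x \<noteq> 1)"

definition equivalent_abs :: "'a set \<Rightarrow> ('a \<Rightarrow> real) \<Rightarrow> ('a \<Rightarrow> real) \<Rightarrow> bool" where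
  "equivalent_abs K \<nu> \<mu> \<longleftrightarrow> (\<exists>s>0. \<forall>x\<in>K. \<mu> x = \<nu> x powr s)"

text \<open>
  A place of \<open>K\<close> is an equivalence class of nontrivial absolute values on \<open>K\<close>.  Absolute values
  are made extensional so that they are determined by their values on \<open>K\<close>.
\<close>

definition nontrivial_abs_values :: "('a, 'm) ring_scheme \<Rightarrow> 'a set \<Rightarrow> ('a \<Rightarrow> real) set" where
  "nontrivial_abs_values R K =
     {\<nu> \<in> extensional K. absolute_value R K \<nu> \<and> nontrivial_abs R K \<nu>}"

definition places :: "('a, 'm) ring_scheme \<Rightarrow> 'a set \<Rightarrow> ('a \<Rightarrow> real) set set" where
  "places R K =
     nontrivial_abs_values R K //
       {(\<nu>, \<mu>). \<nu> \<in> nontrivial_abs_values R K \<and> \<mu> \<in> nontrivial_abs_values R K \<and>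
                equivalent_abs K \<nu> \<mu>}"

definition places_above ::
    "('a, 'm) ring_scheme \<Rightarrow> 'a set \<Rightarrow> 'a set \<Rightarrow> ('a \<Rightarrow> real) set set" where
  "places_above R K L =
     {v \<in> places R L. \<exists>u \<in> places R K. \<forall>\<nu>\<in>v. restrict \<nu> K \<in> u}"

text \<open>
  The function \<open>nv\<close> picks one absolute value in each class, so that the product formula holds.
\<close>

definition normalized_abs ::
    "('a, 'm) ring_scheme \<Rightarrow> 'a set \<Rightarrow> ('a \<Rightarrow> real) set set \<Rightarrow> (('a \<Rightarrow> real) set \<Rightarrow> 'a \<Rightarrow> real) \<Rightarrow> bool"
  where
  "normalized_abs R L \<Omega> nv \<longleftrightarrow>
     (\<forall>v\<in>\<Omega>. nv v \<in> v) \<and>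
     (\<forall>x\<in>L - {\<zero>\<^bsub>R\<^esub>}. finite {v \<in> \<Omega>. nv v x \<noteq> 1} \<and> (\<Prod>v\<in>{v \<in> \<Omega>. nv v x \<noteq> 1}. nv v x) = 1)"

text \<open>
  \<open>Metric_space\<close> asks for symmetry and nonnegativity on the whole type, hence the value \<open>0\<close>
  outside the carrier.
\<close>

definition abs_dist :: "('c, 'm) ring_scheme \<Rightarrow> ('c \<Rightarrow> real) \<Rightarrow> 'c \<Rightarrow> 'c \<Rightarrow> real" where
  "abs_dist C \<nu> x y = (if x \<in> carrier C \<and> y \<in> carrier C then \<nu> (x \<ominus>\<^bsub>C\<^esub> y) else 0)"

lemma (in field) abs_dist_Metric_space:
  assumes "absolute_value R (carrier R) \<nu>"
  shows "Metric_space (carrier R) (abs_dist R \<nu>)"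
proof -
  have nn: "0 \<le> \<nu> x" and z: "\<nu> x = 0 \<longleftrightarrow> x = \<zero>" if "x \<in> carrier R" for x
    using assms that by (auto simp: absolute_value_def)
  have mult: "\<nu> (x \<otimes> y) = \<nu> x * \<nu> y" and tri: "\<nu> (x \<oplus> y) \<le> \<nu> x + \<nu> y"
    if "x \<in> carrier R" "y \<in> carrier R" for x y
    using assms that by (auto simp: absolute_value_def)
  have minus: "\<nu> (\<ominus> x) = \<nu> x" if "x \<in> carrier R" for x
  proof -
    have "(\<ominus> x) \<otimes> (\<ominus> x) = x \<otimes> x"
      using that by (simp add: l_minus r_minus)
    then have "\<nu> (\<ominus> x) * \<nu> (\<ominus> x) = \<nu> x * \<nu> x"
      using that mult by (metis a_inv_closed)
    then have "(\<nu> (\<ominus> x))\<^sup>2 = (\<nu> x)\<^sup>2"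
      by (simp add: power2_eq_square)
    then show ?thesis
      using nn that by (metis a_inv_closed power2_eq_imp_eq)
  qed
  show ?thesis
  proof
    show "0 \<le> abs_dist R \<nu> x y" for x y
      by (simp add: abs_dist_def nn)
    show "abs_dist R \<nu> x y = abs_dist R \<nu> y x" for x y
    proof -
      have "\<nu> (x \<ominus> y) = \<nu> (y \<ominus> x)" if "x \<in> carrier R" "y \<in> carrier R"
      proof -
        have "\<ominus> (x \<ominus> y) = y \<ominus> x"
          using that by (simp add: minus_eq minus_add a_comm)
        then show ?thesis
          using minus[of "x \<ominus> y"] that by simp
      qed
      then show ?thesis by (auto simp: abs_dist_def)
    qed
    show "abs_dist R \<nu> x y = 0 \<longleftrightarrow> x = y" if "x \<in> carrier R" "y \<in> carrier R" for x y
      using that z[of "x \<ominus> y"] by (simp add: abs_dist_def)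
    show "abs_dist R \<nu> x w \<le> abs_dist R \<nu> x y + abs_dist R \<nu> y w"
      if "x \<in> carrier R" "y \<in> carrier R" "w \<in> carrier R" for x y w
    proof -
      have "x \<ominus> w = (x \<ominus> y) \<oplus> (y \<ominus> w)"
        using that by algebra
      then show ?thesis
        using that tri[of "x \<ominus> y" "y \<ominus> w"] by (simp add: abs_dist_def)
    qed
  qed
qed

definition complete_abs :: "('c, 'm) ring_scheme \<Rightarrow> ('c \<Rightarrow> real) \<Rightarrow> bool" where
  "complete_abs C \<nu> \<longleftrightarrow> Metric_space.mcomplete (carrier C) (abs_dist C \<nu>)"


section \<open>Heights\<close>

definition log_plus :: "real \<Rightarrow> real" where
  "log_plus z = ln (max z 1)"

definition unicrit :: "('a, 'm) ring_scheme \<Rightarrow> nat \<Rightarrow> 'a \<Rightarrow> 'a \<Rightarrow> 'a" where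
  "unicrit R d lam x = x [^]\<^bsub>R\<^esub> d \<oplus>\<^bsub>R\<^esub> lam"

definition local_height ::
    "('c, 'm) ring_scheme \<Rightarrow> ('c \<Rightarrow> real) \<Rightarrow> nat \<Rightarrow> 'c \<Rightarrow> 'c \<Rightarrow> real" where
  "local_height C \<nu> d lam x =
     lim (\<lambda>n. log_plus (\<nu> ((unicrit C d lam ^^ n) x)) / real d ^ n)"

definition galois_group :: "('a, 'm) ring_scheme \<Rightarrow> 'a set \<Rightarrow> ('a \<Rightarrow> 'a) set" where
  "galois_group R L = {\<sigma> \<in> ring_iso R R. \<forall>a\<in>L. \<sigma> a = a}"

definition galois_orbit :: "('a, 'm) ring_scheme \<Rightarrow> 'a set \<Rightarrow> 'a \<Rightarrow> 'a set" where
  "galois_orbit R L x = (\<lambda>\<sigma>. \<sigma> x) ` galois_group R L"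

text \<open>
  Below, \<open>nrm v y\<close> is the absolute value at the place \<open>v\<close> of an element \<open>y\<close> of the algebraic
  closure, computed through its embedding in the complete field attached to \<open>v\<close>.  Only finitely
  many terms of the sum over \<open>\<Omega>\<close> are nonzero.
\<close>

definition weil_height ::
    "('a, 'm) ring_scheme \<Rightarrow> 'a set \<Rightarrow> 'v set \<Rightarrow> ('v \<Rightarrow> 'a \<Rightarrow> real) \<Rightarrow> 'a \<Rightarrow> real" where
  "weil_height R L \<Omega> nrm x =
     1 / real (ring.dim R L (generate_field R (insert x L))) *
     (\<Sum>\<^sub>\<infinity>v\<in>\<Omega>. \<Sum>y\<in>galois_orbit R L x. log_plus (nrm v y))"

definition global_height ::
    "('a, 'm) ring_scheme \<Rightarrow> 'a set \<Rightarrow> 'v set \<Rightarrow> ('v \<Rightarrow> 'a \<Rightarrow> real) \<Rightarrow> nat \<Rightarrow> 'a \<Rightarrow> 'a \<Rightarrow> real"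
  where
  "global_height R L \<Omega> nrm d lam x =
     lim (\<lambda>n. weil_height R L \<Omega> nrm ((unicrit R d lam ^^ n) x) / real d ^ n)"

end

theory Submission
  imports Defs "HOL-Analysis.Analysis"
begin

hide_const (open) Polynomial.degree Polynomial.lead_coeff Polynomial.coeff Polynomial.monom

text \<open>
  All absolute values are pulled back to the algebraic closure, where they are ultrametric because
  the characteristic is positive.  The \<open>n\<close>-th iterate of \<open>\<alpha>\<close> is a monic polynomial in the parameter,
  of degree \<open>N = d ^ (n - 1)\<close>.  Attach to its roots the uniform measure \<open>\<rho>\<^sub>\<alpha>\<close> on the discs that are the
  components of the locus where it has absolute value at most \<open>1\<close>.  For the kernel \<open>log |x - y|\<close>
  extended to discs, \<open>\<rho>\<^sub>\<alpha>\<close> has energy \<open>0\<close>, and \<open>N\<close> times its potential is the positive part of the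
  logarithm of the iterate, so up to \<open>O(1/N)\<close> the potential is \<open>d\<close> times the local height.  An
  ultrametric kernel is a positive combination of block indicators and a constant, hence is
  semidefinite on measures of mass \<open>0\<close>.

  Let \<open>F\<close> be a large Galois-stable set of parameters of small height, a union of conjugacy classes of
  the \<open>\<lambda>\<^sub>n\<close>.  Its discriminant is a nonzero element of \<open>L\<close> since \<open>L\<close> is perfect.  Comparing \<open>F\<close> with
  the mean of \<open>\<rho>\<^sub>\<alpha>\<close> and \<open>\<rho>\<^sub>\<beta>\<close> at every place and adding up, the product formula bounds the mutual
  energy of \<open>\<rho>\<^sub>\<alpha>\<close> and \<open>\<rho>\<^sub>\<beta>\<close> at each place by \<open>O(1/N)\<close>.  By the Cauchy-Schwarz inequality the two
  potentials have the same limit as \<open>n\<close> grows.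
\<close>

section \<open>Energies of ultrametric kernels\<close>

text \<open>The root measures are finite-level stand-ins for limit measures on the Berkovich line: a
  closed disc is a point there, and \<open>disc_kernel\<close> is the Hsia kernel. At a fixed level
  all energies are finite sums. The mean of two measures of energy 0 has half their mutual energy as
  its energy, so a single inequality for \<open>F\<close> bounds the mutual energy from above.
  Mutual energies are nonnegative, so a bound for their sum over places is a bound at each place.
  The order of the limits matters. Fixing the level fixes the radii by which points of
  \<open>F\<close> are fattened. These are 1 wherever \<alpha> and \<beta> are integral, so their
  logarithms have a finite sum over the places; it is divided by \<open>card F\<close> and
  disappears as \<open>F\<close> grows. What remains is a constant from the finitely many other
  places, divided by \<open>d ^ n\<close>. Evaluating potentials at a parameter then needs a disc on
  which the truncated iterate is constant. Its radius is exponentially small in \<open>n\<close>, so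
  its logarithm is only linear in \<open>n\<close>, and \<open>n / d ^ n\<close> tends to 0.\<close>

lemma block_sum_nonneg:
  fixes c :: "'x \<Rightarrow> real" and E :: "'x \<Rightarrow> 'x \<Rightarrow> bool"
  assumes fin: "finite U"
    and sym: "\<And>x y. \<lbrakk>x \<in> U; y \<in> U; E x y\<rbrakk> \<Longrightarrow> E y x"
    and trans: "\<And>x y z. \<lbrakk>x \<in> U; y \<in> U; z \<in> U; E x y; E y z\<rbrakk> \<Longrightarrow> E x z"
  shows "0 \<le> (\<Sum>x\<in>U. \<Sum>y\<in>U. c x * c y * of_bool (E x y))"
proof -
  \<comment> \<open>\<open>E\<close> need not be reflexive: in the application it reads
    \<open>k x y \<le> M'\<close>, and a point with \<open>k x x\<close> above \<open>M'\<close> is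
    related to no point at all. On \<open>Y\<close> it is an equivalence relation, and the sum does
    not change.\<close>
  define Y where "Y = {x \<in> U. E x x}"
  define cl where "cl x = {y \<in> U. E x y}" for x
  have finY: "finite Y" using fin by (simp add: Y_def)
  have cl: "E x y \<longleftrightarrow> cl x = cl y" if "x \<in> Y" "y \<in> Y" for x y
  proof
    assume "E x y"
    with that have "E x z \<longleftrightarrow> E y z" if "z \<in> U" for z
      using that sym[of x y] trans[of x y z] trans[of y x z] by (auto simp: Y_def)
    then show "cl x = cl y" by (auto simp: cl_def)
  next
    assume "cl x = cl y"
    then show "E x y" using that by (auto simp: cl_def Y_def)
  qed
  have outside: "x \<in> Y \<and> y \<in> Y" if "x \<in> U" "y \<in> U" "E x y" for x y
    using that sym[of x y] trans[of x y x] trans[of y x y] by (simp add: Y_def)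
  have "(\<Sum>x\<in>U. \<Sum>y\<in>U. c x * c y * of_bool (E x y))
      = (\<Sum>x\<in>Y. \<Sum>y\<in>U. c x * c y * of_bool (E x y))"
    using fin by (intro sum.mono_neutral_right) (auto dest: outside simp: Y_def intro!: sum.neutral)
  also have "\<dots> = (\<Sum>x\<in>Y. \<Sum>y\<in>Y. c x * c y * of_bool (E x y))"
    using fin by (intro sum.cong refl sum.mono_neutral_right) (auto dest: outside simp: Y_def)
  also have "\<dots> = (\<Sum>x\<in>Y. \<Sum>y\<in>Y. c x * c y * of_bool (cl x = cl y))"
    using cl by (intro sum.cong refl) auto
  also have "\<dots> = (\<Sum>x\<in>Y. \<Sum>y\<in>Y. \<Sum>q\<in>cl ` Y. (c x * of_bool (cl x = q)) * (c y * of_bool (cl y = q)))"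
  proof (intro sum.cong refl)
    fix x y assume xy: "x \<in> Y" "y \<in> Y"
    have "(\<Sum>q\<in>cl ` Y. (c x * of_bool (cl x = q)) * (c y * of_bool (cl y = q)))
        = (\<Sum>q\<in>cl ` Y. if cl x = q then c x * c y * of_bool (cl x = cl y) else 0)"
      by (intro sum.cong refl) auto
    then show "c x * c y * of_bool (cl x = cl y) =
        (\<Sum>q\<in>cl ` Y. (c x * of_bool (cl x = q)) * (c y * of_bool (cl y = q)))"
      using xy finY by simp
  qed
  \<comment> \<open>Each class contributes the square of its total mass.\<close>
  also have "\<dots> = (\<Sum>q\<in>cl ` Y. (\<Sum>x\<in>Y. c x * of_bool (cl x = q)) * (\<Sum>y\<in>Y. c y * of_bool (cl y = q)))"
    apply (subst sum.swap[of _ "Y" "cl ` Y", symmetric])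
    apply (simp only: sum_product)
    apply (subst sum.swap[of _ "cl ` Y" Y])
    apply (rule refl)
    done
  also have "\<dots> \<ge> 0" by (intro sum_nonneg) simp
  finally show ?thesis .
qed

text \<open>Induction on the number of values of \<open>k\<close>. Truncating at the second largest
  value \<open>M'\<close> loses one value, and \<open>k\<close> is its truncation plus the constant
  \<open>M - M'\<close> minus \<open>M - M'\<close> times the indicator of
  \<open>k x y \<le> M'\<close>. Mass 0 kills the constant, and the indicator is a block form, hence
  nonnegative.\<close>

lemma ultrametric_kernel_nonpos:
  fixes k :: "'x \<Rightarrow> 'x \<Rightarrow> real" and c :: "'x \<Rightarrow> real"
  assumes fin: "finite U" and c: "(\<Sum>x\<in>U. c x) = 0"
    and sym: "\<And>x y. \<lbrakk>x \<in> U; y \<in> U\<rbrakk> \<Longrightarrow> k x y = k y x"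
    and ultra: "\<And>x y z. \<lbrakk>x \<in> U; y \<in> U; z \<in> U\<rbrakk> \<Longrightarrow> k x z \<le> max (k x y) (k y z)"
  shows "(\<Sum>x\<in>U. \<Sum>y\<in>U. c x * c y * k x y) \<le> 0"
  using sym ultra
proof (induction "card (case_prod k ` (U \<times> U))" arbitrary: k rule: less_induct)
  case less
  define V where "V = case_prod k ` (U \<times> U)"
  have finV: "finite V" using fin by (simp add: V_def)
  have kV: "k x y \<in> V" if "x \<in> U" "y \<in> U" for x y
    using that by (auto simp: V_def)
  have const: "(\<Sum>x\<in>U. \<Sum>y\<in>U. c x * c y * t) = 0" for t
  proof -
    have "(\<Sum>x\<in>U. \<Sum>y\<in>U. c x * c y * t) = (\<Sum>x\<in>U. c x * t * (\<Sum>y\<in>U. c y))"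
      by (simp only: sum_distrib_left mult.assoc mult.commute mult.left_commute)
    then show ?thesis using c by simp
  qed
  show ?case
  proof (cases "\<exists>t. V \<subseteq> {t}")
    case True
    then obtain t where t: "V \<subseteq> {t}" by blast
    have "(\<Sum>x\<in>U. \<Sum>y\<in>U. c x * c y * k x y) = (\<Sum>x\<in>U. \<Sum>y\<in>U. c x * c y * t)"
    proof (intro sum.cong refl)
      fix x y assume "x \<in> U" "y \<in> U"
      then have "k x y = t" using kV t by blast
      then show "c x * c y * k x y = c x * c y * t" by simp
    qed
    then show ?thesis using const by simp
  next
    case False
    define M where "M = Max V"
    define M' where "M' = Max (V - {M})"
    have "V \<noteq> {}" using False by auto
    then have M: "M \<in> V" "\<And>v. v \<in> V \<Longrightarrow> v \<le> M" using finV by (auto simp: M_def)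
    have ne: "V - {M} \<noteq> {}" using False by blast
    then have M': "M' \<in> V - {M}" "\<And>v. v \<in> V - {M} \<Longrightarrow> v \<le> M'"
      using finV Max_in[of "V - {M}"] by (auto simp: M'_def)
    have lt: "M' < M" using M M' by force
    define k' where "k' x y = min (k x y) M'" for x y
    have "case_prod k' ` (U \<times> U) \<subseteq> V - {M}"
    proof
      fix v assume "v \<in> case_prod k' ` (U \<times> U)"
      then obtain x y where xy: "x \<in> U" "y \<in> U" "v = min (k x y) M'"
        by (auto simp: k'_def)
      then show "v \<in> V - {M}"
        using kV[OF xy(1,2)] M' lt by (cases "k x y = M") (auto simp: min_def)
    qed
    then have "card (case_prod k' ` (U \<times> U)) \<le> card (V - {M})"
      using finV by (intro card_mono) auto
    also have "\<dots> < card V" using finV M by (intro card_Diff1_less) auto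
    finally have "(\<Sum>x\<in>U. \<Sum>y\<in>U. c x * c y * k' x y) \<le> 0"
    proof (intro less.hyps)
      show "k' x y = k' y x" if "x \<in> U" "y \<in> U" for x y
        using less.prems(1)[OF that] by (simp add: k'_def)
      show "k' x z \<le> max (k' x y) (k' y z)" if "x \<in> U" "y \<in> U" "z \<in> U" for x y z
        using less.prems(2)[OF that] by (auto simp: k'_def)
    qed (simp add: V_def)
    moreover have "0 \<le> (\<Sum>x\<in>U. \<Sum>y\<in>U. c x * c y * of_bool (k x y \<le> M'))"
    proof (intro block_sum_nonneg fin)
      show "k y x \<le> M'" if "x \<in> U" "y \<in> U" "k x y \<le> M'" for x y
        using less.prems(1)[of x y] that by simp
      show "k x z \<le> M'" if "x \<in> U" "y \<in> U" "z \<in> U" "k x y \<le> M'" "k y z \<le> M'" for x y z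
        using less.prems(2)[of x y z] that by simp
    qed
    then have "0 \<le> (M - M') * (\<Sum>x\<in>U. \<Sum>y\<in>U. c x * c y * of_bool (k x y \<le> M'))"
      using lt by (intro mult_nonneg_nonneg) auto
    moreover have "(\<Sum>x\<in>U. \<Sum>y\<in>U. c x * c y * k x y)
        = (\<Sum>x\<in>U. \<Sum>y\<in>U. c x * c y * k' x y) + (\<Sum>x\<in>U. \<Sum>y\<in>U. c x * c y * (M - M'))
          - (M - M') * (\<Sum>x\<in>U. \<Sum>y\<in>U. c x * c y * of_bool (k x y \<le> M'))"
    proof -
      have "k x y = k' x y + (M - M') - (M - M') * of_bool (k x y \<le> M')" if "x \<in> U" "y \<in> U" for x y
        using kV[OF that] M M' lt unfolding k'_def by (cases "k x y = M") (auto simp: min_def)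
      then have "(\<Sum>x\<in>U. \<Sum>y\<in>U. c x * c y * k x y) = (\<Sum>x\<in>U. \<Sum>y\<in>U. c x * c y * k' x y
           + c x * c y * (M - M') - (M - M') * (c x * c y * of_bool (k x y \<le> M')))"
        by (intro sum.cong refl) (metis (no_types, opaque_lifting) distrib_left mult.left_commute right_diff_distrib)
      then show ?thesis
        by (simp only: sum.distrib sum_subtractf sum_distrib_left)
    qed
    ultimately show ?thesis using const[of "M - M'"] by linarith
  qed
qed

section \<open>Logarithmic energies of finitely supported measures\<close>

definition energy :: "'x set \<Rightarrow> ('x \<Rightarrow> 'x \<Rightarrow> real) \<Rightarrow> ('x \<Rightarrow> real) \<Rightarrow> ('x \<Rightarrow> real) \<Rightarrow> real" where
  "energy U k f g = (\<Sum>x\<in>U. \<Sum>y\<in>U. f x * g y * k x y)"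

text \<open>The points are an indexed family, so that multiple roots keep their
  multiplicity.\<close>

definition empirical :: "'i set \<Rightarrow> ('i \<Rightarrow> 'x) \<Rightarrow> 'x \<Rightarrow> real" where
  "empirical A p x = (\<Sum>i\<in>A. of_bool (p i = x)) / real (card A)"

lemma sum_empirical:
  assumes "finite U" "p ` A \<subseteq> U"
  shows "(\<Sum>x\<in>U. empirical A p x * f x) = (\<Sum>i\<in>A. f (p i)) / real (card A)"
proof -
  have "(\<Sum>x\<in>U. empirical A p x * f x) = (\<Sum>x\<in>U. \<Sum>i\<in>A. of_bool (p i = x) * f x) / real (card A)"
    by (simp add: empirical_def sum_divide_distrib sum_distrib_right)
  also have "(\<Sum>x\<in>U. \<Sum>i\<in>A. of_bool (p i = x) * f x) = (\<Sum>i\<in>A. \<Sum>x\<in>U. of_bool (p i = x) * f x)"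
    by (rule sum.swap)
  also have "\<dots> = (\<Sum>i\<in>A. f (p i))"
  proof (intro sum.cong refl)
    fix i assume "i \<in> A"
    have "(\<Sum>x\<in>U. of_bool (p i = x) * f x) = (\<Sum>x\<in>U. if p i = x then f x else 0)"
      by (intro sum.cong refl) auto
    then show "(\<Sum>x\<in>U. of_bool (p i = x) * f x) = f (p i)"
      using assms \<open>i \<in> A\<close> by (simp add: image_subset_iff)
  qed
  finally show ?thesis .
qed

lemma sum_empirical_1:
  assumes "finite U" "p ` A \<subseteq> U" "finite A" "A \<noteq> {}"
  shows "(\<Sum>x\<in>U. empirical A p x) = 1"
  using sum_empirical[OF assms(1,2), of "\<lambda>_. 1"] assms by simp

lemma energy_empirical:
  assumes "finite U" "p ` A \<subseteq> U" "q ` B \<subseteq> U"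
  shows "energy U k (empirical A p) (empirical B q)
    = (\<Sum>i\<in>A. (\<Sum>j\<in>B. k (p i) (q j)) / real (card B)) / real (card A)"
proof -
  have "energy U k (empirical A p) (empirical B q)
      = (\<Sum>x\<in>U. empirical A p x * (\<Sum>y\<in>U. empirical B q y * k x y))"
    by (simp add: energy_def sum_distrib_left mult.assoc)
  also have "\<dots> = (\<Sum>x\<in>U. empirical A p x * ((\<Sum>j\<in>B. k x (q j)) / real (card B)))"
    using assms by (simp only: sum_empirical)
  also have "\<dots> = (\<Sum>i\<in>A. (\<Sum>j\<in>B. k (p i) (q j)) / real (card B)) / real (card A)"
    using assms by (simp only: sum_empirical)
  finally show ?thesis .
qed

lemma energy_add_left: "energy U k (\<lambda>x. f x + g x) h = energy U k f h + energy U k g h"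
  and energy_add_right: "energy U k h (\<lambda>x. f x + g x) = energy U k h f + energy U k h g"
  and energy_scale_left: "energy U k (\<lambda>x. t * f x) h = t * energy U k f h"
  and energy_scale_right: "energy U k h (\<lambda>x. t * f x) = t * energy U k h f"
  by (simp_all add: energy_def algebra_simps sum.distrib sum_distrib_left)

lemma energy_commute:
  assumes "\<And>x y. \<lbrakk>x \<in> U; y \<in> U\<rbrakk> \<Longrightarrow> k x y = k y x"
  shows "energy U k f g = energy U k g f"
proof -
  have "energy U k f g = (\<Sum>y\<in>U. \<Sum>x\<in>U. f x * g y * k x y)"
    unfolding energy_def by (rule sum.swap)
  also have "\<dots> = energy U k g f"
    unfolding energy_def using assms by (intro sum.cong refl) (simp add: mult.commute)
  finally show ?thesis .
qed

text \<open>This says that \<open>- energy\<close> is nonnegative at \<open>f - (a + b) / 2\<close>, a measure of mass \<open>0\<close>.\<close>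

lemma energy_midpoint:
  assumes fin: "finite U"
    and sym: "\<And>x y. \<lbrakk>x \<in> U; y \<in> U\<rbrakk> \<Longrightarrow> k x y = k y x"
    and ultra: "\<And>x y z. \<lbrakk>x \<in> U; y \<in> U; z \<in> U\<rbrakk> \<Longrightarrow> k x z \<le> max (k x y) (k y z)"
    and mass: "(\<Sum>x\<in>U. f x) = 1" "(\<Sum>x\<in>U. a x) = 1" "(\<Sum>x\<in>U. b x) = 1"
    and self: "energy U k a a = 0" "energy U k b b = 0"
  shows "energy U k f f \<le> energy U k f a + energy U k f b - energy U k a b / 2"
proof -
  note comm = energy_commute[of U k, OF sym]
  define c where "c = (\<lambda>x. f x + ((-1/2) * a x + (-1/2) * b x))"
  have "(\<Sum>x\<in>U. c x) = 0"
    using mass unfolding c_def sum.distrib sum_distrib_left[symmetric] by simp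
  then have "energy U k c c \<le> 0"
    unfolding energy_def using fin sym ultra by (intro ultrametric_kernel_nonpos) auto
  then show ?thesis
    unfolding c_def energy_add_left energy_add_right energy_scale_left energy_scale_right
    using self comm[of a f] comm[of b f] comm[of b a]
    by (simp add: algebra_simps)
qed

text \<open>The form \<open>- energy\<close> is semidefinite on measures of mass 0; this is its
  Cauchy-Schwarz inequality for \<open>t\<close> and \<open>a - b\<close>. Since \<open>a\<close>
  and \<open>b\<close> have energy 0, the form takes the value \<open>2 * energy U k a b\<close> at
  \<open>a - b\<close>.\<close>

lemma energy_Cauchy_Schwarz:
  assumes fin: "finite U"
    and sym: "\<And>x y. \<lbrakk>x \<in> U; y \<in> U\<rbrakk> \<Longrightarrow> k x y = k y x"
    and ultra: "\<And>x y z. \<lbrakk>x \<in> U; y \<in> U; z \<in> U\<rbrakk> \<Longrightarrow> k x z \<le> max (k x y) (k y z)"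
    and mass: "(\<Sum>x\<in>U. a x) = 1" "(\<Sum>x\<in>U. b x) = 1" "(\<Sum>x\<in>U. t x) = 0"
    and self: "energy U k a a = 0" "energy U k b b = 0" and neg: "energy U k t t < 0"
  shows "(energy U k t a - energy U k t b)\<^sup>2 \<le> 2 * energy U k a b * (- energy U k t t)"
proof -
  define B where "B = energy U k t a - energy U k t b"
  define C where "C = - energy U k t t"
  \<comment> \<open>The maximiser of \<open>energy U k c c\<close>, a quadratic polynomial in
    \<open>s\<close>.\<close>
  define s where "s = B / C"
  define c where "c = (\<lambda>x. a x + ((-1) * b x + s * t x))"
  note comm = energy_commute[of U k, OF sym]
  have C: "C > 0" using neg by (simp add: C_def)
  have C_def': "energy U k t t = - C" and B': "energy U k t a = B + energy U k t b"
    by (simp_all add: C_def B_def)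
  have "(\<Sum>x\<in>U. c x) = 0"
    using mass unfolding c_def sum.distrib sum_distrib_left[symmetric] by simp
  then have "energy U k c c \<le> 0"
    unfolding energy_def using fin sym ultra by (intro ultrametric_kernel_nonpos) auto
  then have "- 2 * energy U k a b + 2 * s * B - s\<^sup>2 * C \<le> 0"
    unfolding c_def energy_add_left energy_add_right energy_scale_left energy_scale_right
    using self comm[of a t] comm[of b t] comm[of b a]
    by (simp add: algebra_simps B_def[symmetric] C_def' power2_eq_square B')
  then have "B\<^sup>2 / C \<le> 2 * energy U k a b"
    using C by (simp add: s_def power2_eq_square field_simps)
  then show ?thesis using C by (simp add: B_def[symmetric] C_def[symmetric] field_simps)
qed


section \<open>Root measures in ultrametric spaces\<close>

locale ultrametric =
  fixes U :: "'a set" and \<delta> :: "'a \<Rightarrow> 'a \<Rightarrow> real"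
  assumes nonneg: "\<lbrakk>x \<in> U; y \<in> U\<rbrakk> \<Longrightarrow> 0 \<le> \<delta> x y"
    and refl: "x \<in> U \<Longrightarrow> \<delta> x x = 0"
    and commute: "\<lbrakk>x \<in> U; y \<in> U\<rbrakk> \<Longrightarrow> \<delta> x y = \<delta> y x"
    and ultra: "\<lbrakk>x \<in> U; y \<in> U; z \<in> U\<rbrakk> \<Longrightarrow> \<delta> x z \<le> max (\<delta> x y) (\<delta> y z)"
begin

text \<open>Points at distance at most \<open>t\<close> are indistinguishable for distances
  truncated from below at \<open>t\<close>.\<close>

lemma isosceles:
  assumes "x \<in> U" "y \<in> U" "z \<in> U" "\<delta> x y \<le> t"
  shows "max (\<delta> x z) t = max (\<delta> y z) t"
  using ultra[of x y z] ultra[of y x z] commute[of x y] assms by auto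

text \<open>The disc of radius \<open>r l\<close> about \<open>a l\<close> is a component of the set where the monic polynomial with
  roots \<open>a\<close> has absolute value at most \<open>1\<close>.\<close>

definition balanced :: "nat \<Rightarrow> (nat \<Rightarrow> 'a) \<Rightarrow> (nat \<Rightarrow> real) \<Rightarrow> bool" where
  "balanced N a r \<longleftrightarrow>
     (\<forall>l<N. a l \<in> U \<and> 0 < r l \<and> (\<Prod>j<N. max (\<delta> (a l) (a j)) (r l)) = 1)"

lemma prod_max_strict_mono:
  fixes N :: nat
  assumes "l < N" "\<delta> x (a l) < t" "0 < s" "s < t"
  shows "(\<Prod>j<N. max (\<delta> x (a j)) s) < (\<Prod>j<N. max (\<delta> x (a j)) t)"
proof -
  have "(\<Prod>j<N. max (\<delta> x (a j)) u)
      = max (\<delta> x (a l)) u * (\<Prod>j\<in>{..<N} - {l}. max (\<delta> x (a j)) u)" for u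
    using assms(1) by (intro prod.remove) auto
  moreover have "(\<Prod>j\<in>{..<N} - {l}. max (\<delta> x (a j)) s) \<le> (\<Prod>j\<in>{..<N} - {l}. max (\<delta> x (a j)) t)"
    using assms by (intro prod_mono) auto
  moreover have "0 < (\<Prod>j\<in>{..<N} - {l}. max (\<delta> x (a j)) s)"
    using assms by (intro prod_pos) auto
  ultimately show ?thesis
    using assms by (auto intro!: mult_strict_mono' mult_less_le_imp_less)
qed

text \<open>The product is continuous in the radius, vanishes at 0 because of the factor
  \<open>j = l\<close>, and is at least 1 at 1. The intermediate value theorem gives the
  radius.\<close>

lemma balanced_exists:
  fixes N :: nat
  assumes "\<And>l. l < N \<Longrightarrow> a l \<in> U"
  shows "\<exists>r. balanced N a r"
proof -
  have "\<exists>r>0. (\<Prod>j<N. max (\<delta> (a l) (a j)) r) = 1" if l: "l < N" for l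
  proof -
    define f where "f r = (\<Prod>j<N. max (\<delta> (a l) (a j)) r)" for r
    have "f 0 = 0"
      using l assms refl[of "a l"] unfolding f_def by (intro prod_zero) force+
    moreover have "1 \<le> f 1"
      unfolding f_def by (intro prod_ge_1) auto
    moreover have "continuous_on {0..1} f"
      unfolding f_def by (intro continuous_intros)
    ultimately obtain r where "0 \<le> r" "f r = 1"
      using IVT'[of f 0 1 1] by auto
    moreover have "r \<noteq> 0" using \<open>f 0 = 0\<close> \<open>f r = 1\<close> by auto
    ultimately show ?thesis by (auto simp: f_def intro!: exI[of _ r])
  qed
  then have "\<exists>r. \<forall>l. l < N \<longrightarrow> r l > 0 \<and> (\<Prod>j<N. max (\<delta> (a l) (a j)) (r l)) = 1"
    by (intro choice) auto
  then show ?thesis using assms by (auto simp: balanced_def)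
qed

context
  fixes N a r assumes bal: "balanced N a r"
begin

lemma balancedD: "l < N \<Longrightarrow> a l \<in> U" "l < N \<Longrightarrow> 0 < r l"
  "l < N \<Longrightarrow> (\<Prod>j<N. max (\<delta> (a l) (a j)) (r l)) = 1"
  using bal by (auto simp: balanced_def)

lemma balanced_unique:
  assumes "l < N" "t > 0" "(\<Prod>j<N. max (\<delta> (a l) (a j)) t) = 1"
  shows "t = r l"
  using prod_max_strict_mono[of l N "a l" a t "r l"] prod_max_strict_mono[of l N "a l" a "r l" t]
    balancedD[of l] refl[of "a l"] assms by (cases t "r l" rule: linorder_cases) auto

lemma balanced_le_1:
  assumes "l < N"
  shows "r l \<le> 1"
proof (rule ccontr)
  assume "\<not> r l \<le> 1"
  then have "1 < r l" "0 < r l" by simp_all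
  then have "(\<Prod>j<N. max (\<delta> (a l) (a j)) 1) < 1"
    using prod_max_strict_mono[of l N "a l" a "r l" 1, OF assms] balancedD(3)[OF assms]
      refl[OF balancedD(1)[OF assms]] by linarith
  moreover have "1 \<le> (\<Prod>j<N. max (\<delta> (a l) (a j)) 1)"
    by (intro prod_ge_1) auto
  ultimately show False by simp
qed

text \<open>Both centres give the same product at radius \<open>r l\<close>, and the normalising
  radius of a centre is unique. Hence a disc that contains another root is also the disc of that
  root.\<close>

lemma balanced_same_radius:
  assumes "l < N" "j < N" "\<delta> (a l) (a j) \<le> r l"
  shows "r j = r l"
proof -
  have "(\<Prod>i<N. max (\<delta> (a j) (a i)) (r l)) = (\<Prod>i<N. max (\<delta> (a l) (a i)) (r l))"
    using assms balancedD by (intro prod.cong isosceles) (auto simp: commute)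
  then show ?thesis
    using balanced_unique[of j "r l"] balancedD[of l] assms by simp
qed

text \<open>The factors agree one by one with those that normalise the disc of \<open>a l\<close>. A
  root inside this disc has the same radius. A root outside it is farther away than its own radius,
  and moving from \<open>a l\<close> to \<open>z\<close> does not change the distance to it.\<close>

lemma balanced_in_disc:
  assumes l: "l < N" and z: "z \<in> U" "\<delta> z (a l) \<le> r l"
  shows "(\<Prod>j<N. max (\<delta> z (a j)) (r j)) = 1"
proof -
  have "max (\<delta> z (a j)) (r j) = max (\<delta> (a l) (a j)) (r l)" if j: "j < N" for j
  proof (cases "\<delta> (a l) (a j) \<le> r l")
    case True
    then have "r j = r l" using balanced_same_radius l j by blast
    then show ?thesis
      using isosceles[of z "a l" "a j" "r l"] balancedD l j z by auto
  next
    case False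
    have "r j < \<delta> (a l) (a j)"
    proof (rule ccontr)
      assume *: "\<not> r j < \<delta> (a l) (a j)"
      then have "r l = r j" using balanced_same_radius[of j l] l j commute balancedD by auto
      then show False using False * by simp
    qed
    moreover have "\<delta> z (a j) = \<delta> (a l) (a j)"
      using ultra[of z "a l" "a j"] ultra[of "a l" z "a j"] commute[of z "a l"] False z balancedD l j
      by auto
    ultimately show ?thesis using False by simp
  qed
  then show ?thesis using balancedD l by simp
qed

text \<open>Inside a disc the truncated product is 1 and bounds the product of the distances.
  Outside all discs the radii have no effect, and comparison with the nearest root
  \<open>a l\<close> shows that the product of the distances is at least the normalised product at
  \<open>a l\<close>, which is 1.\<close>

lemma balanced_potential:
  assumes z: "z \<in> U"
  shows "(\<Prod>j<N. max (\<delta> z (a j)) (r j)) = max 1 (\<Prod>j<N. \<delta> z (a j))"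
proof (cases "\<exists>l<N. \<delta> z (a l) \<le> r l")
  case True
  then obtain l where l: "l < N" "\<delta> z (a l) \<le> r l" by blast
  have "(\<Prod>j<N. \<delta> z (a j)) \<le> (\<Prod>j<N. max (\<delta> z (a j)) (r j))"
    using nonneg z balancedD by (intro prod_mono) auto
  then show ?thesis using balanced_in_disc l z by simp
next
  case False
  then have out: "r l < \<delta> z (a l)" if "l < N" for l using that by force
  have "1 \<le> (\<Prod>j<N. \<delta> z (a j))"
  proof (cases "N = 0")
    case False
    then have ne: "(\<lambda>l. \<delta> z (a l)) ` {..<N} \<noteq> {}" by auto
    obtain l where l: "l < N" "\<And>j. j < N \<Longrightarrow> \<delta> z (a l) \<le> \<delta> z (a j)"
      using Min_in[OF _ ne] Min_le[of "(\<lambda>l. \<delta> z (a l)) ` {..<N}"] by fastforce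
    have "(\<Prod>j<N. max (\<delta> (a l) (a j)) (r l)) \<le> (\<Prod>j<N. \<delta> z (a j))"
    proof (intro prod_mono conjI)
      fix j assume j: "j \<in> {..<N}"
      show "max (\<delta> (a l) (a j)) (r l) \<le> \<delta> z (a j)"
        using ultra[of "a l" z "a j"] commute[of z "a l"] l(2)[of j] out[OF l(1)] l(1) j z balancedD by auto
      show "0 \<le> max (\<delta> (a l) (a j)) (r l)" using l j balancedD(2)[of l] by auto
    qed
    then show ?thesis using balancedD l by simp
  qed simp
  moreover have "max (\<delta> z (a j)) (r j) = \<delta> z (a j)" if "j < N" for j
    using out[OF that] by simp
  then have "(\<Prod>j<N. max (\<delta> z (a j)) (r j)) = (\<Prod>j<N. \<delta> z (a j))"
    by simp
  ultimately show ?thesis by simp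
qed

text \<open>The radius \<open>r l\<close> may be dropped from each factor: a root within distance
  \<open>r l\<close> has this radius itself, and any other is farther away. So the potential of the
  root measure vanishes on each of its own discs, which makes its energy 0.\<close>

lemma balanced_self:
  assumes l: "l < N"
  shows "(\<Prod>j<N. max (\<delta> (a l) (a j)) (max (r l) (r j))) = 1"
proof -
  have "max (\<delta> (a l) (a j)) (max (r l) (r j)) = max (\<delta> (a l) (a j)) (r j)" if j: "j < N" for j
    using balanced_same_radius[of l j] l j by (cases "\<delta> (a l) (a j) \<le> r l") auto
  then show ?thesis
    using balanced_in_disc[of l "a l"] balancedD[of l] refl[of "a l"] l by simp
qed

text \<open>Otherwise a point of the disc at generic distance from \<open>z\<close> would have a larger truncated
  absolute value than \<open>z\<close>.\<close>

lemma balanced_potential_disc: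
  assumes z: "z \<in> U" and s: "s > 0"
    and const: "\<And>u. \<lbrakk>u \<in> U; \<delta> z u \<le> s\<rbrakk> \<Longrightarrow>
      max 1 (\<Prod>j<N. \<delta> u (a j)) = max 1 (\<Prod>j<N. \<delta> z (a j))"
    and dense: "\<And>t. \<lbrakk>0 \<le> t; t < s\<rbrakk> \<Longrightarrow> \<exists>u\<in>U. t < \<delta> z u \<and> \<delta> z u < s"
  shows "(\<Prod>j<N. max (\<delta> z (a j)) (max s (r j))) = max 1 (\<Prod>j<N. \<delta> z (a j))"
proof -
  have "s \<le> max (\<delta> z (a l)) (r l)" if l: "l < N" for l
  proof (rule ccontr)
    assume "\<not> ?thesis"
    then have lt: "max (\<delta> z (a l)) (r l) < s" by linarith
    \<comment> \<open>\<open>V\<close> collects distances to be avoided. If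
      \<open>\<delta> z u\<close> lies strictly between \<open>Max V\<close> and \<open>s\<close>,
      no root is at this distance from \<open>z\<close>, so each distance from \<open>u\<close> to a
      root is the larger of the two others. Then no factor shrinks and the one at \<open>l\<close>
      grows.\<close>
    define V where "V = insert (max (\<delta> z (a l)) (r l)) {v \<in> (\<lambda>j. \<delta> z (a j)) ` {..<N}. v < s}"
    have V: "finite V" "V \<noteq> {}" by (auto simp: V_def)
    have "Max V < s" using V lt by (auto simp: V_def)
    moreover have "0 \<le> Max V"
      using V balancedD(2)[OF l] Max_ge[of V "max (\<delta> z (a l)) (r l)"] by (auto simp: V_def)
    ultimately obtain u where u: "u \<in> U" "Max V < \<delta> z u" "\<delta> z u < s"
      using dense by blast
    have far: "v < \<delta> z u" if "v \<in> V" for v using that u V Max_ge[of V v] by simp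
    have "\<delta> u (a j) = max (\<delta> z u) (\<delta> z (a j))" if j: "j < N" for j
    proof -
      have "\<delta> z (a j) \<noteq> \<delta> z u"
      proof
        assume "\<delta> z (a j) = \<delta> z u"
        then have "\<delta> z u \<in> V" using u(3) j by (auto simp: V_def image_iff intro!: bexI[of _ j])
        then show False using far by blast
      qed
      then show ?thesis
        using ultra[of u z "a j"] ultra[of z u "a j"] ultra[of z "a j" u] commute[of z u]
          commute[of u "a j"] u z balancedD(1)[OF j] by auto
    qed
    then have ge: "max (\<delta> z (a j)) (r j) \<le> max (\<delta> u (a j)) (r j)" if "j < N" for j
      using that by auto
    have "(\<Prod>j<N. max (\<delta> z (a j)) (r j)) < (\<Prod>j<N. max (\<delta> u (a j)) (r j))"
    proof -
      have "(\<Prod>j<N. max (\<delta> v (a j)) (r j))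
          = max (\<delta> v (a l)) (r l) * (\<Prod>j\<in>{..<N} - {l}. max (\<delta> v (a j)) (r j))" for v
        using l by (intro prod.remove) auto
      moreover have "(\<Prod>j\<in>{..<N} - {l}. max (\<delta> z (a j)) (r j)) \<le> (\<Prod>j\<in>{..<N} - {l}. max (\<delta> u (a j)) (r j))"
        using ge balancedD by (intro prod_mono) (force intro: less_imp_le simp: le_max_iff_disj)
      moreover have "0 < (\<Prod>j\<in>{..<N} - {l}. max (\<delta> z (a j)) (r j))"
        using balancedD by (intro prod_pos) (auto simp: less_max_iff_disj)
      moreover have "max (\<delta> z (a l)) (r l) < max (\<delta> u (a l)) (r l)"
        using far[of "max (\<delta> z (a l)) (r l)"] \<open>\<And>j. j < N \<Longrightarrow> \<delta> u (a j) = max (\<delta> z u) (\<delta> z (a j))\<close>[OF l]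
        by (auto simp: V_def)
      ultimately show ?thesis
        using balancedD(2)[OF l] by (auto intro!: mult_less_le_imp_less simp: less_max_iff_disj)
    qed
    then show False
      using const[of u] u z balanced_potential by simp
  qed
  then have "max (\<delta> z (a j)) (max s (r j)) = max (\<delta> z (a j)) (r j)" if "j < N" for j
    using that by (metis max.absorb2 max.left_commute)
  then have "(\<Prod>j<N. max (\<delta> z (a j)) (max s (r j))) = (\<Prod>j<N. max (\<delta> z (a j)) (r j))"
    by simp
  then show ?thesis using balanced_potential z by simp
qed

end

text \<open>A pair \<open>(x, r)\<close> stands for the closed disc of radius \<open>r\<close> about \<open>x\<close>.\<close>

definition disc_kernel :: "'a \<times> real \<Rightarrow> 'a \<times> real \<Rightarrow> real" where
  "disc_kernel P Q = ln (max (\<delta> (fst P) (fst Q)) (max (snd P) (snd Q)))"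

lemma disc_kernel_commute:
  assumes "P \<in> U \<times> {0<..}" "Q \<in> U \<times> {0<..}"
  shows "disc_kernel P Q = disc_kernel Q P"
  using assms by (auto simp: disc_kernel_def commute max.commute)

lemma disc_kernel_ultra:
  assumes "P \<in> U \<times> {0<..}" "Q \<in> U \<times> {0<..}" "S \<in> U \<times> {0<..}"
  shows "disc_kernel P S \<le> max (disc_kernel P Q) (disc_kernel Q S)"
proof -
  let ?m = "\<lambda>P Q. max (\<delta> (fst P) (fst Q)) (max (snd P) (snd Q))"
  have pos: "0 < ?m P Q" "0 < ?m Q S" "0 < ?m P S"
    using assms by (auto simp: less_max_iff_disj)
  have "?m P S \<le> max (?m P Q) (?m Q S)"
    using assms ultra[of "fst P" "fst Q" "fst S"] by auto
  then have "?m P S \<le> ?m P Q \<or> ?m P S \<le> ?m Q S"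
    by (simp only: le_max_iff_disj)
  then have "ln (?m P S) \<le> ln (?m P Q) \<or> ln (?m P S) \<le> ln (?m Q S)"
    using pos by (metis ln_le_cancel_iff)
  then show ?thesis
    unfolding disc_kernel_def by (simp only: le_max_iff_disj)
qed

lemma sum_disc_kernel:
  fixes N :: nat
  assumes "0 < t" and "\<And>j. j < N \<Longrightarrow> 0 < r j"
  shows "(\<Sum>j<N. disc_kernel (z, t) (a j, r j)) = ln (\<Prod>j<N. max (\<delta> z (a j)) (max t (r j)))"
  using assms unfolding disc_kernel_def by (subst ln_prod) (auto simp: less_max_iff_disj)

lemma root_measure_energy:
  assumes D: "finite D" and c: "balanced N c t" and sub: "(\<lambda>j. (c j, t j)) ` {..<N} \<subseteq> D"
  shows "energy D disc_kernel (empirical {..<N} (\<lambda>j. (c j, t j))) (empirical {..<N} (\<lambda>j. (c j, t j))) = 0"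
proof -
  have "(\<Sum>j<N. disc_kernel (c i, t i) (c j, t j)) = 0" if "i < N" for i
    using balanced_self[OF c that] balancedD[OF c] that by (subst sum_disc_kernel) auto
  then show ?thesis by (subst energy_empirical[OF D sub sub]) simp
qed

text \<open>The energy of \<open>F\<close> relative to the mean of the two root measures is nonnegative; each root
  measure has energy \<open>0\<close> and truncated logarithms as potentials.  The points of \<open>F\<close> are fattened to
  discs of radius \<open>\<epsilon>\<close> to make the diagonal terms finite.\<close>

lemma finite_set_energy:
  fixes a b :: "nat \<Rightarrow> 'a"
  assumes F: "finite F" "F \<noteq> {}" "F \<subseteq> U" "\<And>x y. \<lbrakk>x \<in> F; y \<in> F; x \<noteq> y\<rbrakk> \<Longrightarrow> 0 < \<delta> x y"
    and N: "N > 0" and a: "balanced N a r" and b: "balanced N b s"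
    and \<epsilon>: "0 < \<epsilon>" "\<And>j. j < N \<Longrightarrow> \<epsilon> \<le> r j" "\<And>j. j < N \<Longrightarrow> \<epsilon> \<le> s j"
  defines "J \<equiv> (\<Sum>i<N. \<Sum>j<N. disc_kernel (a i, r i) (b j, s j)) / (real N)\<^sup>2"
  shows "(\<Sum>x\<in>F. \<Sum>y\<in>F - {x}. ln (\<delta> x y)) / (real (card F))\<^sup>2 + ln \<epsilon> / real (card F)
    \<le> (\<Sum>x\<in>F. ln (max 1 (\<Prod>j<N. \<delta> x (a j))) + ln (max 1 (\<Prod>j<N. \<delta> x (b j)))) / (real (card F) * real N)
      - J / 2"
    and "(\<Sum>i<N. ln (max 1 (\<Prod>j<N. \<delta> (a i) (b j)))) \<le> J * (real N)\<^sup>2"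
proof -
  note aD = balancedD[OF a] and bD = balancedD[OF b]
  define pF where "pF x = (x, \<epsilon>)" for x :: 'a
  define pa where "pa j = (a j, r j)" for j
  define pb where "pb j = (b j, s j)" for j
  define D where "D = pF ` F \<union> pa ` {..<N} \<union> pb ` {..<N}"
  have D: "finite D" "D \<subseteq> U \<times> {0<..}" "pF ` F \<subseteq> D" "pa ` {..<N} \<subseteq> D" "pb ` {..<N} \<subseteq> D"
    using F aD bD \<epsilon> by (auto simp: D_def pF_def pa_def pb_def)
  have ne: "{..<N} \<noteq> {}" using N by auto
  let ?f = "empirical F pF" and ?a = "empirical {..<N} pa" and ?b = "empirical {..<N} pb"
  let ?E = "energy D disc_kernel"
  have pot: "?E ?f (empirical {..<N} (\<lambda>j. (c j, t j)))
      = (\<Sum>x\<in>F. ln (max 1 (\<Prod>j<N. \<delta> x (c j)))) / (real (card F) * real N)"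
    if c: "balanced N c t" and sub: "(\<lambda>j. (c j, t j)) ` {..<N} \<subseteq> D"
      and le: "\<And>j. j < N \<Longrightarrow> \<epsilon> \<le> t j" for c t
  proof -
    have "(\<Sum>j<N. disc_kernel (pF x) (c j, t j)) = ln (max 1 (\<Prod>j<N. \<delta> x (c j)))" if "x \<in> F" for x
    proof -
      \<comment> \<open>As \<open>\<epsilon>\<close> is at most every radius, fattening the points
        of \<open>F\<close> does not change the potentials of the root measures there.\<close>
      have "(\<Prod>j<N. max (\<delta> x (c j)) (max \<epsilon> (t j))) = (\<Prod>j<N. max (\<delta> x (c j)) (t j))"
        using le by (simp add: max.absorb2)
      then show ?thesis
        using balanced_potential[OF c, of x] balancedD[OF c] that F \<epsilon> unfolding pF_def
        by (subst sum_disc_kernel) auto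
    qed
    then show ?thesis
      by (subst energy_empirical[OF D(1) D(3) sub])
        (simp add: sum_divide_distrib mult.commute)
  qed
  have Jeq: "J = ?E ?a ?b"
    unfolding J_def energy_empirical[OF D(1,4,5)]
    by (simp add: sum_divide_distrib power2_eq_square pa_def pb_def)
  have mid: "?E ?f ?f \<le> ?E ?f ?a + ?E ?f ?b - ?E ?a ?b / 2"
  proof (rule energy_midpoint[OF D(1)])
    show "disc_kernel P Q = disc_kernel Q P" if "P \<in> D" "Q \<in> D" for P Q
      using that D(2) by (intro disc_kernel_commute) auto
    show "disc_kernel P S \<le> max (disc_kernel P Q) (disc_kernel Q S)" if "P \<in> D" "Q \<in> D" "S \<in> D" for P Q S
      using that D(2) by (intro disc_kernel_ultra) auto
    show "sum ?f D = 1" "sum ?a D = 1" "sum ?b D = 1"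
      using F ne D by (simp_all add: sum_empirical_1)
    show "?E ?a ?a = 0" "?E ?b ?b = 0"
      using root_measure_energy[OF _ a] root_measure_energy[OF _ b] D by (simp_all add: pa_def[abs_def] pb_def[abs_def])
  qed
  \<comment> \<open>Fattening can only increase the terms off the diagonal; each diagonal term is
    exactly \<open>ln \<epsilon>\<close>.\<close>
  have "(\<Sum>x\<in>F. \<Sum>y\<in>F - {x}. ln (\<delta> x y)) + real (card F) * ln \<epsilon>
      \<le> (\<Sum>x\<in>F. \<Sum>y\<in>F. disc_kernel (pF x) (pF y))"
  proof -
    have "(\<Sum>y\<in>F - {x}. ln (\<delta> x y)) + ln \<epsilon> \<le> (\<Sum>y\<in>F. disc_kernel (pF x) (pF y))" if x: "x \<in> F" for x
    proof -
      have "(\<Sum>y\<in>F - {x}. ln (\<delta> x y)) \<le> (\<Sum>y\<in>F - {x}. disc_kernel (pF x) (pF y))"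
        using F x \<epsilon> by (intro sum_mono) (force simp: disc_kernel_def pF_def less_max_iff_disj)
      moreover have "disc_kernel (pF x) (pF x) = ln \<epsilon>"
        using x F \<epsilon> refl[of x] by (auto simp: disc_kernel_def pF_def)
      ultimately show ?thesis using F x by (subst sum.remove[of F x]) auto
    qed
    then have "(\<Sum>x\<in>F. (\<Sum>y\<in>F - {x}. ln (\<delta> x y)) + ln \<epsilon>) \<le> (\<Sum>x\<in>F. \<Sum>y\<in>F. disc_kernel (pF x) (pF y))"
      by (intro sum_mono)
    then show ?thesis by (simp add: sum.distrib)
  qed
  then have "((\<Sum>x\<in>F. \<Sum>y\<in>F - {x}. ln (\<delta> x y)) + real (card F) * ln \<epsilon>) / (real (card F))\<^sup>2 \<le> ?E ?f ?f"
    unfolding energy_empirical[OF D(1,3,3)]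
    by (simp add: sum_divide_distrib[symmetric] power2_eq_square divide_right_mono)
  moreover have "real (card F) * ln \<epsilon> / (real (card F))\<^sup>2 = ln \<epsilon> / real (card F)"
    by (simp add: power2_eq_square)
  ultimately have "(\<Sum>x\<in>F. \<Sum>y\<in>F - {x}. ln (\<delta> x y)) / (real (card F))\<^sup>2 + ln \<epsilon> / real (card F) \<le> ?E ?f ?f"
    by (simp add: add_divide_distrib)
  then show "(\<Sum>x\<in>F. \<Sum>y\<in>F - {x}. ln (\<delta> x y)) / (real (card F))\<^sup>2 + ln \<epsilon> / real (card F)
    \<le> (\<Sum>x\<in>F. ln (max 1 (\<Prod>j<N. \<delta> x (a j))) + ln (max 1 (\<Prod>j<N. \<delta> x (b j)))) / (real (card F) * real N)
      - J / 2"
    using mid pot[OF a] pot[OF b] D(4,5) \<epsilon>(2,3) Jeq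
    by (simp add: pa_def[abs_def] pb_def[abs_def] sum.distrib add_divide_distrib)
  \<comment> \<open>Dropping \<open>r i\<close> from the kernel leaves truncated logarithms, which
    are nonnegative. This is the source of the nonnegativity of the mutual energy.\<close>
  have "(\<Sum>i<N. ln (max 1 (\<Prod>j<N. \<delta> (a i) (b j)))) \<le> (\<Sum>i<N. \<Sum>j<N. disc_kernel (a i, r i) (b j, s j))"
  proof (intro sum_mono)
    fix i assume i: "i \<in> {..<N}"
    have "0 < (\<Prod>j<N. max (\<delta> (a i) (b j)) (s j))"
      using bD by (intro prod_pos) (auto simp: less_max_iff_disj)
    moreover have "(\<Prod>j<N. max (\<delta> (a i) (b j)) (s j)) \<le> (\<Prod>j<N. max (\<delta> (a i) (b j)) (max (r i) (s j)))"
      using bD by (intro prod_mono) (force intro: less_imp_le simp: le_max_iff_disj)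
    ultimately have "ln (\<Prod>j<N. max (\<delta> (a i) (b j)) (s j)) \<le> (\<Sum>j<N. disc_kernel (a i, r i) (b j, s j))"
      using aD bD i by (subst sum_disc_kernel) auto
    then show "ln (max 1 (\<Prod>j<N. \<delta> (a i) (b j))) \<le> (\<Sum>j<N. disc_kernel (a i, r i) (b j, s j))"
      using balanced_potential[OF b, of "a i"] aD i by simp
  qed
  then show "(\<Sum>i<N. ln (max 1 (\<Prod>j<N. \<delta> (a i) (b j)))) \<le> J * (real N)\<^sup>2"
    using N by (simp add: J_def)
qed

text \<open>Cauchy-Schwarz with the unit mass on the disc of radius \<open>t\<close> about
  \<open>z\<close> minus the unit mass on the disc of radius \<open>T\<close>. The larger disc
  contains all the roots, so both potentials equal \<open>ln T\<close> there and cancel. The energy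
  of this test measure is \<open>ln t - ln T\<close>.\<close>

lemma potential_difference:
  fixes a b :: "nat \<Rightarrow> 'a"
  assumes z: "z \<in> U" "0 < t" and N: "N > 0" and a: "balanced N a r" and b: "balanced N b s"
    and far: "t < T" "1 \<le> T" "\<And>j. j < N \<Longrightarrow> \<delta> z (a j) \<le> T" "\<And>j. j < N \<Longrightarrow> \<delta> z (b j) \<le> T"
  defines "J \<equiv> (\<Sum>i<N. \<Sum>j<N. disc_kernel (a i, r i) (b j, s j)) / (real N)\<^sup>2"
  shows "((ln (\<Prod>j<N. max (\<delta> z (a j)) (max t (r j))) - ln (\<Prod>j<N. max (\<delta> z (b j)) (max t (s j)))) / real N)\<^sup>2
     \<le> 2 * J * (ln T - ln t)"
proof -
  note aD = balancedD[OF a] and bD = balancedD[OF b]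
  define pa where "pa j = (a j, r j)" for j
  define pb where "pb j = (b j, s j)" for j
  \<comment> \<open>A point mass is the empirical measure of a family with one member.\<close>
  define p where "p S = (\<lambda>_::unit. (z, S))" for S :: real
  define D where "D = {(z, t), (z, T)} \<union> pa ` {..<N} \<union> pb ` {..<N}"
  have D: "finite D" "D \<subseteq> U \<times> {0<..}" "p t ` UNIV \<subseteq> D" "p T ` UNIV \<subseteq> D" "pa ` {..<N} \<subseteq> D" "pb ` {..<N} \<subseteq> D"
    using z far aD bD by (auto simp: D_def p_def pa_def pb_def)
  have ne: "{..<N} \<noteq> {}" using N by auto
  let ?a = "empirical {..<N} pa" and ?b = "empirical {..<N} pb"
  let ?t = "\<lambda>x. empirical UNIV (p t) x + (-1) * empirical UNIV (p T) x"
  let ?E = "energy D disc_kernel"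
  have pot: "?E ?t (empirical {..<N} (\<lambda>j. (c j, r j)))
      = ln (\<Prod>j<N. max (\<delta> z (c j)) (max t (r j))) / real N - ln T"
    if c: "balanced N c r" and sub: "(\<lambda>j. (c j, r j)) ` {..<N} \<subseteq> D"
      and le: "\<And>j. j < N \<Longrightarrow> \<delta> z (c j) \<le> T" for c r
  proof -
    have "max (\<delta> z (c j)) (max T (r j)) = T" if "j < N" for j
      using balanced_le_1[OF c that] le[OF that] far by simp
    then have "(\<Prod>j<N. max (\<delta> z (c j)) (max T (r j))) = T ^ N" by simp
    then have "(\<Sum>j<N. disc_kernel (z, T) (c j, r j)) = real N * ln T"
      using balancedD[OF c] far z by (subst sum_disc_kernel) (auto simp: ln_realpow)
    moreover have "(\<Sum>j<N. disc_kernel (z, t) (c j, r j)) = ln (\<Prod>j<N. max (\<delta> z (c j)) (max t (r j)))"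
      using balancedD[OF c] z by (subst sum_disc_kernel) auto
    ultimately show ?thesis
      unfolding energy_add_left energy_scale_left energy_empirical[OF D(1,3) sub] energy_empirical[OF D(1,4) sub]
      using N by (simp add: p_def)
  qed
  have tt: "?E ?t ?t = ln t - ln T"
    unfolding energy_add_left energy_scale_left energy_add_right energy_scale_right
      energy_empirical[OF D(1,3,3)] energy_empirical[OF D(1,3,4)] energy_empirical[OF D(1,4,3)] energy_empirical[OF D(1,4,4)]
    using far z refl[of z] by (simp add: p_def disc_kernel_def max.absorb1 max.absorb2)
  have Jeq: "J = ?E ?a ?b"
    unfolding J_def energy_empirical[OF D(1,5,6)]
    by (simp add: sum_divide_distrib power2_eq_square pa_def pb_def)
  have "(?E ?t ?a - ?E ?t ?b)\<^sup>2 \<le> 2 * ?E ?a ?b * (- ?E ?t ?t)"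
  proof (rule energy_Cauchy_Schwarz[OF D(1)])
    show "disc_kernel P Q = disc_kernel Q P" if "P \<in> D" "Q \<in> D" for P Q
      using that D(2) by (intro disc_kernel_commute) auto
    show "disc_kernel P S \<le> max (disc_kernel P Q) (disc_kernel Q S)" if "P \<in> D" "Q \<in> D" "S \<in> D" for P Q S
      using that D(2) by (intro disc_kernel_ultra) auto
    show "sum ?a D = 1" "sum ?b D = 1"
      using ne D by (simp_all add: sum_empirical_1)
    show "sum ?t D = 0"
      using sum_empirical_1[OF D(1,3)] sum_empirical_1[OF D(1,4)]
      by (simp only: sum.distrib sum_distrib_left[symmetric]) simp
    show "?E ?a ?a = 0" "?E ?b ?b = 0"
      using root_measure_energy[OF _ a] root_measure_energy[OF _ b] D by (simp_all add: pa_def[abs_def] pb_def[abs_def])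
    show "?E ?t ?t < 0" unfolding tt using far z by simp
  qed
  then show ?thesis
    using pot[OF a] pot[OF b] D(5,6) far(3,4) Jeq unfolding tt
    by (simp add: pa_def[abs_def] pb_def[abs_def] diff_divide_distrib)
qed

end


section \<open>The unicritical family over an ultrametric field\<close>

text \<open>Consecutive quotients differ by at most \<open>C / d ^ Suc n\<close>, and because
  \<open>d \<ge> 2\<close> this is at most \<open>C / d ^ n - C / d ^ Suc n\<close>, so the errors
  telescope. The hypothesis starts at 1 because in the application the bound has to be uniform in
  the parameter, which the step from 0 to 1 does not allow.\<close>

lemma approx_multiplicative_sequence:
  fixes l :: "nat \<Rightarrow> real" and d :: nat
  assumes d: "d \<ge> 2" and step: "\<And>n. n \<ge> 1 \<Longrightarrow> \<bar>l (Suc n) - real d * l n\<bar> \<le> C"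
  shows "convergent (\<lambda>n. l n / real d ^ n)"
    and "n \<ge> 1 \<Longrightarrow> \<bar>l n / real d ^ n - lim (\<lambda>n. l n / real d ^ n)\<bar> \<le> C / real d ^ n"
proof -
  define a where "a n = l n / real d ^ n" for n
  define e where "e n = C / real d ^ n" for n
  have C: "0 \<le> C" using step[of 1] by linarith
  have dist: "\<bar>a m - a n\<bar> \<le> e n - e m" if "1 \<le> n" "n \<le> m" for m n
    using that(2)
  proof (induction m rule: dec_induct)
    case (step m)
    have "a (Suc m) - a m = (l (Suc m) - real d * l m) / real d ^ Suc m"
      using d by (simp add: a_def field_simps)
    then have "\<bar>a (Suc m) - a m\<bar> \<le> C / real d ^ Suc m"
      using assms(2)[of m] step that(1) by (simp add: divide_right_mono)
    also have "\<dots> \<le> e m - e (Suc m)"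
    proof -
      have "C * 2 \<le> C * real d" using C d by (intro mult_left_mono) auto
      then show ?thesis using d by (simp add: e_def field_simps)
    qed
    finally show ?case using step by linarith
  qed simp
  have e0: "e \<longlonglongrightarrow> 0"
    unfolding e_def using d LIMSEQ_divide_realpow_zero[of "real d" C] by simp
  have "Cauchy a"
  proof (rule metric_CauchyI)
    fix \<epsilon> :: real assume "\<epsilon> > 0"
    then have "eventually (\<lambda>n. e n < \<epsilon> / 2) sequentially"
      using e0 by (intro order_tendstoD(2)[OF e0]) auto
    then obtain M where M: "\<And>n. n \<ge> M \<Longrightarrow> e n < \<epsilon> / 2"
      by (auto simp: eventually_sequentially)
    have nonneg: "0 \<le> e n" for n using C by (simp add: e_def)
    show "\<exists>M. \<forall>m\<ge>M. \<forall>n\<ge>M. dist (a m) (a n) < \<epsilon>"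
    proof (intro exI[of _ "max 1 M"] allI impI)
      fix m n assume mn: "m \<ge> max 1 M" "n \<ge> max 1 M"
      show "dist (a m) (a n) < \<epsilon>"
        using dist[of "max 1 M" m] dist[of "max 1 M" n] mn M[of "max 1 M"] nonneg[of m] nonneg[of n]
        by (simp add: dist_real_def)
    qed
  qed
  then have conv: "convergent a" by (simp add: Cauchy_convergent_iff)
  then show "convergent (\<lambda>n. l n / real d ^ n)" by (simp add: a_def[abs_def])
  show "\<bar>l n / real d ^ n - lim (\<lambda>n. l n / real d ^ n)\<bar> \<le> C / real d ^ n" if "n \<ge> 1"
  proof -
    have lim: "a \<longlonglongrightarrow> lim a" using conv by (simp add: convergent_LIMSEQ_iff)
    have "(\<lambda>m. \<bar>a m - a n\<bar>) \<longlonglongrightarrow> \<bar>lim a - a n\<bar>"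
      by (intro tendsto_intros lim)
    moreover have "(\<lambda>m. e n - e m) \<longlonglongrightarrow> e n - 0"
      by (intro tendsto_intros e0)
    ultimately have "\<bar>lim a - a n\<bar> \<le> e n - 0"
      using dist[OF that] by (intro LIMSEQ_le[of _ _ "\<lambda>m. e n - e m"]) auto
    then show ?thesis by (simp add: a_def[abs_def] e_def abs_minus_commute)
  qed
qed

lemma log_plus_nonneg: "0 \<le> log_plus v"
  by (simp add: log_plus_def)

locale ultrametric_field = field R for R (structure) +
  fixes \<nu> :: "'a \<Rightarrow> real"
  assumes abs_value: "absolute_value R (carrier R) \<nu>"
    and abs_add: "\<lbrakk>x \<in> carrier R; y \<in> carrier R\<rbrakk> \<Longrightarrow> \<nu> (x \<oplus> y) \<le> max (\<nu> x) (\<nu> y)"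
begin

lemma abs_nonneg: "x \<in> carrier R \<Longrightarrow> 0 \<le> \<nu> x"
  and abs_eq_0: "x \<in> carrier R \<Longrightarrow> \<nu> x = 0 \<longleftrightarrow> x = \<zero>"
  and abs_mult: "\<lbrakk>x \<in> carrier R; y \<in> carrier R\<rbrakk> \<Longrightarrow> \<nu> (x \<otimes> y) = \<nu> x * \<nu> y"
  using abs_value by (auto simp: absolute_value_def)

lemma abs_pos: "\<lbrakk>x \<in> carrier R; x \<noteq> \<zero>\<rbrakk> \<Longrightarrow> 0 < \<nu> x"
  using abs_nonneg[of x] abs_eq_0[of x] by simp

lemma abs_one: "\<nu> \<one> = 1"
  using abs_mult[of \<one> \<one>] abs_eq_0[of \<one>] one_not_zero by simp

lemma abs_uminus: "x \<in> carrier R \<Longrightarrow> \<nu> (\<ominus> x) = \<nu> x"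
proof -
  assume x: "x \<in> carrier R"
  have "(\<ominus> x) \<otimes> (\<ominus> x) = x \<otimes> x" using x by (simp add: l_minus r_minus)
  then have "(\<nu> (\<ominus> x))\<^sup>2 = (\<nu> x)\<^sup>2"
    using x abs_mult by (metis a_inv_closed power2_eq_square)
  then show ?thesis using abs_nonneg x by (metis a_inv_closed power2_eq_imp_eq)
qed

lemma abs_pow: "x \<in> carrier R \<Longrightarrow> \<nu> (x [^] (n::nat)) = \<nu> x ^ n"
  by (induction n) (simp_all add: abs_one abs_mult mult.commute)

lemma abs_inv: "\<lbrakk>x \<in> carrier R; x \<noteq> \<zero>\<rbrakk> \<Longrightarrow> \<nu> (inv x) = inverse (\<nu> x)"
  using abs_mult[of x "inv x"] abs_one abs_eq_0[of x] field_Units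
  by (simp add: field_simps)

lemma abs_diff_commute: "\<lbrakk>x \<in> carrier R; y \<in> carrier R\<rbrakk> \<Longrightarrow> \<nu> (x \<ominus> y) = \<nu> (y \<ominus> x)"
  using abs_uminus[of "x \<ominus> y"] by (simp add: minus_add minus_eq a_comm)

lemma abs_diff: "\<lbrakk>x \<in> carrier R; y \<in> carrier R\<rbrakk> \<Longrightarrow> \<nu> (x \<ominus> y) \<le> max (\<nu> x) (\<nu> y)"
  using abs_add[of x "\<ominus> y"] by (simp add: minus_eq abs_uminus)

lemma abs_add_dominant:
  assumes "x \<in> carrier R" "y \<in> carrier R" "\<nu> y < \<nu> x"
  shows "\<nu> (x \<oplus> y) = \<nu> x"
proof -
  have "x = (x \<oplus> y) \<ominus> y" using assms by algebra
  then have "\<nu> x \<le> max (\<nu> (x \<oplus> y)) (\<nu> y)"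
    using abs_diff[of "x \<oplus> y" y] assms by simp
  then show ?thesis using abs_add[of x y] assms by auto
qed

lemma abs_le_diff:
  assumes "x \<in> carrier R" "y \<in> carrier R"
  shows "\<nu> y \<le> max (\<nu> x) (\<nu> (y \<ominus> x))"
proof -
  have "y = x \<oplus> (y \<ominus> x)" using assms by algebra
  then show ?thesis using abs_add[of x "y \<ominus> x"] assms by simp
qed

sublocale ultrametric "carrier R" "\<lambda>x y. \<nu> (x \<ominus> y)"
proof
  fix x y z assume xyz: "x \<in> carrier R" "y \<in> carrier R" "z \<in> carrier R"
  have "x \<ominus> z = (x \<ominus> y) \<oplus> (y \<ominus> z)" using xyz by algebra
  then show "\<nu> (x \<ominus> z) \<le> max (\<nu> (x \<ominus> y)) (\<nu> (y \<ominus> z))"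
    using abs_add[of "x \<ominus> y" "y \<ominus> z"] xyz by simp
qed (auto simp: abs_nonneg abs_diff_commute abs_eq_0)

text \<open>The Lipschitz estimate for the power map; the strong triangle inequality removes the
  integer factor \<open>Suc k\<close> of the archimedean version.\<close>

lemma abs_pow_diff:
  assumes x: "x \<in> carrier R" and y: "y \<in> carrier R" and B: "\<nu> x \<le> B" "\<nu> y \<le> B"
  shows "\<nu> (x [^] Suc k \<ominus> y [^] Suc k) \<le> \<nu> (x \<ominus> y) * B ^ k"
proof (induction k)
  case (Suc k)
  have B0: "0 \<le> B" using B abs_nonneg[OF x] by linarith
  have "x [^] Suc (Suc k) \<ominus> y [^] Suc (Suc k)
      = x [^] Suc k \<otimes> (x \<ominus> y) \<oplus> (x [^] Suc k \<ominus> y [^] Suc k) \<otimes> y"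
  proof -
    have "x [^] Suc k \<in> carrier R" "y [^] Suc k \<in> carrier R" using x y by auto
    then have "x [^] Suc k \<otimes> x \<ominus> y [^] Suc k \<otimes> y
      = x [^] Suc k \<otimes> (x \<ominus> y) \<oplus> (x [^] Suc k \<ominus> y [^] Suc k) \<otimes> y"
      using x y by algebra
    then show ?thesis by simp
  qed
  then have "\<nu> (x [^] Suc (Suc k) \<ominus> y [^] Suc (Suc k))
      \<le> max (\<nu> (x [^] Suc k \<otimes> (x \<ominus> y))) (\<nu> ((x [^] Suc k \<ominus> y [^] Suc k) \<otimes> y))"
    using x y by (metis abs_add m_closed minus_closed nat_pow_closed)
  also have "\<dots> \<le> \<nu> (x \<ominus> y) * B ^ Suc k"
  proof (rule max.boundedI)
    have "\<nu> (x [^] Suc k \<otimes> (x \<ominus> y)) = \<nu> (x \<ominus> y) * \<nu> x ^ Suc k"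
      using x y by (simp add: abs_mult abs_pow mult.commute)
    also have "\<dots> \<le> \<nu> (x \<ominus> y) * B ^ Suc k"
      using x y B by (intro mult_left_mono power_mono) (auto simp: abs_nonneg)
    finally show "\<nu> (x [^] Suc k \<otimes> (x \<ominus> y)) \<le> \<nu> (x \<ominus> y) * B ^ Suc k" .
    have "\<nu> ((x [^] Suc k \<ominus> y [^] Suc k) \<otimes> y) = \<nu> (x [^] Suc k \<ominus> y [^] Suc k) * \<nu> y"
      using x y by (intro abs_mult) auto
    also have "\<dots> \<le> (\<nu> (x \<ominus> y) * B ^ k) * B"
      using x y B B0 Suc by (intro mult_mono) (auto simp: abs_nonneg)
    finally show "\<nu> ((x [^] Suc k \<ominus> y [^] Suc k) \<otimes> y) \<le> \<nu> (x \<ominus> y) * B ^ Suc k"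
      by (simp add: mult_ac)
  qed
  finally show ?case .
qed (use x y in simp)

text \<open>High roots of \<open>x\<close> have absolute values \<open>c\<close> slightly above 1,
  and the integer powers of such a \<open>c\<close> are spaced too closely to miss the
  interval.\<close>

lemma value_group_dense:
  assumes x: "x \<in> carrier R" "1 < \<nu> x"
    and roots: "\<And>k. k > 0 \<Longrightarrow> \<exists>y\<in>carrier R. y [^] (k::nat) = x"
    and st: "0 \<le> s" "s < t"
  shows "\<exists>u\<in>carrier R. s < \<nu> u \<and> \<nu> u < t"
proof -
  \<comment> \<open>The lower end may be 0; a positive one is needed to bound the ratio of the two
    ends and to take logarithms.\<close>
  define s' where "s' = max s (t / 2)"
  have s': "0 < s'" "s \<le> s'" "s' < t" using st by (auto simp: s'_def)
  have "(\<lambda>k. root k (\<nu> x)) \<longlonglongrightarrow> 1"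
    using x by (intro LIMSEQ_root_const) simp
  then have "eventually (\<lambda>k. root k (\<nu> x) < t / s') sequentially"
    using s' by (intro order_tendstoD(2)) auto
  then obtain K where K: "\<And>k. k \<ge> K \<Longrightarrow> root k (\<nu> x) < t / s'"
    by (auto simp: eventually_sequentially)
  define k where "k = Suc K"
  have k: "k > 0" "root k (\<nu> x) < t / s'" using K[of k] by (auto simp: k_def)
  obtain y where y: "y \<in> carrier R" "y [^] k = x" using roots[OF k(1)] by blast
  define c where "c = \<nu> y"
  have "c ^ k = \<nu> x" using abs_pow[of y k] y by (simp add: c_def)
  then have "1 < c"
    using x power_le_one[of c k] abs_nonneg[OF y(1)] by (force simp: c_def)
  with \<open>c ^ k = \<nu> x\<close> have c: "1 < c" "c < t / s'"
    using k x abs_nonneg[OF y(1)] real_root_pos_unique[of k c "\<nu> x"] by (auto simp: c_def)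
  \<comment> \<open>The least integer with \<open>c powr i > s'\<close>; minimality gives
    \<open>c powr i \<le> s' * c < t\<close>.\<close>
  define i where "i = \<lfloor>ln s' / ln c\<rfloor> + 1"
  have lnc: "0 < ln c" using c by simp
  have "ln s' / ln c < of_int i" "of_int i \<le> ln s' / ln c + 1"
    unfolding i_def by linarith+
  then have "ln s' < of_int i * ln c" "of_int i * ln c \<le> ln s' + ln c"
    using lnc by (simp_all add: field_simps)
  then have "exp (ln s') < exp (of_int i * ln c)" "exp (of_int i * ln c) \<le> exp (ln s' + ln c)"
    by simp_all
  moreover have "exp (of_int i * ln c) = c powr of_int i" using c by (simp add: powr_def)
  ultimately have ci: "s' < c powr of_int i" "c powr of_int i \<le> s' * c"
    using s' c by (simp_all add: exp_add)
  have "\<exists>u\<in>carrier R. \<nu> u = c powr of_int i"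
  proof (cases "i \<ge> 0")
    case True
    then have "c powr of_int i = c ^ nat i" using c by (simp add: powr_real_of_int)
    then show ?thesis using y(1) abs_pow[OF y(1), of "nat i"] by (metis c_def nat_pow_closed)
  next
    case False
    have y0: "y \<noteq> \<zero>" using c abs_eq_0[OF y(1)] by (auto simp: c_def)
    then have "inv y \<in> carrier R" using y(1) by (simp add: field_Units)
    moreover have "c powr of_int i = inverse c ^ nat (- i)"
      using c False by (simp add: powr_real_of_int power_inverse)
    ultimately show ?thesis
      using abs_pow[of "inv y" "nat (- i)"] abs_inv[OF y(1) y0] by (metis c_def nat_pow_closed)
  qed
  then obtain u where "u \<in> carrier R" "\<nu> u = c powr of_int i" by blast
  moreover have "s' * c < t" using c s' by (simp add: field_simps)
  ultimately show ?thesis using ci s' by (intro bexI[of _ u]) auto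
qed

end

section \<open>Escape of orbits and local heights of the unicritical family\<close>

locale unicritical = ultrametric_field +
  fixes d :: nat
  assumes d: "d \<ge> 2"
begin

abbreviation it :: "'a \<Rightarrow> 'a \<Rightarrow> nat \<Rightarrow> 'a" where
  "it x z n \<equiv> (unicrit R d z ^^ n) x"

lemma it_closed: "\<lbrakk>x \<in> carrier R; z \<in> carrier R\<rbrakk> \<Longrightarrow> it x z n \<in> carrier R"
  by (induction n) (auto simp: unicrit_def)

text \<open>The constant behind all local estimates: parameters of larger absolute value escape from
  the first iterate on, so zeros of the iterates in the parameter are bounded by it. It is 1
  wherever \<open>x\<close> is integral, so \<open>ln (bnd x)\<close> vanishes at almost all
  places.\<close>

definition bnd :: "'a \<Rightarrow> real" where
  "bnd x = max 1 (\<nu> x ^ d)"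

lemma bnd_ge_1: "1 \<le> bnd x"
  by (simp add: bnd_def)

text \<open>The power \<open>y [^] d\<close> strictly dominates the parameter, so the next iterate
  has absolute value exactly \<open>\<nu> y ^ d\<close>. The comparison with 1 makes the condition
  persist.\<close>

definition escaping :: "'a \<Rightarrow> 'a \<Rightarrow> bool" where
  "escaping z y \<longleftrightarrow> max 1 (\<nu> z) < \<nu> y ^ d"

lemma escaping_step:
  assumes "y \<in> carrier R" "z \<in> carrier R" "escaping z y"
  shows "\<nu> (unicrit R d z y) = \<nu> y ^ d" and "escaping z (unicrit R d z y)"
proof -
  show *: "\<nu> (unicrit R d z y) = \<nu> y ^ d"
    unfolding unicrit_def using assms abs_add_dominant[of "y [^] d" z]
    by (simp add: abs_pow escaping_def)
  have "\<nu> y ^ d \<le> (\<nu> y ^ d) ^ d"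
    using assms d by (intro self_le_power) (auto simp: escaping_def)
  then show "escaping z (unicrit R d z y)"
    using assms unfolding escaping_def * by simp
qed

lemma escaping_large_parameter:
  assumes "x \<in> carrier R" "z \<in> carrier R" "bnd x < \<nu> z"
  shows "escaping z (it x z (Suc n))" and "\<nu> (it x z (Suc n)) = \<nu> z ^ (d ^ n)"
proof -
  have z: "1 < \<nu> z" "\<nu> x ^ d < \<nu> z" using assms by (auto simp: bnd_def)
  have "escaping z (it x z (Suc n)) \<and> \<nu> (it x z (Suc n)) = \<nu> z ^ (d ^ n)"
  proof (induction n)
    case 0
    have "\<nu> (it x z 1) = \<nu> z"
      using abs_add_dominant[of z "x [^] d"] assms z by (simp add: unicrit_def abs_pow a_comm)
    moreover have "\<nu> z ^ 1 < \<nu> z ^ d" using z d by (intro power_strict_increasing) auto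
    ultimately show ?case using z by (simp add: escaping_def)
  next
    case (Suc n)
    then show ?case
      using escaping_step[OF it_closed[OF assms(1,2), of "Suc n"] assms(2)]
      by (simp add: power_mult[symmetric] mult.commute)
  qed
  then show "escaping z (it x z (Suc n))" "\<nu> (it x z (Suc n)) = \<nu> z ^ (d ^ n)" by auto
qed

lemma pow_max_1: "max v 1 ^ d = max (v ^ d) (1::real)" if "0 \<le> v"
proof (cases "v \<le> 1")
  case True
  then show ?thesis using power_le_one[of v d] that by (simp add: max.absorb2)
next
  case False
  then show ?thesis using one_le_power[of v d] by (simp add: max.absorb1)
qed

text \<open>The difference is 0 at an escaping point. Otherwise the parameter is at most
  \<open>bnd x\<close>, since larger parameters escape at every \<open>n \<ge> 1\<close>, and both
  terms lie between 0 and \<open>ln (bnd x)\<close>. The bound is therefore independent of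
  \<open>z\<close>.\<close>

lemma log_plus_step:
  assumes "x \<in> carrier R" "z \<in> carrier R" "n \<ge> 1"
  shows "\<bar>log_plus (\<nu> (it x z (Suc n))) - real d * log_plus (\<nu> (it x z n))\<bar> \<le> ln (bnd x)"
proof -
  define y where "y = it x z n"
  have y: "y \<in> carrier R" using assms it_closed by (simp add: y_def)
  have Suc: "it x z (Suc n) = unicrit R d z y" by (simp add: y_def)
  have dl: "real d * log_plus (\<nu> y) = ln (max (\<nu> y ^ d) 1)"
    using pow_max_1[of "\<nu> y"] abs_nonneg[OF y]
    by (simp add: log_plus_def ln_realpow[symmetric])
  show ?thesis
  proof (cases "escaping z y")
    case True
    then show ?thesis
      using escaping_step[OF y assms(2) True] dl bnd_ge_1[of x] unfolding Suc y_def[symmetric]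
      by (simp add: log_plus_def)
  next
    case False
    obtain k where "n = Suc k" using assms(3) by (cases n) auto
    then have z: "\<nu> z \<le> bnd x"
      using escaping_large_parameter(1)[OF assms(1,2), of k] False by (force simp: y_def)
    then have le: "\<nu> y ^ d \<le> bnd x"
      using False bnd_ge_1[of x] by (auto simp: escaping_def)
    have "\<nu> (unicrit R d z y) \<le> bnd x"
      unfolding unicrit_def using abs_add[of "y [^] d" z] y assms le z by (simp add: abs_pow)
    then have "log_plus (\<nu> (unicrit R d z y)) \<le> ln (bnd x)" "ln (max (\<nu> y ^ d) 1) \<le> ln (bnd x)"
      using le bnd_ge_1[of x] by (auto simp: log_plus_def)
    moreover have "0 \<le> ln (max (\<nu> y ^ d) 1)" by simp
    ultimately show ?thesis
      using log_plus_nonneg[of "\<nu> (unicrit R d z y)"] unfolding Suc y_def[symmetric] dl by linarith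
  qed
qed

lemma local_height_tendsto:
  assumes "x \<in> carrier R" "z \<in> carrier R"
  shows "(\<lambda>n. log_plus (\<nu> (it x z n)) / real d ^ n) \<longlonglongrightarrow> local_height R \<nu> d z x"
  unfolding local_height_def
  using approx_multiplicative_sequence(1)[where l = "\<lambda>n. log_plus (\<nu> (it x z n))", OF d log_plus_step[OF assms]]
  by (simp add: convergent_LIMSEQ_iff)

lemma local_height_approx:
  assumes "x \<in> carrier R" "z \<in> carrier R" "n \<ge> 1"
  shows "\<bar>log_plus (\<nu> (it x z n)) / real d ^ n - local_height R \<nu> d z x\<bar> \<le> ln (bnd x) / real d ^ n"
  unfolding local_height_def
  using approx_multiplicative_sequence(2)[where l = "\<lambda>n. log_plus (\<nu> (it x z n))", OF d log_plus_step[OF assms(1,2)] assms(3)] .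

lemma local_height_nonneg:
  assumes "x \<in> carrier R" "z \<in> carrier R"
  shows "0 \<le> local_height R \<nu> d z x"
  using local_height_tendsto[OF assms]
  by (rule LIMSEQ_le_const) (auto simp: log_plus_nonneg)

lemma zero_of_iterate_bounded:
  assumes "x \<in> carrier R" "z \<in> carrier R" "n \<ge> 1" "it x z n = \<zero>"
  shows "\<nu> z \<le> bnd x"
proof (rule ccontr)
  assume "\<not> ?thesis"
  moreover obtain k where "n = Suc k" using assms(3) by (cases n) auto
  ultimately have "escaping z \<zero>"
    using escaping_large_parameter(1)[OF assms(1,2), of k] assms(4) by simp
  then show False using d abs_eq_0[of \<zero>] by (auto simp: escaping_def power_0_left)
qed

text \<open>While the iterates are of moderate size, one step multiplies the distance of the two
  orbits by at most \<open>bnd x\<close>. As soon as this size is exceeded, both orbits escape with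
  equal absolute values.\<close>

lemma truncated_abs_locally_constant:
  assumes x: "x \<in> carrier R" and z: "z \<in> carrier R" and u: "u \<in> carrier R" and n: "n \<ge> 1"
    and close: "\<nu> (z \<ominus> u) * bnd x ^ n \<le> 1"
  shows "max 1 (\<nu> (it x u n)) = max 1 (\<nu> (it x z n))"
proof -
  define s where "s = \<nu> (z \<ominus> u)"
  define M where "M = bnd x"
  have M: "1 \<le> M" by (simp add: M_def bnd_ge_1)
  have s0: "0 \<le> s" using z u by (simp add: s_def abs_nonneg)
  have sM: "s * M ^ k \<le> 1" if "k \<le> n" for k
  proof -
    have "s * M ^ k \<le> s * M ^ n"
      using s0 M that by (intro mult_left_mono power_increasing) auto
    then show ?thesis using close by (simp add: s_def M_def)
  qed
  have s1: "s \<le> 1" using sM[of 0] by simp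
  have uz: "\<nu> u \<le> max (\<nu> z) s"
    using abs_le_diff[OF z u] abs_diff_commute[OF z u] by (simp add: s_def)
  obtain k where k: "n = Suc k" using n by (cases n) auto
  show ?thesis
  proof (cases "M < \<nu> z")
    case True
    have "\<nu> u = \<nu> z"
    proof -
      have "u = z \<oplus> (u \<ominus> z)" using z u by algebra
      then show ?thesis
        using abs_add_dominant[of z "u \<ominus> z"] z u True M s1 abs_diff_commute[OF z u] by (simp add: s_def)
    qed
    then show ?thesis
      using escaping_large_parameter(2)[OF x z, of k] escaping_large_parameter(2)[OF x u, of k] True k
      by (simp add: M_def)
  next
    case False
    then have zM: "\<nu> z \<le> M" and uM: "\<nu> u \<le> M" using uz s1 M by auto
    \<comment> \<open>The invariant: either the orbits are still close, or both have left the
      moderate range with the same absolute value. The exponent is \<open>j - 1\<close> because the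
      first iterates differ by exactly \<open>z \<ominus> u\<close>.\<close>
    let ?P = "\<lambda>j. \<nu> (it x z j \<ominus> it x u j) \<le> s * M ^ (j - 1) \<or>
      (\<nu> (it x u j) = \<nu> (it x z j) \<and> M < \<nu> (it x z j) ^ d)"
    have "j \<le> n \<longrightarrow> ?P j" if "j \<ge> 1" for j
      using that
    proof (induction j rule: dec_induct)
      case base
      have "(x [^] d \<oplus> z) \<ominus> (x [^] d \<oplus> u) = z \<ominus> u"
      proof -
        have "x [^] d \<in> carrier R" using x by simp
        then show ?thesis using z u by algebra
      qed
      then have "it x z 1 \<ominus> it x u 1 = z \<ominus> u" by (simp add: unicrit_def)
      then show ?case by (simp add: s_def)
    next
      case (step j)
      define y where "y = it x z j"
      define w where "w = it x u j"
      have yw: "y \<in> carrier R" "w \<in> carrier R" using x z u it_closed by (auto simp: y_def w_def)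
      have Suc: "it x z (Suc j) = unicrit R d z y" "it x u (Suc j) = unicrit R d u w"
        by (simp_all add: y_def w_def)
      have escape: "?P (Suc j)" if "\<nu> w = \<nu> y" "M < \<nu> y ^ d"
      proof -
        have "escaping z y" "escaping u w"
          using that zM uM M by (auto simp: escaping_def)
        then have "\<nu> (unicrit R d z y) = \<nu> y ^ d" "\<nu> (unicrit R d u w) = \<nu> y ^ d"
          using escaping_step(1)[of y z] escaping_step(1)[of w u] yw z u that by auto
        moreover have "\<nu> y ^ d \<le> (\<nu> y ^ d) ^ d"
          using that M d by (intro self_le_power) auto
        ultimately show ?thesis using that unfolding Suc by simp
      qed
      show ?case
      proof
        assume "Suc j \<le> n"
        then have IH: "?P j" using step by simp
        show "?P (Suc j)"
        proof (cases "M < \<nu> y ^ d")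
          case True
          have y1: "1 < \<nu> y"
            using True M power_le_one[OF abs_nonneg[OF yw(1)], of d] by force
          have "\<nu> w = \<nu> y"
            using IH
          proof
            assume "\<nu> (it x z j \<ominus> it x u j) \<le> s * M ^ (j - 1)"
            moreover have "j - 1 \<le> n" using \<open>Suc j \<le> n\<close> by linarith
            ultimately have le: "\<nu> (w \<ominus> y) \<le> 1"
              using sM[of "j - 1"] abs_diff_commute[OF yw] by (simp add: y_def w_def)
            have "w = y \<oplus> (w \<ominus> y)" using yw by algebra
            then show ?thesis using abs_add_dominant[of y "w \<ominus> y"] yw le y1 by simp
          qed (simp add: y_def w_def)
          then show ?thesis using escape True by blast
        next
          case nesc: False
          then have e: "\<nu> (y \<ominus> w) \<le> s * M ^ (j - 1)" using IH by (auto simp: y_def w_def)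
          have "j - 1 \<le> n" using \<open>Suc j \<le> n\<close> by linarith
          then have e1: "\<nu> (y \<ominus> w) \<le> 1" using e sM[of "j - 1"] by linarith
          \<comment> \<open>Since \<open>B ^ d \<le> M\<close> and \<open>B \<ge> 1\<close>, the
            Lipschitz constant \<open>B ^ (d - 1)\<close> of the power map is at most
            \<open>M\<close>.\<close>
          define B where "B = max (\<nu> y) 1"
          have B: "\<nu> y \<le> B" "\<nu> w \<le> B" "1 \<le> B"
            using abs_le_diff[OF yw] abs_diff_commute[OF yw] e1 by (auto simp: B_def)
          have "B ^ d \<le> M" using pow_max_1[OF abs_nonneg[OF yw(1)]] nesc M by (simp add: B_def)
          moreover have "B ^ (d - 1) \<le> B ^ d" using B by (intro power_increasing) auto
          ultimately have BM: "B ^ (d - 1) \<le> M" by simp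
          have "unicrit R d z y \<ominus> unicrit R d u w = (y [^] d \<ominus> w [^] d) \<oplus> (z \<ominus> u)"
          proof -
            have "y [^] d \<in> carrier R" "w [^] d \<in> carrier R" using yw by auto
            then show ?thesis using z u unfolding unicrit_def by algebra
          qed
          then have "\<nu> (unicrit R d z y \<ominus> unicrit R d u w) \<le> max (\<nu> (y [^] d \<ominus> w [^] d)) s"
            using abs_add[of "y [^] d \<ominus> w [^] d" "z \<ominus> u"] yw z u by (simp add: s_def)
          also have "\<dots> \<le> s * M ^ j"
          proof (rule max.boundedI)
            have "\<nu> (y [^] d \<ominus> w [^] d) \<le> \<nu> (y \<ominus> w) * B ^ (d - 1)"
              using abs_pow_diff[OF yw B(1,2), of "d - 1"] d by simp
            also have "\<dots> \<le> (s * M ^ (j - 1)) * M"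
              using e BM B s0 M yw by (intro mult_mono) (auto simp: abs_nonneg)
            also have "\<dots> = s * M ^ j" using step(1) by (simp add: power_eq_if)
            finally show "\<nu> (y [^] d \<ominus> w [^] d) \<le> s * M ^ j" .
            show "s \<le> s * M ^ j" using s0 M one_le_power[OF M, of j] mult_left_mono[of 1 "M ^ j" s] by simp
          qed
          finally show ?thesis unfolding Suc by simp
        qed
      qed
    qed
    then have "?P n" using n by simp
    then show ?thesis
    proof
      define y where "y = it x z n"
      define w where "w = it x u n"
      have yw: "y \<in> carrier R" "w \<in> carrier R" using x z u it_closed by (auto simp: y_def w_def)
      assume "\<nu> (it x z n \<ominus> it x u n) \<le> s * M ^ (n - 1)"
      then have "\<nu> (y \<ominus> w) \<le> 1" using sM[of "n - 1"] by (simp add: y_def w_def)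
      then have "max 1 (\<nu> w) = max 1 (\<nu> y)"
        using abs_le_diff[OF yw] abs_le_diff[OF yw(2,1)] abs_diff_commute[OF yw] by auto
      then show ?thesis by (simp add: y_def w_def)
    qed simp
  qed
qed

end


section \<open>Splitting of iterates as polynomials in the parameter\<close>

context field
begin

definition monic :: "'a list \<Rightarrow> bool" where
  "monic p \<longleftrightarrow> p \<in> carrier (poly_ring R) \<and> p \<noteq> [] \<and> lead_coeff p = \<one>"

lemma monicD: "monic p \<Longrightarrow> p \<in> carrier (poly_ring R)" "monic p \<Longrightarrow> p \<noteq> []" "monic p \<Longrightarrow> lead_coeff p = \<one>"
  by (simp_all add: monic_def)

lemma poly_carrier_iff: "p \<in> carrier (poly_ring R) \<longleftrightarrow> p = [] \<or> (set p \<subseteq> carrier R \<and> lead_coeff p \<noteq> \<zero>)"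
  by (simp add: univ_poly_carrier[symmetric] polynomial_def)

lemma monic_linear: "a \<in> carrier R \<Longrightarrow> monic [\<one>, a]"
  using one_not_zero by (simp add: monic_def poly_carrier_iff)

lemma monic_one: "monic \<one>\<^bsub>poly_ring R\<^esub>"
  using one_not_zero by (simp add: monic_def poly_carrier_iff univ_poly_one)

lemma monic_mult:
  assumes "monic p" "monic q"
  shows "monic (p \<otimes>\<^bsub>poly_ring R\<^esub> q)"
    and "degree (p \<otimes>\<^bsub>poly_ring R\<^esub> q) = degree p + degree q"
proof -
  interpret P: domain "poly_ring R" using univ_poly_is_domain[OF carrier_is_subring] .
  note D = monicD[OF assms(1)] monicD[OF assms(2)]
  have pol: "polynomial (carrier R) p" "polynomial (carrier R) q"
    using D by (simp_all add: univ_poly_carrier)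
  show "monic (p \<otimes>\<^bsub>poly_ring R\<^esub> q)"
    using D P.integral[of p q] poly_mult_lead_coeff[OF carrier_is_subring pol] P.m_closed[of p q]
    by (auto simp: monic_def univ_poly_mult univ_poly_zero)
  show "degree (p \<otimes>\<^bsub>poly_ring R\<^esub> q) = degree p + degree q"
    using poly_mult_degree_eq[OF carrier_is_subring pol] D by (simp add: univ_poly_mult)
qed

lemma monic_pow:
  assumes "monic p"
  shows "monic (p [^]\<^bsub>poly_ring R\<^esub> (n::nat))"
proof (induction n)
  case 0
  then show ?case using monic_one by simp
next
  case (Suc n)
  interpret P: domain "poly_ring R" using univ_poly_is_domain[OF carrier_is_subring] .
  show ?case using monic_mult(1)[OF Suc assms] by simp
qed

lemma monic_add_lower:
  assumes p: "monic p" and q: "q \<in> carrier (poly_ring R)" and less: "degree q < degree p"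
  shows "monic (p \<oplus>\<^bsub>poly_ring R\<^esub> q)" and "degree (p \<oplus>\<^bsub>poly_ring R\<^esub> q) = degree p"
proof -
  interpret P: domain "poly_ring R" using univ_poly_is_domain[OF carrier_is_subring] .
  note D = monicD[OF p]
  have pol: "polynomial (carrier R) p" "polynomial (carrier R) q"
    using D q by (simp_all add: univ_poly_carrier)
  have sub: "set p \<subseteq> carrier R" "set q \<subseteq> carrier R"
    using pol polynomial_in_carrier[OF carrier_is_subring] by auto
  let ?s = "p \<oplus>\<^bsub>poly_ring R\<^esub> q"
  show deg: "degree ?s = degree p"
    using poly_add_degree_eq[OF carrier_is_subring pol] less by (simp add: univ_poly_add)
  then have ne: "?s \<noteq> []" using less by auto
  have "lead_coeff ?s = coeff ?s (degree p)"
    using lead_coeff_simp[OF ne] deg by simp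
  also have "\<dots> = coeff p (degree p) \<oplus> coeff q (degree p)"
    using poly_add_coeff[OF sub] by (simp add: univ_poly_add)
  also have "\<dots> = \<one>"
    using coeff_degree[of q "degree p"] less lead_coeff_simp[OF D(2)] D(3) by simp
  finally show "monic ?s" using P.a_closed[OF D(1) q] ne by (simp add: monic_def)
qed

lemma eval_mult:
  assumes "p \<in> carrier (poly_ring R)" "q \<in> carrier (poly_ring R)" "z \<in> carrier R"
  shows "eval (p \<otimes>\<^bsub>poly_ring R\<^esub> q) z = eval p z \<otimes> eval q z"
    and "eval (p \<oplus>\<^bsub>poly_ring R\<^esub> q) z = eval p z \<oplus> eval q z"
    and "eval (p [^]\<^bsub>poly_ring R\<^esub> (n::nat)) z = eval p z [^] n"
proof -
  interpret H: ring_hom_cring "poly_ring R" R "\<lambda>p. eval p z"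
    using eval_cring_hom[OF carrier_is_subring assms(3)] .
  show "eval (p \<otimes>\<^bsub>poly_ring R\<^esub> q) z = eval p z \<otimes> eval q z"
    "eval (p \<oplus>\<^bsub>poly_ring R\<^esub> q) z = eval p z \<oplus> eval q z"
    "eval (p [^]\<^bsub>poly_ring R\<^esub> (n::nat)) z = eval p z [^] n"
    using assms by simp_all
qed

lemma eval_closed: "\<lbrakk>p \<in> carrier (poly_ring R); z \<in> carrier R\<rbrakk> \<Longrightarrow> eval p z \<in> carrier R"
  using eval_poly_in_carrier[OF carrier_is_subring] by (simp add: univ_poly_carrier)

text \<open>The first iterate is the parameter plus a constant, hence of degree 1; this explains the
  shift between \<open>d ^ n\<close> and \<open>Suc n\<close>. The passage from \<open>p\<close> to
  the \<open>d\<close>-th power of \<open>p\<close> plus \<open>X\<close> keeps the polynomial monic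
  because that power has degree at least 2.\<close>

lemma unicrit_iterate_polynomial:
  assumes x: "x \<in> carrier R" and d: "d \<ge> 2"
  shows "\<exists>p. monic p \<and> degree p = d ^ n \<and>
    (\<forall>z\<in>carrier R. eval p z = (unicrit R d z ^^ Suc n) x)"
proof (induction n)
  case 0
  have "eval [\<one>, x [^] d] z = (unicrit R d z ^^ Suc 0) x" if "z \<in> carrier R" for z
    using x that by (simp add: unicrit_def a_comm)
  then show ?case using monic_linear[of "x [^] d"] x
    by (intro exI[of _ "[\<one>, x [^] d]"]) simp
next
  case (Suc n)
  then obtain p where p: "monic p" "degree p = d ^ n"
    "\<And>z. z \<in> carrier R \<Longrightarrow> eval p z = (unicrit R d z ^^ Suc n) x" by blast
  let ?P = "poly_ring R"
  have X: "[\<one>, \<zero>] \<in> carrier ?P" using monicD[OF monic_linear] by simp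
  interpret P: domain ?P using univ_poly_is_domain[OF carrier_is_subring] .
  have pd: "p [^]\<^bsub>?P\<^esub> d \<in> carrier ?P" "degree (p [^]\<^bsub>?P\<^esub> d) = d ^ Suc n"
    using polynomial_pow_degree[OF monicD(1)[OF p(1)], of d] monicD(1)[OF p(1)] p(2) by simp_all
  have "1 < d ^ Suc n" using d by (intro one_less_power) auto
  then have "degree [\<one>, \<zero>] < degree (p [^]\<^bsub>?P\<^esub> d)" using pd by simp
  note add = monic_add_lower[OF monic_pow[OF p(1)] X this]
  have "eval (p [^]\<^bsub>?P\<^esub> d \<oplus>\<^bsub>?P\<^esub> [\<one>, \<zero>]) z = (unicrit R d z ^^ Suc (Suc n)) x"
    if z: "z \<in> carrier R" for z
    using eval_mult(2)[OF pd(1) X z] eval_mult(3)[OF monicD(1)[OF p(1)] X z, of d] p(3)[OF z] z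
    by (simp add: unicrit_def)
  then show ?case using add pd by (intro exI[of _ "p [^]\<^bsub>?P\<^esub> d \<oplus>\<^bsub>?P\<^esub> [\<one>, \<zero>]"]) simp
qed

end

context algebraically_closed
begin

lemma exists_root_of_poly:
  assumes "p \<in> carrier (poly_ring L)" "degree p > 0"
  shows "\<exists>x\<in>carrier L. eval p x = \<zero>"
proof -
  have "size (roots p) > 0" using roots_over_carrier[OF assms(1)] assms(2) by (simp add: splitted_def)
  then obtain x where "x \<in># roots p" by (metis nonempty_has_size multiset_nonemptyE)
  then show ?thesis using roots_mem_iff_is_root[OF assms(1)] by (auto simp: is_root_def)
qed

text \<open>The factorisation is recorded through values, by a list of roots with multiplicity, so
  that any absolute value can be applied to it.\<close>

lemma monic_splits:
  assumes "monic p"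
  shows "\<exists>as. length as = degree p \<and> set as \<subseteq> carrier L \<and>
    (\<forall>z\<in>carrier L. eval p z = foldr (\<lambda>a y. (z \<ominus> a) \<otimes> y) as \<one>)"
  using assms
proof (induction "degree p" arbitrary: p)
  case 0
  then have "p = [\<one>]" using monicD[OF 0(2)] by (cases p) auto
  then show ?case by (intro exI[of _ "[]"]) simp
next
  case (Suc n)
  note D = monicD[OF Suc(3)]
  obtain a where a: "a \<in> carrier L" "eval p a = \<zero>"
    using exists_root_of_poly[OF D(1)] Suc(2)[symmetric] by (metis zero_less_Suc)
  then have "is_root p a" using D by (simp add: is_root_def)
  then have "[\<one>, \<ominus> a] pdivides p" using is_root_imp_pdivides[OF D(1)] by blast
  then obtain q where q: "q \<in> carrier (poly_ring L)" "p = [\<one>, \<ominus> a] \<otimes>\<^bsub>poly_ring L\<^esub> q"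
    by (auto simp: pdivides_def factor_def)
  interpret P: domain "poly_ring L" using univ_poly_is_domain[OF carrier_is_subring] .
  have lin: "monic [\<one>, \<ominus> a]" using monic_linear a by simp
  have "q \<noteq> []"
  proof
    assume "q = []"
    then have "p = []" using q P.r_null[of "[\<one>, \<ominus> a]"] monicD(1)[OF lin] by (simp add: univ_poly_zero)
    then show False using D by simp
  qed
  moreover from this have "lead_coeff p = \<one> \<otimes> lead_coeff q"
    using poly_mult_lead_coeff[OF carrier_is_subring, of "[\<one>, \<ominus> a]" q] q monicD(1)[OF lin]
    by (simp add: univ_poly_carrier univ_poly_mult)
  ultimately have "monic q" using q D lead_coeff_in_carrier[of "carrier L"]
    by (cases q) (auto simp: monic_def poly_carrier_iff)
  moreover have "n = degree q"
    using monic_mult(2)[OF lin \<open>monic q\<close>] q(2) Suc(2) by simp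
  ultimately obtain as where as: "length as = degree q" "set as \<subseteq> carrier L"
    "\<And>z. z \<in> carrier L \<Longrightarrow> eval q z = foldr (\<lambda>a y. (z \<ominus> a) \<otimes> y) as \<one>"
    using Suc(1)[of q] by blast
  have "eval p z = foldr (\<lambda>a y. (z \<ominus> a) \<otimes> y) (a # as) \<one>" if "z \<in> carrier L" for z
    using eval_mult(1)[OF monicD(1)[OF lin] q(1) that] as(3)[OF that] that a q(2)
    by (simp add: minus_eq)
  then show ?case
    using as a \<open>n = degree q\<close> Suc(2) by (intro exI[of _ "a # as"]) simp
qed

lemma exists_nth_root:
  assumes x: "x \<in> carrier L" and k: "k > 0"
  shows "\<exists>y\<in>carrier L. y [^] (k::nat) = x"
proof -
  interpret P: domain "poly_ring L" using univ_poly_is_domain[OF carrier_is_subring] .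
  let ?X = "[\<one>, \<zero>] [^]\<^bsub>poly_ring L\<^esub> k" and ?C = "if x = \<zero> then [] else [\<ominus> x]"
  have X: "monic [\<one>, \<zero>]" using monic_linear by simp
  have C: "?C \<in> carrier (poly_ring L)" using x by (auto simp: poly_carrier_iff)
  have "degree ?X = k" using polynomial_pow_degree[OF monicD(1)[OF X], of k] by simp
  then have m: "monic (?X \<oplus>\<^bsub>poly_ring L\<^esub> ?C)" "degree (?X \<oplus>\<^bsub>poly_ring L\<^esub> ?C) = k"
    using monic_add_lower[OF monic_pow[OF X] C] k by auto
  obtain y where y: "y \<in> carrier L" "eval (?X \<oplus>\<^bsub>poly_ring L\<^esub> ?C) y = \<zero>"
    using exists_root_of_poly[OF monicD(1)[OF m(1)]] m(2) k by metis
  have "y [^] k \<oplus> \<ominus> x = \<zero>"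
    using y x eval_mult(2)[OF monicD(1)[OF monic_pow[OF X]] C y(1), of k]
      eval_mult(3)[OF monicD(1)[OF X] C y(1), of k] by (auto split: if_splits)
  then have "y [^] k = x" using y x by (metis minus_equality minus_minus nat_pow_closed a_inv_closed a_comm)
  then show ?thesis using y by blast
qed

end

lemma (in ultrametric_field) abs_foldr:
  assumes "set as \<subseteq> carrier R" "z \<in> carrier R"
  shows "foldr (\<lambda>a y. (z \<ominus> a) \<otimes> y) as \<one> \<in> carrier R"
    and "\<nu> (foldr (\<lambda>a y. (z \<ominus> a) \<otimes> y) as \<one>) = (\<Prod>j<length as. \<nu> (z \<ominus> as ! j))"
proof -
  have "foldr (\<lambda>a y. (z \<ominus> a) \<otimes> y) as \<one> \<in> carrier R \<and>
      \<nu> (foldr (\<lambda>a y. (z \<ominus> a) \<otimes> y) as \<one>) = (\<Prod>j<length as. \<nu> (z \<ominus> as ! j))"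
    using assms(1)
  proof (induction as)
    case (Cons a as)
    then show ?case
      using assms(2) by (simp add: abs_mult prod.lessThan_Suc_shift del: prod.lessThan_Suc)
  qed (simp add: abs_one)
  then show "foldr (\<lambda>a y. (z \<ominus> a) \<otimes> y) as \<one> \<in> carrier R"
    "\<nu> (foldr (\<lambda>a y. (z \<ominus> a) \<otimes> y) as \<one>) = (\<Prod>j<length as. \<nu> (z \<ominus> as ! j))" by auto
qed

lemma (in cring) foldr_linear_eq_zero:
  assumes "z \<in> set bs" "set bs \<subseteq> carrier R"
  shows "foldr (\<lambda>a y. (z \<ominus> a) \<otimes> y) bs \<one> = \<zero>"
  using assms
proof (induction bs)
  case (Cons b bs)
  have "foldr (\<lambda>a y. (z \<ominus> a) \<otimes> y) bs \<one> \<in> carrier R"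
    if "z \<in> carrier R" "set bs \<subseteq> carrier R" for bs
    using that by (induction bs) auto
  then show ?case using Cons by (auto simp: minus_eq r_neg)
qed simp

text \<open>The roots are chosen before the absolute value, so one indexed family of roots serves
  all places.\<close>

lemma (in algebraically_closed) unicrit_iterate_roots:
  assumes x: "x \<in> carrier L" and d: "d \<ge> 2"
  shows "\<exists>a. (\<forall>j<d ^ n. a j \<in> carrier L \<and> (unicrit L d (a j) ^^ Suc n) x = \<zero>) \<and>
    (\<forall>\<nu> z. ultrametric_field L \<nu> \<longrightarrow> z \<in> carrier L \<longrightarrow>
      \<nu> ((unicrit L d z ^^ Suc n) x) = (\<Prod>j<d ^ n. \<nu> (z \<ominus> a j)))"
proof -
  obtain p where p: "monic p" "degree p = d ^ n"
    "\<And>z. z \<in> carrier L \<Longrightarrow> eval p z = (unicrit L d z ^^ Suc n) x"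
    using unicrit_iterate_polynomial[OF x d] by blast
  obtain as where as: "length as = degree p" "set as \<subseteq> carrier L"
    "\<And>z. z \<in> carrier L \<Longrightarrow> eval p z = foldr (\<lambda>a y. (z \<ominus> a) \<otimes> y) as \<one>"
    using monic_splits[OF p(1)] by blast
  have "(unicrit L d (as ! j) ^^ Suc n) x = \<zero>" if "j < d ^ n" for j
    using foldr_linear_eq_zero[of "as ! j" as] as p that by (metis nth_mem subsetD)
  moreover have "as ! j \<in> carrier L" if "j < d ^ n" for j
    using as p that by (metis nth_mem subsetD)
  moreover have "\<nu> ((unicrit L d z ^^ Suc n) x) = (\<Prod>j<d ^ n. \<nu> (z \<ominus> as ! j))"
    if "ultrametric_field L \<nu>" "z \<in> carrier L" for \<nu> z
    using ultrametric_field.abs_foldr(2)[OF that(1) as(2) that(2)] as(1,3) p that by simp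
  ultimately show ?thesis by (intro exI[of _ "\<lambda>j. as ! j"]) blast
qed


section \<open>Fields of prime characteristic\<close>

lemma (in cring) binomial_expansion:
  assumes x: "x \<in> carrier R" and y: "y \<in> carrier R"
  shows "(x \<oplus> y) [^] n = (\<Oplus>k\<in>{..n}. [(n choose k)] \<cdot> (x [^] k \<otimes> y [^] (n - k)))"
proof (induction n)
  case 0
  then show ?case using x y by (simp add: finsum_0)
next
  case (Suc n)
  let ?A = "\<lambda>k. [(n choose k)] \<cdot> (x [^] Suc k \<otimes> y [^] (n - k))"
  let ?B = "\<lambda>k. [(n choose Suc k)] \<cdot> (x [^] Suc k \<otimes> y [^] (n - k))"
  let ?C = "\<lambda>k. [(n choose k)] \<cdot> (x [^] k \<otimes> y [^] (Suc n - k))"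
  let ?S = "\<Oplus>k\<in>{..n}. [(n choose k)] \<cdot> (x [^] k \<otimes> y [^] (n - k))"
  have cl: "[c] \<cdot> (x [^] (i::nat) \<otimes> y [^] (j::nat)) \<in> carrier R" for c :: nat and i j
    using x y by simp
  have S: "?S \<in> carrier R" using cl by (intro finsum_closed) auto
  have "?S \<otimes> x = (\<Oplus>k\<in>{..n}. [(n choose k)] \<cdot> (x [^] k \<otimes> y [^] (n - k)) \<otimes> x)"
    using x cl by (intro finsum_ldistr) auto
  also have "\<dots> = (\<Oplus>k\<in>{..n}. ?A k)"
  proof (intro finsum_cong')
    fix k
    have "x [^] k \<otimes> y [^] (n - k) \<otimes> x = x [^] Suc k \<otimes> y [^] (n - k)"
      using x y by (simp add: m_ac)
    then show "[(n choose k)] \<cdot> (x [^] k \<otimes> y [^] (n - k)) \<otimes> x = ?A k"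
      using x y by (simp add: add_pow_ldistr)
  qed (use x y in auto)
  finally have Sx: "?S \<otimes> x = (\<Oplus>k\<in>{..n}. ?A k)" .
  have "?S \<otimes> y = (\<Oplus>k\<in>{..n}. [(n choose k)] \<cdot> (x [^] k \<otimes> y [^] (n - k)) \<otimes> y)"
    using y cl by (intro finsum_ldistr) auto
  also have "\<dots> = (\<Oplus>k\<in>{..n}. ?C k)"
  proof (intro finsum_cong')
    fix k assume "k \<in> {..n}"
    then have "y [^] (Suc n - k) = y [^] (n - k) \<otimes> y" by (simp add: Suc_diff_le)
    then show "[(n choose k)] \<cdot> (x [^] k \<otimes> y [^] (n - k)) \<otimes> y = ?C k"
      using x y by (simp add: add_pow_ldistr m_assoc)
  qed (use cl in auto)
  also have "\<dots> = (\<Oplus>k\<in>{..Suc n}. ?C k)"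
  proof -
    have "(\<Oplus>k\<in>{..Suc n}. ?C k) = ?C (Suc n) \<oplus> (\<Oplus>k\<in>{..n}. ?C k)"
      using cl by (intro finsum_Suc) auto
    moreover have "?C (Suc n) = \<zero>" by (simp add: binomial_eq_0)
    ultimately show ?thesis using cl by simp
  qed
  also have "\<dots> = (\<Oplus>k\<in>{..n}. ?C (Suc k)) \<oplus> ?C 0"
    using cl by (intro finsum_Suc2) auto
  finally have Sy: "?S \<otimes> y = (\<Oplus>k\<in>{..n}. ?B k) \<oplus> y [^] Suc n" using x y by simp
  have "(x \<oplus> y) [^] Suc n = ?S \<otimes> x \<oplus> ?S \<otimes> y"
    using x y S Suc by (simp add: r_distr)
  also have "\<dots> = ((\<Oplus>k\<in>{..n}. ?A k) \<oplus> (\<Oplus>k\<in>{..n}. ?B k)) \<oplus> y [^] Suc n"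
    unfolding Sx Sy using x y by (intro a_assoc[symmetric] finsum_closed) auto
  also have "(\<Oplus>k\<in>{..n}. ?A k) \<oplus> (\<Oplus>k\<in>{..n}. ?B k) = (\<Oplus>k\<in>{..n}. ?A k \<oplus> ?B k)"
    using x y by (intro finsum_addf[symmetric]) auto
  also have "\<dots> = (\<Oplus>k\<in>{..n}. [(Suc n choose Suc k)] \<cdot> (x [^] Suc k \<otimes> y [^] (Suc n - Suc k)))"
    using x y by (intro finsum_cong') (auto simp: add.nat_pow_mult)
  also have "\<dots> \<oplus> y [^] Suc n = (\<Oplus>k\<in>{..Suc n}. [(Suc n choose k)] \<cdot> (x [^] k \<otimes> y [^] (Suc n - k)))"
    using x y by (subst finsum_Suc2) auto
  finally show ?case .
qed

locale prime_char_field = field R for R (structure) +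
  fixes p :: nat
  assumes prime: "Factorial_Ring.prime p" and char: "[p] \<cdot> \<one> = \<zero>"
begin

lemma p_pos: "p > 0" and p_gt_1: "p > 1"
  using prime by (auto simp: prime_gt_0_nat prime_gt_Suc_0_nat)

lemma char_mult: "z \<in> carrier R \<Longrightarrow> [(p * m)] \<cdot> z = \<zero>"
proof -
  assume z: "z \<in> carrier R"
  define w where "w = [m] \<cdot> z"
  have w: "w \<in> carrier R" using z by (simp add: w_def)
  then have "[p] \<cdot> w = ([p] \<cdot> \<one>) \<otimes> w" by (simp add: add_pow_ldistr)
  then have "[p] \<cdot> w = \<zero>" using char w by simp
  then show ?thesis
    unfolding w_def using add.nat_pow_pow[OF z, where n = m and m = p] by (simp add: mult.commute[of m p])
qed

lemma add_pow_ne_0: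
  assumes "\<not> p dvd k"
  shows "[k] \<cdot> \<one> \<noteq> \<zero>"
proof
  assume k: "[k] \<cdot> \<one> = \<zero>"
  have "coprime p k" using assms prime by (intro prime_imp_coprime) auto
  then have "gcd k p = 1" by (simp add: coprime_iff_gcd_eq_1 gcd.commute)
  moreover have "k \<noteq> 0" using assms by (metis dvd_0_right)
  ultimately obtain a b where "k * a = p * b + 1"
    using bezout_nat[of k p] by metis
  then have ab: "a * k = b * p + 1" by (simp add: mult.commute)
  have "[(a * k)] \<cdot> \<one> = \<zero>" using k add.nat_pow_pow[OF one_closed, where n = k and m = a]
    by (simp add: mult.commute[of k a])
  moreover have "[(b * p + 1)] \<cdot> \<one> = [(p * b)] \<cdot> \<one> \<oplus> \<one>"
    using add.nat_pow_mult[of \<one> "p * b" 1] by (simp add: mult.commute)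
  ultimately show False using ab char_mult[of \<one> b] one_not_zero by simp
qed

lemma frobenius_add:
  assumes x: "x \<in> carrier R" and y: "y \<in> carrier R"
  shows "(x \<oplus> y) [^] p = x [^] p \<oplus> y [^] p"
proof -
  obtain q where q: "p = Suc q" using p_pos by (cases p) auto
  let ?f = "\<lambda>k. [(p choose k)] \<cdot> (x [^] k \<otimes> y [^] (p - k))"
  have cl: "?f k \<in> carrier R" for k using x y by simp
  have zero: "?f k = \<zero>" if "0 < k" "k < p" for k
  proof -
    have "p dvd (p choose k)" using that prime by (intro dvd_choose_prime) auto
    then obtain m where "p choose k = p * m" by blast
    then show ?thesis using char_mult x y by simp
  qed
  have "(x \<oplus> y) [^] p = (\<Oplus>k\<in>{..Suc q}. ?f k)"
    using binomial_expansion[OF x y, of p] q by simp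
  also have "\<dots> = ?f (Suc q) \<oplus> (\<Oplus>k\<in>{..q}. ?f k)"
    using cl by (intro finsum_Suc) auto
  also have "(\<Oplus>k\<in>{..q}. ?f k) = (\<Oplus>k\<in>{..q}. if 0 = k then ?f k else \<zero>)"
    using zero x y q by (intro finsum_cong') auto
  also have "\<dots> = ?f 0" using x y by (intro finsum_singleton) auto
  finally show ?thesis using x y q by simp
qed

lemma frobenius_hom: "(\<lambda>x. x [^] p) \<in> ring_hom R R"
  by (rule ring_hom_memI) (auto simp: frobenius_add nat_pow_distrib)

lemma frobenius_inj: "\<lbrakk>x \<in> carrier R; y \<in> carrier R; x [^] p = y [^] p\<rbrakk> \<Longrightarrow> x = y"
  using non_trivial_field_hom_is_inj[OF frobenius_hom field_axioms field_axioms]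
  by (auto simp: inj_on_def)

section \<open>Perfect fields\<close>

definition perfect :: "'a set \<Rightarrow> bool" where
  "perfect K \<longleftrightarrow> (\<forall>x\<in>K. \<exists>y\<in>K. y [^] p = x)"

lemma frobenius_image_perfect:
  assumes K: "subfield K R" and "perfect K"
  shows "(\<lambda>x. x [^] p) ` K = K"
proof
  show "(\<lambda>x. x [^] p) ` K \<subseteq> K"
  proof clarify
    fix x assume x: "x \<in> K"
    have "x [^] n \<in> K" for n :: nat
      by (induction n) (use x subringE(3,6)[OF subfieldE(1)[OF K]] in auto)
    then show "x [^] p \<in> K" by simp
  qed
  show "K \<subseteq> (\<lambda>x. x [^] p) ` K"
  proof
    fix x assume "x \<in> K"
    then obtain y where "y \<in> K" "y [^] p = x" using assms(2) by (auto simp: perfect_def)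
    then show "x \<in> (\<lambda>x. x [^] p) ` K" by (intro image_eqI[of _ _ y]) simp_all
  qed
qed

text \<open>The Frobenius map sends \<open>E\<close> injectively to a subspace of \<open>E\<close>
  over its image of \<open>K\<close>, which is \<open>K\<close> again. The dimensions are equal and
  finite, so the image is all of \<open>E\<close>.\<close>

lemma finite_extension_perfect:
  assumes K: "subfield K R" and E: "subfield E R" and perf: "perfect K" and fin: "finite_dimension K E"
  shows "perfect E"
proof -
  interpret F: ring_hom_ring R R "\<lambda>x. x [^] p"
    using ring_hom_ringI2[OF ring_axioms ring_axioms frobenius_hom] .
  obtain n where n: "dimension n K E" using fin by (auto simp: finite_dimension_def)
  have inj: "inj_on (\<lambda>x. x [^] p) E"
    using frobenius_inj subfieldE(3)[OF E] by (auto simp: inj_on_def)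
  have "dimension n K ((\<lambda>x. x [^] p) ` E)"
    using F.inj_hom_dimension[OF K one_not_zero inj n] frobenius_image_perfect[OF K perf] by simp
  then obtain Us where Us: "set Us \<subseteq> carrier R" "independent K Us" "length Us = n" "Span K Us = (\<lambda>x. x [^] p) ` E"
    using exists_base[OF K] by blast
  have sub: "(\<lambda>x. x [^] p) ` E \<subseteq> E"
  proof clarify
    fix x assume x: "x \<in> E"
    have "x [^] n \<in> E" for n :: nat
      by (induction n) (use x subringE(3,6)[OF subfieldE(1)[OF E]] in auto)
    then show "x [^] p \<in> E" by simp
  qed
  have "set Us \<subseteq> E" using Span_base_incl[OF K Us(1)] Us(4) sub by blast
  then have "Span K Us = E" using independent_length_eq_dimension[OF K n Us(2)] Us(3) by blast
  from trans[OF sym[OF this] Us(4)] show ?thesis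
    unfolding perfect_def by (metis (no_types, lifting) imageE)
qed

text \<open>The \<open>p\<close>-th powers in the generated field form a subfield; it contains the
  generators, hence everything.\<close>

lemma generate_field_perfect:
  assumes H: "H \<subseteq> carrier R" and roots: "\<And>h. h \<in> H \<Longrightarrow> \<exists>y\<in>generate_field R H. y [^] p = h"
  shows "perfect (generate_field R H)"
proof -
  interpret F: ring_hom_ring R R "\<lambda>x. x [^] p"
    using ring_hom_ringI2[OF ring_axioms ring_axioms frobenius_hom] .
  let ?E = "(\<lambda>x. x [^] p) ` generate_field R H"
  have "H \<subseteq> ?E"
  proof
    fix h assume "h \<in> H"
    from roots[OF this] obtain y where "y \<in> generate_field R H" "y [^] p = h" by (rule bexE)
    then show "h \<in> ?E" by (intro image_eqI[of _ _ y]) simp_all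
  qed
  from generate_field_min_subfield1[OF H F.img_is_subfield(2)[OF generate_field_is_subfield[OF H] one_not_zero] this]
  have sub: "generate_field R H \<subseteq> ?E" .
  show ?thesis
    unfolding perfect_def
  proof
    fix x assume "x \<in> generate_field R H"
    with sub have "x \<in> ?E" by (rule subsetD)
    then obtain y where "x = y [^] p" "y \<in> generate_field R H" by (rule imageE)
    then show "\<exists>y\<in>generate_field R H. y [^] p = x" by (intro bexI[of _ y]) simp_all
  qed
qed

lemma binomial_polynomial:
  assumes F: "subfield F R" and x: "x \<in> F" and n: "n > 0"
  shows "\<exists>q\<in>carrier (F[X]). length q = Suc n \<and> (\<forall>y\<in>carrier R. eval q y = y [^] n \<ominus> x)"
proof (intro bexI conjI ballI)
  \<comment> \<open>The coefficients of \<open>X ^ n - x\<close>, leading coefficient first.\<close>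
  let ?q = "\<one> # replicate (n - 1) \<zero> @ [\<ominus> x]"
  have xR: "x \<in> carrier R" using x subfieldE(3)[OF F] by auto
  note Fs = subringE[OF subfieldE(1)[OF F]]
  have "set ?q \<subseteq> F" using Fs(2,3) Fs(5)[OF x] by (simp add: set_replicate_conv_if)
  then show "?q \<in> carrier (F[X])"
    using one_not_zero by (auto simp: univ_poly_carrier[symmetric] polynomial_def)
  show "length ?q = Suc n" using n by simp
  fix y assume y: "y \<in> carrier R"
  have "eval ?q y = eval (\<one> # replicate (n - 1) \<zero>) y \<otimes> y \<oplus> \<ominus> x"
    using eval_append_aux[of "\<one> # replicate (n - 1) \<zero>" "\<ominus> x" y] xR y by (simp add: set_replicate_conv_if)
  also have "eval (\<one> # replicate (n - 1) \<zero>) y = y [^] (n - 1)"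
    using eval_monom[of \<one> y "n - 1"] y unfolding monom_def by simp
  also have "y [^] (n - 1) \<otimes> y = y [^] n"
    using n nat_pow_Suc[of y "n - 1"] by simp
  finally show "eval ?q y = y [^] n \<ominus> x" by (simp add: minus_eq)
qed

lemma algebraic_pth_root:
  assumes K: "subfield K R" and x: "x \<in> carrier R" "(algebraic over K) x"
    and y: "y \<in> carrier R" "y [^] p = x"
  shows "(algebraic over K) y"
proof -
  let ?F = "simple_extension K x"
  have F: "subfield ?F R" using simple_extension_is_subfield[OF K x(1)] x(2) by simp
  have xF: "x \<in> ?F" using simple_extension_mem[OF subfieldE(1)[OF K] x(1)] .
  obtain q where q: "q \<in> carrier (?F[X])" "length q = Suc p" "eval q y = y [^] p \<ominus> x"
    using binomial_polynomial[OF F xF p_pos] y(1) by blast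
  then have "q \<noteq> []" "eval q y = \<zero>" using x y by (auto simp: minus_eq r_neg)
  then have "(algebraic over ?F) y" using q(1) by (intro algebraicI)
  then have "finite_dimension ?F (simple_extension ?F y)"
    using finite_dimension_simple_extension[OF F y(1)] by simp
  moreover have "finite_dimension K ?F" using finite_dimension_simple_extension[OF K x(1)] x(2) by simp
  ultimately have "finite_dimension K (simple_extension ?F y)"
    using telescopic_base_dim(1)[OF K F] by blast
  then show ?thesis
    using finite_dimension_imp_algebraic[OF K simple_extension_is_subring[OF subfieldE(1)[OF F] y(1)]]
      simple_extension_mem[OF subfieldE(1)[OF F] y(1)] by blast
qed

text \<open>The generators are closed under \<open>p\<close>-th roots: a root of a constant is again
  algebraic over the prime field, and for an iterated root of \<open>t\<close> the exponent
  increases by one.\<close>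

lemma perf_rat_field_perfect:
  assumes roots: "\<And>x. x \<in> carrier R \<Longrightarrow> \<exists>y\<in>carrier R. y [^] p = x"
  shows "subfield (perf_rat_field p R t) R" and "perfect (perf_rat_field p R t)"
proof -
  let ?H = "constants R \<union> {s \<in> carrier R. \<exists>n::nat. s [^] (p ^ n) = t}"
  have P: "subfield (prime_subfield R) R"
    unfolding prime_subfield_def using generate_field_is_subfield by simp
  have H: "?H \<subseteq> carrier R" by (auto simp: constants_def)
  then show "subfield (perf_rat_field p R t) R"
    unfolding perf_rat_field_def by (rule generate_field_is_subfield)
  show "perfect (perf_rat_field p R t)"
    unfolding perf_rat_field_def
  proof (rule generate_field_perfect[OF H])
    fix h assume h: "h \<in> ?H"
    then obtain y where y: "y \<in> carrier R" "y [^] p = h" using H roots by blast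
    have "y \<in> ?H"
    proof (cases "h \<in> constants R")
      case True
      then have "h \<in> carrier R" "(algebraic over (prime_subfield R)) h"
        by (simp_all add: constants_def over_def)
      then have "(algebraic over (prime_subfield R)) y"
        using algebraic_pth_root[OF P _ _ y] by simp
      then show ?thesis using y by (simp add: constants_def over_def)
    next
      case False
      then obtain n :: nat where "h [^] (p ^ n) = t" using h by blast
      then have "y [^] (p ^ Suc n) = t" using y nat_pow_pow[OF y(1), where n = p and m = "p ^ n"] by simp
      then show ?thesis using y by blast
    qed
    then have "y \<in> generate_field R ?H" by (rule generate_field.incl)
    then show "\<exists>y\<in>generate_field R ?H. y [^] p = h" using y(2) by (intro bexI[of _ y])
  qed
qed

text \<open>In characteristic \<open>p\<close> the Frobenius map turns the triangle inequality into
  \<open>\<nu> (x + y) ^ (p ^ k) \<le> 2 * max (\<nu> x) (\<nu> y) ^ (p ^ k)\<close> for all \<open>k\<close>.\<close>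

lemma absolute_value_ultrametric:
  assumes \<nu>: "absolute_value R (carrier R) \<nu>" and x: "x \<in> carrier R" and y: "y \<in> carrier R"
  shows "\<nu> (x \<oplus> y) \<le> max (\<nu> x) (\<nu> y)"
proof (rule ccontr)
  assume contr: "\<not> \<nu> (x \<oplus> y) \<le> max (\<nu> x) (\<nu> y)"
  have nn: "0 \<le> \<nu> a" "\<nu> a = 0 \<longleftrightarrow> a = \<zero>" if "a \<in> carrier R" for a
    using \<nu> that by (auto simp: absolute_value_def)
  have mult: "\<nu> (a \<otimes> b) = \<nu> a * \<nu> b" and tri: "\<nu> (a \<oplus> b) \<le> \<nu> a + \<nu> b"
    if "a \<in> carrier R" "b \<in> carrier R" for a b
    using \<nu> that by (auto simp: absolute_value_def)
  define m where "m = max (\<nu> x) (\<nu> y)"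
  have lt: "m < \<nu> (x \<oplus> y)" using contr unfolding m_def by linarith
  have m0: "0 < m"
  proof (rule ccontr)
    assume "\<not> 0 < m"
    then have "\<nu> x = 0" "\<nu> y = 0" using nn(1)[OF x] nn(1)[OF y] by (auto simp: m_def)
    then have "x \<oplus> y = \<zero>" using nn x y by simp
    then show False using lt m_def nn(2)[of \<zero>] \<open>\<nu> x = 0\<close> \<open>\<nu> y = 0\<close> by simp
  qed
  have one: "\<nu> \<one> = 1" using mult[of \<one> \<one>] nn(2)[of \<one>] one_not_zero by simp
  have pow: "\<nu> (a [^] (n::nat)) = \<nu> a ^ n" if "a \<in> carrier R" for a n
    using that by (induction n) (simp_all add: one mult mult.commute)
  have frob: "(x \<oplus> y) [^] (p ^ k) = x [^] (p ^ k) \<oplus> y [^] (p ^ k)" for k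
  proof (induction k)
    case (Suc k)
    have "(x \<oplus> y) [^] (p ^ Suc k) = ((x \<oplus> y) [^] (p ^ k)) [^] p"
      using x y by (simp add: nat_pow_pow mult.commute)
    also have "\<dots> = (x [^] (p ^ k)) [^] p \<oplus> (y [^] (p ^ k)) [^] p"
      unfolding Suc using x y by (intro frobenius_add) auto
    finally show ?case using x y by (simp add: nat_pow_pow mult.commute)
  qed (use x y in simp)
  define r where "r = \<nu> (x \<oplus> y) / m"
  have r: "1 < r" using lt m0 by (simp add: r_def)
  have bound: "r ^ (p ^ k) \<le> 2" for k
  proof -
    have "\<nu> (x \<oplus> y) ^ (p ^ k) \<le> \<nu> x ^ (p ^ k) + \<nu> y ^ (p ^ k)"
      using tri[of "x [^] (p ^ k)" "y [^] (p ^ k)"] x y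
      unfolding frob[symmetric] by (simp add: pow)
    also have "\<dots> \<le> m ^ (p ^ k) + m ^ (p ^ k)"
      using nn x y by (intro add_mono power_mono) (auto simp: m_def)
    finally show ?thesis using m0 by (simp add: r_def power_divide field_simps)
  qed
  obtain k where k: "2 < r ^ k" using real_arch_pow[OF r] by blast
  have "k \<le> p ^ k" using p_gt_1 by (simp add: less_imp_le_nat power_gt_expt)
  then have "r ^ k \<le> r ^ (p ^ k)" using r by (intro power_increasing) auto
  then show False using k bound[of k] by simp
qed

end


section \<open>Automorphisms of the algebraic closure\<close>

context algebraic_closure
begin

lemmas K_closed = subringE(1,2,3,5,7,6)[OF subfieldE(1)[OF subfield_axioms]]

text \<open>A graph of an embedding over \<open>K\<close>. Relations are used because the union of a
  chain is again one of them. Functionality is not demanded: it follows from additivity and the last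
  condition.\<close>

definition partial_iso :: "('a \<times> 'a) set \<Rightarrow> bool" where
  "partial_iso \<Gamma> \<longleftrightarrow> \<Gamma> \<subseteq> carrier L \<times> carrier L \<and> Id_on K \<subseteq> \<Gamma> \<and>
     (\<forall>a b a' b'. (a, b) \<in> \<Gamma> \<longrightarrow> (a', b') \<in> \<Gamma> \<longrightarrow> (a \<oplus> a', b \<oplus> b') \<in> \<Gamma> \<and> (a \<otimes> a', b \<otimes> b') \<in> \<Gamma>) \<and>
     (\<forall>a\<in>Domain \<Gamma>. a \<noteq> \<zero> \<longrightarrow> inv a \<in> Domain \<Gamma>) \<and> (\<forall>b. (\<zero>, b) \<in> \<Gamma> \<longrightarrow> b = \<zero>)"

lemma partial_isoD:
  assumes "partial_iso \<Gamma>"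
  shows "(a, b) \<in> \<Gamma> \<Longrightarrow> a \<in> carrier L" "(a, b) \<in> \<Gamma> \<Longrightarrow> b \<in> carrier L"
    and "k \<in> K \<Longrightarrow> (k, k) \<in> \<Gamma>"
    and "\<lbrakk>(a, b) \<in> \<Gamma>; (a', b') \<in> \<Gamma>\<rbrakk> \<Longrightarrow> (a \<oplus> a', b \<oplus> b') \<in> \<Gamma>"
    and "\<lbrakk>(a, b) \<in> \<Gamma>; (a', b') \<in> \<Gamma>\<rbrakk> \<Longrightarrow> (a \<otimes> a', b \<otimes> b') \<in> \<Gamma>"
    and "\<lbrakk>a \<in> Domain \<Gamma>; a \<noteq> \<zero>\<rbrakk> \<Longrightarrow> inv a \<in> Domain \<Gamma>"
    and "(\<zero>, b) \<in> \<Gamma> \<Longrightarrow> b = \<zero>"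
  using assms unfolding partial_iso_def by auto

lemma partial_iso_functional:
  assumes "partial_iso \<Gamma>" "(a, b) \<in> \<Gamma>" "(a, c) \<in> \<Gamma>"
  shows "b = c"
proof -
  note D = partial_isoD[OF assms(1)]
  have cl: "a \<in> carrier L" "b \<in> carrier L" "c \<in> carrier L" using assms D(1,2) by auto
  \<comment> \<open>Closure under negation comes from multiplication by this pair, which is present
    because \<open>K\<close> contains \<open>\<ominus> \<one>\<close>.\<close>
  have "(\<ominus> \<one>, \<ominus> \<one>) \<in> \<Gamma>" using D(3)[OF K_closed(4)[OF K_closed(3)]] .
  from D(5)[OF this assms(3)] have "(\<ominus> \<one> \<otimes> a, \<ominus> \<one> \<otimes> c) \<in> \<Gamma>" .
  then have "(\<ominus> a, \<ominus> c) \<in> \<Gamma>" using cl by (simp add: l_minus)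
  from D(4)[OF assms(2) this] have "(\<zero>, b \<ominus> c) \<in> \<Gamma>" using cl by (simp add: minus_eq r_neg)
  then have "b \<ominus> c = \<zero>" using D(7) by blast
  then show ?thesis using cl by simp
qed

definition ev :: "('a \<times> 'a) set \<Rightarrow> 'a \<Rightarrow> 'a" where
  "ev \<Gamma> a = (THE b. (a, b) \<in> \<Gamma>)"

lemma ev_eq: "\<lbrakk>partial_iso \<Gamma>; (a, b) \<in> \<Gamma>\<rbrakk> \<Longrightarrow> ev \<Gamma> a = b"
  unfolding ev_def by (rule the_equality) (auto dest: partial_iso_functional)

lemma partial_iso_Domain:
  assumes "partial_iso \<Gamma>"
  shows "subfield (Domain \<Gamma>) L"
proof (rule subfieldI')
  note D = partial_isoD[OF assms]
  show "subring (Domain \<Gamma>) L"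
  proof (rule subringI)
    show "Domain \<Gamma> \<subseteq> carrier L" using D(1) by auto
    show "\<one> \<in> Domain \<Gamma>" using D(3)[OF K_closed(3)] by (rule DomainI)
    show "h1 \<oplus> h2 \<in> Domain \<Gamma>" if "h1 \<in> Domain \<Gamma>" "h2 \<in> Domain \<Gamma>" for h1 h2
      using that D(4) by fast
    show m: "h1 \<otimes> h2 \<in> Domain \<Gamma>" if "h1 \<in> Domain \<Gamma>" "h2 \<in> Domain \<Gamma>" for h1 h2
      using that D(5) by fast
    show "\<ominus> h \<in> Domain \<Gamma>" if h: "h \<in> Domain \<Gamma>" for h
    proof -
      have "\<ominus> \<one> \<in> Domain \<Gamma>" using D(3)[OF K_closed(4)[OF K_closed(3)]] by (rule DomainI)
      from m[OF this h] show ?thesis using h D(1) by (auto simp: l_minus)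
    qed
  qed
  show "inv h \<in> Domain \<Gamma>" if "h \<in> Domain \<Gamma> - {\<zero>}" for h
    using that D(6) by auto
qed

lemma partial_iso_hom:
  assumes "partial_iso \<Gamma>"
  shows "ev \<Gamma> \<in> ring_hom (L\<lparr>carrier := Domain \<Gamma>\<rparr>) L"
proof (rule ring_hom_memI)
  note D = partial_isoD[OF assms]
  fix a b assume "a \<in> carrier (L\<lparr>carrier := Domain \<Gamma>\<rparr>)" "b \<in> carrier (L\<lparr>carrier := Domain \<Gamma>\<rparr>)"
  then obtain a' b' where ab: "(a, a') \<in> \<Gamma>" "(b, b') \<in> \<Gamma>" by auto
  then show "ev \<Gamma> (a \<otimes>\<^bsub>L\<lparr>carrier := Domain \<Gamma>\<rparr>\<^esub> b) = ev \<Gamma> a \<otimes> ev \<Gamma> b"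
    "ev \<Gamma> (a \<oplus>\<^bsub>L\<lparr>carrier := Domain \<Gamma>\<rparr>\<^esub> b) = ev \<Gamma> a \<oplus> ev \<Gamma> b"
    using D(4,5)[OF ab] assms by (simp_all add: ev_eq)
next
  show "ev \<Gamma> \<one>\<^bsub>L\<lparr>carrier := Domain \<Gamma>\<rparr>\<^esub> = \<one>"
    using ev_eq[OF assms partial_isoD(3)[OF assms K_closed(3)]] by simp
next
  fix a assume "a \<in> carrier (L\<lparr>carrier := Domain \<Gamma>\<rparr>)"
  then show "ev \<Gamma> a \<in> carrier L" using assms partial_isoD(2)[OF assms] by (auto simp: ev_eq)
qed

text \<open>The new graph consists of the pairs of \<open>q\<close> evaluated at \<open>x\<close>
  and its transported version at \<open>y\<close>, for \<open>q\<close> over the domain. It is well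
  defined because a polynomial that vanishes at \<open>x\<close> is a multiple of the minimal
  polynomial, whose transported version vanishes at \<open>y\<close>.\<close>

lemma partial_iso_extend:
  assumes \<Gamma>: "partial_iso \<Gamma>" and x: "x \<in> carrier L" and y: "y \<in> carrier L"
    and root: "eval (map (ev \<Gamma>) (Irr (Domain \<Gamma>) x)) y = \<zero>"
  shows "\<exists>\<Gamma>'. partial_iso \<Gamma>' \<and> \<Gamma> \<subseteq> \<Gamma>' \<and> (x, y) \<in> \<Gamma>'"
proof -
  note \<Gamma>D = partial_isoD[OF \<Gamma>]
  define D where "D = Domain \<Gamma>"
  define h where "h = ev \<Gamma>"
  define E where "E q = eval (map h q) y" for q
  have D: "subfield D L" unfolding D_def using \<Gamma> by (rule partial_iso_Domain)
  note Ds = subringE[OF subfieldE(1)[OF D]]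
  have KD: "K \<subseteq> D" using \<Gamma>D(3) by (auto simp: D_def)
  have alg: "(algebraic over D) x"
    using algebraic_mono[OF KD algebraic_extension[OF x]] by simp
  interpret H: ring_hom_ring "L\<lparr>carrier := D\<rparr>" L h
    unfolding D_def h_def
    using ring_hom_ringI2[OF subring_is_ring[OF subfieldE(1)[OF partial_iso_Domain[OF \<Gamma>]]] ring_axioms
        partial_iso_hom[OF \<Gamma>]] .
  interpret PD: domain "D[X]" using univ_poly_is_domain[OF subfieldE(1)[OF D]] .
  have hD: "h a \<in> carrier L" if "a \<in> D" for a using H.hom_closed that by simp
  have setD: "set q \<subseteq> D" if "q \<in> carrier (D[X])" for q
    using that by (auto simp: univ_poly_carrier[symmetric] polynomial_def)
  have sub: "set q \<subseteq> carrier L" if "q \<in> carrier (D[X])" for q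
    using setD[OF that] Ds(1) by blast
  have mapsub: "set (map h q) \<subseteq> carrier L" if "q \<in> carrier (D[X])" for q
    using setD[OF that] hD by auto
  \<comment> \<open>The homomorphism laws for \<open>map h\<close> are stated for normalised
    coefficient lists; evaluation does not see leading zeros.\<close>
  have norm: "eval (map h q) y = eval (normalize (map h q)) y" if "q \<in> carrier (D[X])" for q
    using eval_normalize[OF mapsub[OF that] y] by simp
  have E_closed: "E q \<in> carrier L" if "q \<in> carrier (D[X])" for q
    unfolding E_def using eval_in_carrier[OF mapsub[OF that] y] .
  have E_add: "E (q \<oplus>\<^bsub>D[X]\<^esub> r) = E q \<oplus> E r" if qr: "q \<in> carrier (D[X])" "r \<in> carrier (D[X])" for q r
  proof -
    have "E (q \<oplus>\<^bsub>D[X]\<^esub> r) = eval (normalize (map h (q \<oplus>\<^bsub>D[X]\<^esub> r))) y"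
      unfolding E_def using norm qr by simp
    also have "normalize (map h (q \<oplus>\<^bsub>D[X]\<^esub> r)) = poly_add (map h q) (map h r)"
      using H.poly_add_hom'[of q r] setD[OF qr(1)] setD[OF qr(2)]
      by (simp add: univ_poly_add poly_add_consistent[OF subfieldE(1)[OF D]])
    also have "eval \<dots> y = E q \<oplus> E r"
      unfolding E_def using eval_poly_add[OF mapsub[OF qr(1)] mapsub[OF qr(2)] y] .
    finally show ?thesis .
  qed
  have E_mult: "E (q \<otimes>\<^bsub>D[X]\<^esub> r) = E q \<otimes> E r" if qr: "q \<in> carrier (D[X])" "r \<in> carrier (D[X])" for q r
  proof -
    have "E (q \<otimes>\<^bsub>D[X]\<^esub> r) = eval (normalize (map h (q \<otimes>\<^bsub>D[X]\<^esub> r))) y"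
      unfolding E_def using norm qr by simp
    also have "normalize (map h (q \<otimes>\<^bsub>D[X]\<^esub> r)) = poly_mult (map h q) (map h r)"
      using H.poly_mult_hom'[of q r] setD[OF qr(1)] setD[OF qr(2)]
      by (simp add: univ_poly_mult poly_mult_consistent[OF subfieldE(1)[OF D]])
    also have "eval \<dots> y = E q \<otimes> E r"
      unfolding E_def using eval_poly_mult[OF mapsub[OF qr(1)] mapsub[OF qr(2)] y] .
    finally show ?thesis .
  qed
  have eval_hom: "eval (q \<oplus>\<^bsub>D[X]\<^esub> r) x = eval q x \<oplus> eval r x"
    "eval (q \<otimes>\<^bsub>D[X]\<^esub> r) x = eval q x \<otimes> eval r x"
    if qr: "q \<in> carrier (D[X])" "r \<in> carrier (D[X])" for q r
    using eval_poly_add[OF sub[OF qr(1)] sub[OF qr(2)] x] eval_poly_mult[OF sub[OF qr(1)] sub[OF qr(2)] x]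
    by (simp_all add: univ_poly_add univ_poly_mult)
  define \<Gamma>' where "\<Gamma>' = (\<lambda>q. (eval q x, E q)) ` carrier (D[X])"
  have Dom: "Domain \<Gamma>' = simple_extension D x"
    unfolding simple_extension_as_eval_img[OF Ds(1) x] \<Gamma>'_def by force
  have const: "(a, b) \<in> \<Gamma>'" if ab: "(a, b) \<in> \<Gamma>" for a b
  proof -
    \<comment> \<open>The zero polynomial is the empty list, so the constant 0 needs its own
      case.\<close>
    define q where "q = (if a = \<zero> then [] else [a])"
    have a: "a \<in> D" "a \<in> carrier L" "b \<in> carrier L" "h a = b"
      using ab \<Gamma>D(1,2) ev_eq[OF \<Gamma> ab] by (auto simp: D_def h_def)
    have "q \<in> carrier (D[X])"
      using a by (auto simp: q_def univ_poly_carrier[symmetric] polynomial_def)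
    moreover have "eval q x = a" using a x by (simp add: q_def)
    moreover have "E q = b"
      using a y \<Gamma>D(7)[of b] ab by (auto simp: q_def E_def)
    ultimately show ?thesis unfolding \<Gamma>'_def by (intro image_eqI[of _ _ q]) simp_all
  qed
  have Irr: "Irr D x \<in> carrier (D[X])" using IrrE(1)[OF D x alg] .
  have zero: "E q = \<zero>" if q: "q \<in> carrier (D[X])" "eval q x = \<zero>" for q
  proof -
    have "(Irr D x) pdivides q" using Irr_minimal[OF D x alg q] .
    then obtain r where r: "r \<in> carrier (D[X])" "q = Irr D x \<otimes>\<^bsub>D[X]\<^esub> r"
      using pdivides_iff_shell[OF D Irr q(1)] by (auto simp: factor_def)
    then have "E q = E (Irr D x) \<otimes> E r" using E_mult[OF Irr r(1)] by simp
    also have "E (Irr D x) = \<zero>" using root by (simp add: E_def D_def h_def)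
    finally show ?thesis using E_closed[OF r(1)] by simp
  qed
  have "partial_iso \<Gamma>'"
    unfolding partial_iso_def
  proof (intro conjI allI impI ballI)
    show "\<Gamma>' \<subseteq> carrier L \<times> carrier L"
      unfolding \<Gamma>'_def using E_closed eval_in_carrier[OF sub x] by auto
    show "Id_on K \<subseteq> \<Gamma>'" using const[OF \<Gamma>D(3)] by (auto simp: Id_on_def)
    fix a b a' b' assume "(a, b) \<in> \<Gamma>'" "(a', b') \<in> \<Gamma>'"
    then obtain q r where qr: "q \<in> carrier (D[X])" "r \<in> carrier (D[X])"
      and eq: "a = eval q x" "b = E q" "a' = eval r x" "b' = E r"
      unfolding \<Gamma>'_def by auto
    show "(a \<oplus> a', b \<oplus> b') \<in> \<Gamma>'"
      unfolding \<Gamma>'_def eq using qr by (intro image_eqI[of _ _ "q \<oplus>\<^bsub>D[X]\<^esub> r"]) (simp_all add: E_add eval_hom)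
    show "(a \<otimes> a', b \<otimes> b') \<in> \<Gamma>'"
      unfolding \<Gamma>'_def eq using qr by (intro image_eqI[of _ _ "q \<otimes>\<^bsub>D[X]\<^esub> r"]) (simp_all add: E_mult eval_hom)
  next
    fix a assume a: "a \<in> Domain \<Gamma>'" "a \<noteq> \<zero>"
    have "subfield (simple_extension D x) L" using simple_extension_is_subfield[OF D x] alg by simp
    then show "inv a \<in> Domain \<Gamma>'" using subfield_m_inv(1)[of "simple_extension D x" a] a by (simp add: Dom)
  next
    fix b assume "(\<zero>, b) \<in> \<Gamma>'"
    then obtain q where "q \<in> carrier (D[X])" "eval q x = \<zero>" "b = E q" unfolding \<Gamma>'_def by auto
    then show "b = \<zero>" using zero by simp
  qed
  moreover have "(x, y) \<in> \<Gamma>'"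
  proof -
    have "[\<one>, \<zero>] \<in> carrier (D[X])"
      using Ds(2,3) one_not_zero by (simp add: univ_poly_carrier[symmetric] polynomial_def)
    moreover have "eval [\<one>, \<zero>] x = x" using x by simp
    moreover have "h \<one> = \<one>" "h \<zero> = \<zero>"
      using ev_eq[OF \<Gamma> \<Gamma>D(3)[OF K_closed(3)]] ev_eq[OF \<Gamma> \<Gamma>D(3)[OF K_closed(2)]] by (simp_all add: h_def)
    then have "E [\<one>, \<zero>] = y" using y by (simp add: E_def)
    ultimately show ?thesis unfolding \<Gamma>'_def by (intro image_eqI[of _ _ "[\<one>, \<zero>]"]) simp_all
  qed
  ultimately show ?thesis using const by auto
qed

lemma partial_iso_Id: "partial_iso (Id_on K)"
  unfolding partial_iso_def
proof (intro conjI allI impI ballI)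
  show "Id_on K \<subseteq> carrier L \<times> carrier L" using K_closed(1) by auto
  show "(a \<oplus> a', b \<oplus> b') \<in> Id_on K" "(a \<otimes> a', b \<otimes> b') \<in> Id_on K"
    if "(a, b) \<in> Id_on K" "(a', b') \<in> Id_on K" for a b a' b'
    using that K_closed(5,6) by (auto simp: Id_on_iff)
  show "inv a \<in> Domain (Id_on K)" if "a \<in> Domain (Id_on K)" "a \<noteq> \<zero>" for a
    using that subfield_m_inv(1)[OF subfield_axioms, of a] by simp
qed (simp_all add: Id_on_iff)

lemma ev_Id: "a \<in> K \<Longrightarrow> ev (Id_on K) a = a"
  using ev_eq[OF partial_iso_Id, of a a] by auto

text \<open>By Zorn's lemma there is a maximal extension. An element outside its domain would be
  algebraic over it, and a root of the transported minimal polynomial would give a proper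
  extension.\<close>

lemma partial_iso_total:
  assumes "partial_iso \<Gamma>0"
  shows "\<exists>\<Gamma>. partial_iso \<Gamma> \<and> \<Gamma>0 \<subseteq> \<Gamma> \<and> Domain \<Gamma> = carrier L"
proof -
  let ?A = "{\<Gamma>. partial_iso \<Gamma> \<and> \<Gamma>0 \<subseteq> \<Gamma>}"
  have "\<exists>M\<in>?A. \<forall>Y\<in>?A. M \<subseteq> Y \<longrightarrow> Y = M"
  proof (rule subset_Zorn_nonempty)
    show "?A \<noteq> {}" using assms by auto
    fix C assume C: "C \<noteq> {}" "subset.chain ?A C"
    then have mem: "\<And>\<Gamma>. \<Gamma> \<in> C \<Longrightarrow> partial_iso \<Gamma>" "\<And>\<Gamma>. \<Gamma> \<in> C \<Longrightarrow> \<Gamma>0 \<subseteq> \<Gamma>"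
      and total: "\<And>\<Gamma> \<Delta>. \<lbrakk>\<Gamma> \<in> C; \<Delta> \<in> C\<rbrakk> \<Longrightarrow> \<Gamma> \<subseteq> \<Delta> \<or> \<Delta> \<subseteq> \<Gamma>"
      by (auto simp: subset_chain_def)
    obtain \<Gamma>1 where \<Gamma>1: "\<Gamma>1 \<in> C" using C by blast
    have "partial_iso (\<Union>C)"
      unfolding partial_iso_def
    proof (intro conjI allI impI ballI)
      show "\<Union>C \<subseteq> carrier L \<times> carrier L" using mem(1) unfolding partial_iso_def by blast
      show "Id_on K \<subseteq> \<Union>C" using mem(1)[OF \<Gamma>1] \<Gamma>1 unfolding partial_iso_def by blast
      fix a b a' b' assume "(a, b) \<in> \<Union>C" "(a', b') \<in> \<Union>C"
      then obtain \<Gamma> where "\<Gamma> \<in> C" "(a, b) \<in> \<Gamma>" "(a', b') \<in> \<Gamma>" using total by blast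
      then show "(a \<oplus> a', b \<oplus> b') \<in> \<Union>C" "(a \<otimes> a', b \<otimes> b') \<in> \<Union>C"
        using partial_isoD(4,5)[OF mem(1)] by blast+
    next
      fix a assume "a \<in> Domain (\<Union>C)" "a \<noteq> \<zero>"
      then show "inv a \<in> Domain (\<Union>C)" using partial_isoD(6)[OF mem(1)] by blast
    next
      fix b assume "(\<zero>, b) \<in> \<Union>C"
      then show "b = \<zero>" using partial_isoD(7)[OF mem(1)] by blast
    qed
    then show "\<Union>C \<in> ?A" using mem(2)[OF \<Gamma>1] \<Gamma>1 by blast
  qed
  then obtain M where M: "partial_iso M" "\<Gamma>0 \<subseteq> M"
    and max: "\<And>\<Gamma>. \<lbrakk>partial_iso \<Gamma>; M \<subseteq> \<Gamma>\<rbrakk> \<Longrightarrow> \<Gamma> = M" by auto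
  have "x \<in> Domain M" if x: "x \<in> carrier L" for x
  proof -
    let ?D = "Domain M"
    have D: "subfield ?D L" using M(1) by (rule partial_iso_Domain)
    have KD: "K \<subseteq> ?D" using partial_isoD(3)[OF M(1)] by auto
    have alg: "(algebraic over ?D) x" using algebraic_mono[OF KD algebraic_extension[OF x]] by simp
    have Irr: "Irr ?D x \<in> carrier (poly_ring (L\<lparr>carrier := ?D\<rparr>))"
      using IrrE(1)[OF D x alg] univ_poly_consistent[OF subfieldE(1)[OF D]] by simp
    have "map (ev M) (Irr ?D x) \<in> carrier (poly_ring L)"
      using polynomial_hom[OF partial_iso_hom[OF M(1)] subfield_iff(2)[OF D] field_axioms Irr] .
    moreover have "degree (map (ev M) (Irr ?D x)) > 0"
      using pirreducible_degree[OF D IrrE(1)[OF D x alg] IrrE(2)[OF D x alg]] by simp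
    ultimately obtain y where "y \<in> carrier L" "eval (map (ev M) (Irr ?D x)) y = \<zero>"
      using exists_root_of_poly by blast
    then obtain \<Gamma>' where "partial_iso \<Gamma>'" "M \<subseteq> \<Gamma>'" "(x, y) \<in> \<Gamma>'"
      using partial_iso_extend[OF M(1) x] by blast
    then show ?thesis using max by blast
  qed
  then have "Domain M = carrier L" using partial_isoD(1)[OF M(1)] by auto
  then show ?thesis using M by blast
qed

lemma Irr_props:
  assumes "x \<in> carrier L"
  shows "Irr K x \<in> carrier (K[X])" "pirreducible K (Irr K x)" "lead_coeff (Irr K x) = \<one>"
    "eval (Irr K x) x = \<zero>" "Irr K x \<in> carrier (poly_ring L)" "degree (Irr K x) \<ge> 1" "Irr K x \<noteq> []"
    "set (Irr K x) \<subseteq> K" "monic (Irr K x)"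
proof -
  note I = IrrE[OF subfield_axioms assms algebraic_extension[OF assms]]
  show "Irr K x \<in> carrier (K[X])" "pirreducible K (Irr K x)" "lead_coeff (Irr K x) = \<one>"
    "eval (Irr K x) x = \<zero>" by (rule I)+
  show c: "Irr K x \<in> carrier (poly_ring L)"
    using carrier_polynomial_shell[OF subfieldE(1)[OF subfield_axioms] I(1)] .
  show d: "degree (Irr K x) \<ge> 1" using pirreducible_degree[OF subfield_axioms I(1,2)] .
  then show n: "Irr K x \<noteq> []" by auto
  show "set (Irr K x) \<subseteq> K" using I(1) by (auto simp: univ_poly_carrier[symmetric] polynomial_def)
  show "monic (Irr K x)" using c n I(3) by (simp add: monic_def)
qed

lemma finite_roots: "x \<in> carrier L \<Longrightarrow> finite {y \<in> carrier L. eval (Irr K x) y = \<zero>}"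
  using finite_number_of_roots[OF Irr_props(5)] Irr_props(7) by (simp add: is_root_def)

section \<open>Automorphisms over the base field and their orbits\<close>

abbreviation G :: "('a \<Rightarrow> 'a) set" where
  "G \<equiv> galois_group L K"

lemma GD:
  assumes "\<phi> \<in> G"
  shows "\<phi> \<in> ring_iso L L" "\<phi> \<in> ring_hom L L" "a \<in> K \<Longrightarrow> \<phi> a = a" "bij_betw \<phi> (carrier L) (carrier L)"
    "x \<in> carrier L \<Longrightarrow> \<phi> x \<in> carrier L"
  using assms by (auto simp: galois_group_def ring_iso_def ring_hom_memE)

lemma G_hom_ring: "\<phi> \<in> G \<Longrightarrow> ring_hom_ring L L \<phi>"
  using ring_hom_ringI2[OF ring_axioms ring_axioms GD(2)] .

lemma G_eval:
  assumes "\<phi> \<in> G" "set q \<subseteq> K" "x \<in> carrier L"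
  shows "eval q (\<phi> x) = \<phi> (eval q x)"
proof -
  interpret S: ring_hom_ring L L \<phi> using G_hom_ring[OF assms(1)] .
  have "map \<phi> q = q" using GD(3)[OF assms(1)] assms(2) by (intro map_idI) auto
  then show ?thesis using S.eval_hom'[of x q] assms K_closed(1) by auto
qed

text \<open>Sending \<open>x\<close> to \<open>y\<close> extends to an endomorphism of the closure.
  It is surjective because it is injective and maps the finite root set of each minimal polynomial
  over \<open>K\<close> into itself.\<close>

lemma exists_automorphism:
  assumes x: "x \<in> carrier L" and y: "y \<in> carrier L" "eval (Irr K x) y = \<zero>"
  shows "\<exists>\<phi>\<in>G. \<phi> x = y"
proof -
  have "map (ev (Id_on K)) (Irr K x) = Irr K x"
    using Irr_props(8)[OF x] ev_Id by (intro map_idI) auto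
  then obtain \<Gamma>0 where "partial_iso \<Gamma>0" "(x, y) \<in> \<Gamma>0"
    using partial_iso_extend[OF partial_iso_Id x y(1)] y(2) by auto
  then obtain \<Gamma> where \<Gamma>: "partial_iso \<Gamma>" "(x, y) \<in> \<Gamma>" "Domain \<Gamma> = carrier L"
    using partial_iso_total by blast
  let ?\<phi> = "ev \<Gamma>"
  have "L\<lparr>carrier := carrier L\<rparr> = L" by simp
  then have hom: "?\<phi> \<in> ring_hom L L" using partial_iso_hom[OF \<Gamma>(1)] \<Gamma>(3) by simp
  have fixK: "?\<phi> a = a" if "a \<in> K" for a using ev_eq[OF \<Gamma>(1) partial_isoD(3)[OF \<Gamma>(1) that]] .
  have inj: "inj_on ?\<phi> (carrier L)"
    using non_trivial_field_hom_is_inj[OF hom field_axioms field_axioms] by simp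
  interpret S: ring_hom_ring L L ?\<phi> using ring_hom_ringI2[OF ring_axioms ring_axioms hom] .
  have "z \<in> ?\<phi> ` carrier L" if z: "z \<in> carrier L" for z
  proof -
    let ?R = "{w \<in> carrier L. eval (Irr K z) w = \<zero>}"
    have "?\<phi> ` ?R \<subseteq> ?R"
    proof clarify
      fix w assume w: "w \<in> carrier L" "eval (Irr K z) w = \<zero>"
      have "map ?\<phi> (Irr K z) = Irr K z" using Irr_props(8)[OF z] fixK by (intro map_idI) auto
      then show "?\<phi> w \<in> carrier L \<and> eval (Irr K z) (?\<phi> w) = \<zero>"
        using S.eval_hom'[of w "Irr K z"] w Irr_props(8)[OF z] K_closed(1) by auto
    qed
    moreover have "inj_on ?\<phi> ?R" using inj by (rule inj_on_subset) auto
    ultimately have eq: "?\<phi> ` ?R = ?R" using finite_roots[OF z] by (intro endo_inj_surj)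
    have "z \<in> ?R" using z Irr_props(4)[OF z] by simp
    then have "z \<in> ?\<phi> ` ?R" by (simp only: eq)
    then show ?thesis by (elim imageE) simp
  qed
  then have "bij_betw ?\<phi> (carrier L) (carrier L)"
    using inj S.hom_closed by (auto simp: bij_betw_def)
  then have "?\<phi> \<in> G" using hom fixK by (simp add: galois_group_def ring_iso_def)
  moreover have "?\<phi> x = y" using ev_eq \<Gamma> by blast
  ultimately show ?thesis by blast
qed

lemma G_id: "id \<in> G"
  by (auto simp: galois_group_def ring_iso_def bij_betw_def intro!: ring_hom_memI)

lemma G_comp: "\<lbrakk>\<phi> \<in> G; \<tau> \<in> G\<rbrakk> \<Longrightarrow> \<phi> \<circ> \<tau> \<in> G"
  using ring_iso_set_trans[of \<tau> L L \<phi> L] K_closed(1) by (auto simp: galois_group_def)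

lemma G_inv:
  assumes \<phi>: "\<phi> \<in> G"
  shows "\<exists>\<tau>\<in>G. (\<forall>x\<in>carrier L. \<tau> (\<phi> x) = x) \<and> (\<forall>x\<in>carrier L. \<phi> (\<tau> x) = x)"
proof -
  let ?\<tau> = "inv_into (carrier L) \<phi>"
  note b = GD(4)[OF \<phi>]
  have "?\<tau> \<in> ring_iso L L" using ring_iso_set_sym[OF ring_axioms GD(1)[OF \<phi>]] .
  moreover have l: "?\<tau> (\<phi> x) = x" if "x \<in> carrier L" for x using bij_betw_inv_into_left[OF b that] .
  moreover have "?\<tau> a = a" if "a \<in> K" for a
    using l[of a] that GD(3)[OF \<phi> that] K_closed(1) by auto
  ultimately show ?thesis
    using bij_betw_inv_into_right[OF b] by (intro bexI[of _ ?\<tau>]) (auto simp: galois_group_def)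
qed

abbreviation orb :: "'a \<Rightarrow> 'a set" where
  "orb \<equiv> galois_orbit L K"

lemma orb_eq:
  assumes x: "x \<in> carrier L"
  shows "orb x = {y \<in> carrier L. eval (Irr K x) y = \<zero>}"
proof
  show "orb x \<subseteq> {y \<in> carrier L. eval (Irr K x) y = \<zero>}"
  proof
    fix y assume "y \<in> orb x"
    then obtain \<phi> where \<phi>: "\<phi> \<in> G" "y = \<phi> x" by (auto simp: galois_orbit_def)
    interpret S: ring_hom_ring L L \<phi> using G_hom_ring[OF \<phi>(1)] .
    show "y \<in> {y \<in> carrier L. eval (Irr K x) y = \<zero>}"
      using G_eval[OF \<phi>(1) Irr_props(8)[OF x] x] Irr_props(4)[OF x] \<phi> x by simp
  qed
  show "{y \<in> carrier L. eval (Irr K x) y = \<zero>} \<subseteq> orb x"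
    using exists_automorphism[OF x] by (auto simp: galois_orbit_def)
qed

lemma orb_closed: "x \<in> carrier L \<Longrightarrow> orb x \<subseteq> carrier L"
  and orb_finite: "x \<in> carrier L \<Longrightarrow> finite (orb x)"
  by (simp_all add: orb_eq finite_roots)

lemma orb_self: "x \<in> orb x"
  unfolding galois_orbit_def using G_id by (intro image_eqI[of _ _ id]) auto

lemma orb_image:
  assumes x: "x \<in> carrier L" and \<phi>: "\<phi> \<in> G"
  shows "\<phi> ` orb x = orb x"
proof -
  have "\<phi> ` orb x \<subseteq> orb x"
  proof
    fix y assume "y \<in> \<phi> ` orb x"
    then obtain \<tau> where \<tau>: "\<tau> \<in> G" "y = \<phi> (\<tau> x)" by (auto simp: galois_orbit_def)
    then show "y \<in> orb x"
      using G_comp[OF \<phi> \<tau>(1)] unfolding galois_orbit_def by (intro image_eqI[of _ _ "\<phi> \<circ> \<tau>"]) auto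
  qed
  moreover have "inj_on \<phi> (orb x)"
    using GD(4)[OF \<phi>] orb_closed[OF x] by (auto simp: bij_betw_def intro: inj_on_subset)
  ultimately show ?thesis using orb_finite[OF x] by (intro endo_inj_surj)
qed

lemma orb_trans:
  assumes x: "x \<in> carrier L" and y: "y \<in> orb x"
  shows "orb y = orb x"
proof
  obtain \<phi> where \<phi>: "\<phi> \<in> G" "y = \<phi> x" using y by (auto simp: galois_orbit_def)
  show "orb y \<subseteq> orb x"
  proof
    fix z assume "z \<in> orb y"
    then obtain \<tau> where \<tau>: "\<tau> \<in> G" "z = \<tau> y" by (auto simp: galois_orbit_def)
    then show "z \<in> orb x" using orb_image[OF x \<tau>(1)] y by blast
  qed
  obtain \<rho> where \<rho>: "\<rho> \<in> G" "\<rho> (\<phi> x) = x" using G_inv[OF \<phi>(1)] x by blast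
  then have xy: "x \<in> orb y" using \<phi> by (auto simp: galois_orbit_def intro: image_eqI[of _ _ \<rho>])
  have yc: "y \<in> carrier L" using y orb_closed[OF x] by blast
  show "orb x \<subseteq> orb y"
  proof
    fix z assume "z \<in> orb x"
    then obtain \<tau> where \<tau>: "\<tau> \<in> G" "z = \<tau> x" by (auto simp: galois_orbit_def)
    then show "z \<in> orb y" using orb_image[OF yc \<tau>(1)] xy by blast
  qed
qed

text \<open>An equivariant map between orbits has fibres of constant size.\<close>

lemma orb_average:
  fixes g :: "'a \<Rightarrow> real"
  assumes x: "x \<in> carrier L" and A: "\<And>z. z \<in> carrier L \<Longrightarrow> A z \<in> carrier L"
    and equiv: "\<And>\<phi> z. \<lbrakk>\<phi> \<in> G; z \<in> carrier L\<rbrakk> \<Longrightarrow> A (\<phi> z) = \<phi> (A z)"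
  shows "(\<Sum>y\<in>orb (A x). g y) / real (card (orb (A x))) = (\<Sum>z\<in>orb x. g (A z)) / real (card (orb x))"
proof -
  have img: "A ` orb x = orb (A x)"
    using equiv x by (force simp: galois_orbit_def image_image)
  define fib where "fib y = {z \<in> orb x. A z = y}" for y
  have fin: "finite (orb x)" "finite (orb (A x))" using orb_finite x A by auto
  have le: "card (fib y) \<le> card (fib (\<phi> y))" if "\<phi> \<in> G" for \<phi> y
  proof (rule card_inj_on_le[of \<phi>])
    show "inj_on \<phi> (fib y)"
      using GD(4)[OF that] orb_closed[OF x] by (auto simp: bij_betw_def fib_def intro: inj_on_subset)
    show "\<phi> ` fib y \<subseteq> fib (\<phi> y)"
      using orb_image[OF x that] orb_closed[OF x] equiv[OF that] by (auto simp: fib_def)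
    show "finite (fib (\<phi> y))" using fin by (simp add: fib_def)
  qed
  \<comment> \<open>\<open>le\<close> for an automorphism and for its inverse gives
    equality.\<close>
  have const: "card (fib y) = card (fib (A x))" if y: "y \<in> orb (A x)" for y
  proof -
    obtain \<phi> where \<phi>: "\<phi> \<in> G" "y = \<phi> (A x)" using y by (auto simp: galois_orbit_def)
    obtain \<tau> where "\<tau> \<in> G" "\<tau> y = A x" using G_inv[OF \<phi>(1)] A[OF x] \<phi>(2) by blast
    then show ?thesis using le[OF \<phi>(1), of "A x"] le[of \<tau> y] \<phi>(2) by auto
  qed
  define c where "c = card (fib (A x))"
  have group: "(\<Sum>z\<in>orb x. f (A z)) = real c * (\<Sum>y\<in>orb (A x). f y)" for f :: "'a \<Rightarrow> real"
  proof -
    have "(\<Sum>z\<in>orb x. f (A z)) = (\<Sum>y\<in>A ` orb x. \<Sum>z\<in>{z \<in> orb x. A z = y}. f (A z))"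
      using fin by (intro sum.image_gen) auto
    also have "\<dots> = (\<Sum>y\<in>orb (A x). real c * f y)"
      unfolding img
    proof (intro sum.cong refl)
      fix y assume "y \<in> orb (A x)"
      then have "card {z \<in> orb x. A z = y} = c" using const by (simp add: fib_def c_def)
      then show "(\<Sum>z\<in>{z \<in> orb x. A z = y}. f (A z)) = real c * f y" by simp
    qed
    finally show ?thesis by (simp add: sum_distrib_left)
  qed
  have "x \<in> fib (A x)" using orb_self by (simp add: fib_def)
  then have "c > 0" using fin by (auto simp: c_def fib_def card_gt_0_iff)
  moreover have "real (card (orb x)) = real c * real (card (orb (A x)))"
    using group[of "\<lambda>_. 1"] by simp
  ultimately show ?thesis using group[of g] by simp
qed

end


section \<open>Galois orbits over a perfect field\<close>

lemma (in domain) finprod_nonzero: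
  assumes "finite A" "\<And>i. i \<in> A \<Longrightarrow> f i \<in> carrier R \<and> f i \<noteq> \<zero>"
  shows "finprod R f A \<noteq> \<zero>"
  using assms
proof (induction A rule: finite_induct)
  case (insert i A)
  have "finprod R f A \<in> carrier R" using insert by (intro finprod_closed) auto
  moreover have "finprod R f (insert i A) = f i \<otimes> finprod R f A"
    using insert by (intro finprod_insert) auto
  ultimately show ?case using insert by (simp add: integral_iff)
qed simp

lemma (in ultrametric_field) abs_finprod:
  assumes "finite A" "\<And>i. i \<in> A \<Longrightarrow> f i \<in> carrier R"
  shows "\<nu> (finprod R f A) = (\<Prod>i\<in>A. \<nu> (f i))"
  using assms
proof (induction A rule: finite_induct)
  case (insert i A)
  have "finprod R f A \<in> carrier R" using insert by (intro finprod_closed) auto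
  moreover have "finprod R f (insert i A) = f i \<otimes> finprod R f A"
    using insert by (intro finprod_insert) auto
  ultimately show ?case using insert by (simp add: abs_mult)
qed (simp add: abs_one)

lemma (in field) monic_finprod:
  assumes "finite S" "S \<subseteq> carrier R"
  shows "monic (finprod (poly_ring R) (\<lambda>y. [\<one>, \<ominus> y]) S)"
    and "degree (finprod (poly_ring R) (\<lambda>y. [\<one>, \<ominus> y]) S) = card S"
proof -
  interpret P: domain "poly_ring R" using univ_poly_is_domain[OF carrier_is_subring] .
  have "monic (finprod (poly_ring R) (\<lambda>y. [\<one>, \<ominus> y]) S) \<and>
      degree (finprod (poly_ring R) (\<lambda>y. [\<one>, \<ominus> y]) S) = card S"
    using assms
  proof (induction S rule: finite_induct)
    case empty
    then show ?case using monic_one by (simp add: univ_poly_one)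
  next
    case (insert y S)
    have lin: "monic [\<one>, \<ominus> z]" if "z \<in> carrier R" for z using monic_linear that by simp
    have y: "monic [\<one>, \<ominus> y]" using lin insert by auto
    have "finprod (poly_ring R) (\<lambda>y. [\<one>, \<ominus> y]) (insert y S)
        = [\<one>, \<ominus> y] \<otimes>\<^bsub>poly_ring R\<^esub> finprod (poly_ring R) (\<lambda>y. [\<one>, \<ominus> y]) S"
      using insert monicD(1)[OF lin] by (intro P.finprod_insert) auto
    then show ?case using monic_mult[OF y, of "finprod (poly_ring R) (\<lambda>y. [\<one>, \<ominus> y]) S"] insert by simp
  qed
  then show "monic (finprod (poly_ring R) (\<lambda>y. [\<one>, \<ominus> y]) S)"
    "degree (finprod (poly_ring R) (\<lambda>y. [\<one>, \<ominus> y]) S) = card S" by auto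
qed

context algebraic_closure
begin

lemma K_pow: "a \<in> K \<Longrightarrow> a [^] (n::nat) \<in> K"
  by (induction n) (simp_all add: K_closed(3,6))

lemma G_map_hom:
  assumes \<phi>: "\<phi> \<in> G"
  shows "map \<phi> \<in> ring_hom (poly_ring L) (poly_ring L)"
proof (rule ring_hom_memI)
  interpret S: ring_hom_ring L L \<phi> using G_hom_ring[OF \<phi>] .
  interpret P: domain "poly_ring L" using univ_poly_is_domain[OF carrier_is_subring] .
  have cl: "map \<phi> q \<in> carrier (poly_ring L)" if "q \<in> carrier (poly_ring L)" for q
    using polynomial_hom[OF GD(2)[OF \<phi>] field_axioms field_axioms that] .
  have norm: "normalize (map \<phi> q) = map \<phi> q" if "q \<in> carrier (poly_ring L)" for q
    using normalize_polynomial cl[OF that] by (simp add: univ_poly_carrier)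
  have sub: "set q \<subseteq> carrier L" if "q \<in> carrier (poly_ring L)" for q
    using that by (auto simp: poly_carrier_iff)
  fix q r assume q: "q \<in> carrier (poly_ring L)"
  show "map \<phi> q \<in> carrier (poly_ring L)" using cl q .
  assume r: "r \<in> carrier (poly_ring L)"
  show "map \<phi> (q \<otimes>\<^bsub>poly_ring L\<^esub> r) = map \<phi> q \<otimes>\<^bsub>poly_ring L\<^esub> map \<phi> r"
    using S.poly_mult_hom'[OF sub[OF q] sub[OF r]] norm[OF P.m_closed[OF q r]] by (simp add: univ_poly_mult)
  show "map \<phi> (q \<oplus>\<^bsub>poly_ring L\<^esub> r) = map \<phi> q \<oplus>\<^bsub>poly_ring L\<^esub> map \<phi> r"
    using S.poly_add_hom'[OF sub[OF q] sub[OF r]] norm[OF P.a_closed[OF q r]] by (simp add: univ_poly_add)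
next
  interpret S: ring_hom_ring L L \<phi> using G_hom_ring[OF \<phi>] .
  show "map \<phi> \<one>\<^bsub>poly_ring L\<^esub> = \<one>\<^bsub>poly_ring L\<^esub>" by (simp add: univ_poly_one)
qed

lemma generate_field_insert:
  assumes x: "x \<in> carrier L"
  shows "generate_field L (insert x K) = simple_extension K x"
proof (rule generate_fieldI[symmetric])
  have sK: "subring K L" using subfieldE(1)[OF subfield_axioms] .
  show "insert x K \<subseteq> carrier L" using x K_closed(1) by simp
  show "subfield (simple_extension K x) L"
    using simple_extension_is_subfield[OF subfield_axioms x] algebraic_extension[OF x] by simp
  show "insert x K \<subseteq> simple_extension K x"
    using simple_extension_mem[OF sK x] simple_extension_incl[OF K_closed(1) x] by simp
  show "simple_extension K x \<subseteq> K'" if "subfield K' L" "insert x K \<subseteq> K'" for K'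
    using simple_extension_subring_incl[OF subfieldE(1)[OF that(1)]] that(2) by simp
qed

lemma dim_generate_field:
  assumes x: "x \<in> carrier L"
  shows "dim K (generate_field L (insert x K)) = degree (Irr K x)"
  using simple_extension_dim[OF subfield_axioms x algebraic_extension[OF x]] generate_field_insert[OF x]
  by (simp add: over_def)

lemma Irr_degree_le:
  assumes x: "x \<in> carrier L" and q: "q \<in> carrier (K[X])" "q \<noteq> []" "eval q x = \<zero>"
  shows "degree (Irr K x) \<le> degree q"
  using pdivides_imp_degree_le[OF subfieldE(1)[OF subfield_axioms] Irr_props(1)[OF x] q(1,2)]
    Irr_minimal[OF subfield_axioms x algebraic_extension[OF x] q(1,3)] by simp

end

locale perfect_closure = algebraic_closure L K + prime_char_field L p
  for L (structure) and K p +
  assumes perfect_K: "perfect K"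
begin

text \<open>The list is the polynomial \<open>1 + X + ... + X ^ (n - 1)\<close>. Its roots are
  \<open>n\<close>-th roots of unity, and its value \<open>n\<close> at 1 is nonzero when
  \<open>p\<close> does not divide \<open>n\<close>.\<close>

lemma eval_replicate_one:
  assumes z: "z \<in> carrier L"
  shows "eval (replicate n \<one>) z \<in> carrier L"
    and "eval (replicate n \<one>) z \<otimes> (z \<ominus> \<one>) = z [^] n \<ominus> \<one>"
    and "eval (replicate n \<one>) \<one> = [n] \<cdot> \<one>"
proof -
  have cl: "eval (replicate n \<one>) z \<in> carrier L" for n
    using z by (intro eval_in_carrier) auto
  then show "eval (replicate n \<one>) z \<in> carrier L" .
  have one: "\<one> \<in> carrier L" by simp
  have step: "eval (replicate (Suc n) \<one>) w = w [^] n \<oplus> eval (replicate n \<one>) w" if "w \<in> carrier L" for n w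
    using that by simp
  show "eval (replicate n \<one>) z \<otimes> (z \<ominus> \<one>) = z [^] n \<ominus> \<one>"
  proof (induction n)
    case 0
    then show ?case using z by (simp add: minus_eq r_neg)
  next
    case (Suc n)
    have zn: "z [^] n \<in> carrier L" using z by simp
    have "eval (replicate (Suc n) \<one>) z \<otimes> (z \<ominus> \<one>)
        = z [^] n \<otimes> (z \<ominus> \<one>) \<oplus> eval (replicate n \<one>) z \<otimes> (z \<ominus> \<one>)"
      unfolding step[OF z]
      using z zn cl[of n] by (intro l_distr) auto
    also have "\<dots> = z [^] n \<otimes> (z \<ominus> \<one>) \<oplus> (z [^] n \<ominus> \<one>)" using Suc by simp
    also have "\<dots> = z [^] n \<otimes> z \<ominus> \<one>" using z zn by algebra
    finally show ?case by simp
  qed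
  show "eval (replicate n \<one>) \<one> = [n] \<cdot> \<one>"
  proof (induction n)
    case (Suc n)
    then show ?case unfolding step[OF one]
      by (simp add: a_comm)
  qed simp
qed

lemma nontrivial_root_of_unity:
  assumes n: "n \<ge> 2" "\<not> p dvd n"
  shows "\<exists>\<zeta>\<in>carrier L. \<zeta> [^] n = \<one> \<and> \<zeta> \<noteq> \<one>"
proof -
  let ?q = "replicate n \<one>"
  have "?q \<in> carrier (poly_ring L)"
    using n one_not_zero by (simp add: poly_carrier_iff set_replicate_conv_if)
  then obtain \<zeta> where \<zeta>: "\<zeta> \<in> carrier L" "eval ?q \<zeta> = \<zero>"
    using exists_root_of_poly[of ?q] n by auto
  have "\<zeta> [^] n \<ominus> \<one> = \<zero>" using eval_replicate_one(2)[OF \<zeta>(1), of n] \<zeta> by simp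
  then have "\<zeta> [^] n = \<one>" using \<zeta>(1) by simp
  moreover have "\<zeta> \<noteq> \<one>" using eval_replicate_one(3)[of \<one> n] \<zeta>(2) add_pow_ne_0[OF n(2)] by auto
  ultimately show ?thesis using \<zeta>(1) by blast
qed

text \<open>If \<open>x\<close> is the only root of its minimal polynomial, of degree \<open>n\<close>, then \<open>x ^ n \<in> K\<close>.
  When \<open>p\<close> divides \<open>n\<close>, perfectness gives \<open>x ^ (n div p) \<in> K\<close> and a smaller degree; otherwise
  \<open>X ^ n - x ^ n\<close> is the minimal polynomial and has another root unless \<open>n = 1\<close>.\<close>

lemma fixed_imp_mem:
  assumes x: "x \<in> carrier L" and fixed: "\<And>\<phi>. \<phi> \<in> G \<Longrightarrow> \<phi> x = x"
  shows "x \<in> K"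
proof (rule ccontr)
  assume xK: "x \<notin> K"
  define P where "P = Irr K x"
  define n where "n = degree P"
  note P = Irr_props[OF x, folded P_def]
  have orbx: "orb x = {x}" using fixed orb_self[of x] by (auto simp: galois_orbit_def)
  have root: "y = x" if "y \<in> carrier L" "eval P y = \<zero>" for y
    using orb_eq[OF x] that unfolding orbx P_def by auto
  obtain as where as: "length as = n" "set as \<subseteq> carrier L"
    "\<And>z. z \<in> carrier L \<Longrightarrow> eval P z = foldr (\<lambda>a y. (z \<ominus> a) \<otimes> y) as \<one>"
    using monic_splits[OF P(9)] by (auto simp: n_def)
  have "a = x" if a: "a \<in> set as" for a
    using root[of a] as(2,3) foldr_linear_eq_zero[OF a as(2)] a by auto
  then have rep: "as = replicate n x" using as(1) by (intro replicate_eqI) auto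
  \<comment> \<open>The polynomial \<open>P\<close> is the \<open>n\<close>-th power of
    \<open>X - x\<close>, which determines its constant term; the sign is removed afterwards by a
    power of \<open>\<ominus> \<one>\<close>.\<close>
  have "foldr (\<lambda>a y. (\<zero> \<ominus> a) \<otimes> y) (replicate n x) \<one> = (\<ominus> x) [^] n" for n
    using x by (induction n) (simp_all add: minus_eq m_comm)
  then have "const_term P = (\<ominus> x) [^] n" using as(3)[of \<zero>] rep by (simp add: const_term_def)
  then have neg: "(\<ominus> x) [^] n \<in> K"
    using const_term_simprules_shell(1)[OF subfieldE(1)[OF subfield_axioms] P(1)] by simp
  have "(\<ominus> \<one>) [^] n \<otimes> (\<ominus> x) [^] n = (\<ominus> \<one> \<otimes> \<ominus> x) [^] n"
    using x by (intro nat_pow_distrib[symmetric]) auto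
  also have "\<ominus> \<one> \<otimes> \<ominus> x = x" using x by (simp add: l_minus)
  finally have xn: "x [^] n \<in> K"
    using K_closed(6)[OF K_pow[OF K_closed(4)[OF K_closed(3)]] neg, of n] by simp
  have n1: "n \<ge> 1" using P(6) by (simp add: n_def)
  show False
  proof (cases "p dvd n")
    case True
    then obtain j where j: "n = p * j" by blast
    then have j0: "0 < j" "j < n" using n1 p_gt_1 by auto
    obtain y where y: "y \<in> K" "y [^] p = x [^] n" using perfect_K xn by (auto simp: perfect_def)
    have "(x [^] j) [^] p = x [^] n" using x j by (simp add: nat_pow_pow mult.commute)
    then have "x [^] j = y" using frobenius_inj[of "x [^] j" y] y x K_closed(1) by auto
    then have "x [^] j \<in> K" using y(1) by simp
    then obtain q where q: "q \<in> carrier (K[X])" "length q = Suc j" "eval q x = x [^] j \<ominus> x [^] j"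
      using binomial_polynomial[OF subfield_axioms _ j0(1)] x by metis
    then have "q \<noteq> []" "eval q x = \<zero>" using x by (auto simp: minus_eq r_neg)
    then show False using Irr_degree_le[OF x q(1)] q(2) j0 by (simp add: n_def P_def)
  next
    case False
    have "n \<noteq> 1" using xn xK x by auto
    then have n2: "n \<ge> 2" using n1 by simp
    obtain \<zeta> where \<zeta>: "\<zeta> \<in> carrier L" "\<zeta> [^] n = \<one>" "\<zeta> \<noteq> \<one>"
      using nontrivial_root_of_unity[OF n2 False] by blast
    obtain q where q: "q \<in> carrier (K[X])" "length q = Suc n"
      "\<And>y. y \<in> carrier L \<Longrightarrow> eval q y = y [^] n \<ominus> x [^] n"
      using binomial_polynomial[OF subfield_axioms xn, of n] n1 by auto
    have q0: "q \<noteq> []" using q(2) by auto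
    \<comment> \<open>Both polynomials have degree \<open>n\<close>, so the cofactor is a nonzero
      constant and every root of \<open>q\<close> is a root of \<open>P\<close>, that is, equal to
      \<open>x\<close>.\<close>
    have "P pdivides q"
      using Irr_minimal[OF subfield_axioms x algebraic_extension[OF x] q(1)] q(3)[OF x] x
      by (simp add: P_def minus_eq r_neg)
    then obtain r where r: "r \<in> carrier (poly_ring L)" "q = P \<otimes>\<^bsub>poly_ring L\<^esub> r"
      by (auto simp: pdivides_def factor_def)
    interpret PL: domain "poly_ring L" using univ_poly_is_domain[OF carrier_is_subring] .
    have r0: "r \<noteq> []" using r q0 PL.r_null[OF P(5)] by (auto simp: univ_poly_zero)
    have "degree q = degree P + degree r"
      using poly_mult_degree_eq[OF carrier_is_subring, of P r] P(5,7) r r0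
      by (simp add: univ_poly_mult univ_poly_carrier)
    then have "degree r = 0" using q(2) by (simp add: n_def)
    then obtain c where c: "r = [c]" using r0 by (cases r) auto
    then have c': "c \<in> carrier L" "c \<noteq> \<zero>" using r(1) by (auto simp: poly_carrier_iff)
    have "\<zeta> \<otimes> x \<in> carrier L" using \<zeta> x by simp
    have "eval q (\<zeta> \<otimes> x) = \<zero>"
      using q(3)[of "\<zeta> \<otimes> x"] \<zeta> x by (simp add: nat_pow_distrib minus_eq r_neg)
    then have "eval P (\<zeta> \<otimes> x) \<otimes> c = \<zero>"
      using eval_mult(1)[OF P(5) r(1) \<open>\<zeta> \<otimes> x \<in> carrier L\<close>] r(2) c c' by simp
    then have "eval P (\<zeta> \<otimes> x) = \<zero>"
      using integral[of "eval P (\<zeta> \<otimes> x)" c] c' eval_closed[OF P(5) \<open>\<zeta> \<otimes> x \<in> carrier L\<close>] by auto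
    then have "\<zeta> \<otimes> x = x" by (rule root[OF \<open>\<zeta> \<otimes> x \<in> carrier L\<close>])
    then have "\<zeta> \<otimes> x = \<one> \<otimes> x" using x by simp
    moreover have "x \<noteq> \<zero>" using xK K_closed(2) by auto
    ultimately show False using m_rcancel[of x \<zeta> \<one>] \<zeta> x by simp
  qed
qed

text \<open>The orbit consists of roots, which gives one inequality. For the other, the product of
  all \<open>X - y\<close> over the orbit is invariant under \<open>G\<close>, so it has
  coefficients in \<open>K\<close> by \<open>fixed_imp_mem\<close>, and it vanishes at
  \<open>x\<close>. This lets the normalisation of the Weil height by the field degree be read as an
  average over the orbit.\<close>

lemma card_orb:
  assumes x: "x \<in> carrier L"
  shows "card (orb x) = degree (Irr K x)"
proof (rule antisym)
  note P = Irr_props[OF x]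
  have "orb x = set_mset (roots (Irr K x))"
    using orb_eq[OF x] roots_mem_iff_is_root[OF P(5)] P(7) by (auto simp: is_root_def)
  moreover have "card (set_mset M) \<le> size M" for M :: "'a multiset"
    by (induction M) (auto simp: card_insert_if)
  ultimately have "card (orb x) \<le> size (roots (Irr K x))" by simp
  then show "card (orb x) \<le> degree (Irr K x)" using size_roots_le_degree[OF P(5)] by simp
  let ?P = "poly_ring L"
  interpret PL: domain ?P using univ_poly_is_domain[OF carrier_is_subring] .
  define g where "g = finprod ?P (\<lambda>y. [\<one>, \<ominus> y]) (orb x)"
  note oc = orb_closed[OF x] and ofin = orb_finite[OF x]
  have lin: "[\<one>, \<ominus> y] \<in> carrier ?P" if "y \<in> carrier L" for y
    using monicD(1)[OF monic_linear] that by simp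
  have g: "monic g" "degree g = card (orb x)"
    unfolding g_def using monic_finprod[OF ofin oc] by auto
  have "map \<phi> g = g" if \<phi>: "\<phi> \<in> G" for \<phi>
  proof -
    interpret S: ring_hom_ring L L \<phi> using G_hom_ring[OF \<phi>] .
    interpret M: ring_hom_cring ?P ?P "map \<phi>"
      by (intro ring_hom_cring.intro ring_hom_cring_axioms.intro PL.is_cring G_map_hom[OF \<phi>])
    have "map \<phi> g = finprod ?P (map \<phi> \<circ> (\<lambda>y. [\<one>, \<ominus> y])) (orb x)"
      unfolding g_def using oc lin by (intro M.hom_finprod) auto
    also have "\<dots> = finprod ?P (\<lambda>y. [\<one>, \<ominus> (\<phi> y)]) (orb x)"
      using oc lin S.hom_closed by (intro PL.finprod_cong') auto
    also have "\<dots> = finprod ?P (\<lambda>y. [\<one>, \<ominus> y]) (\<phi> ` orb x)"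
    proof (intro PL.finprod_reindex[symmetric])
      show "(\<lambda>y. [\<one>, \<ominus> y]) \<in> \<phi> ` orb x \<rightarrow> carrier ?P" using lin oc S.hom_closed by auto
      show "inj_on \<phi> (orb x)"
        using GD(4)[OF \<phi>] oc by (auto simp: bij_betw_def intro: inj_on_subset)
    qed
    finally show ?thesis using orb_image[OF x \<phi>] by (simp add: g_def)
  qed
  then have "\<phi> a = a" if "\<phi> \<in> G" "a \<in> set g" for \<phi> a
    using that by (metis list.map_id map_eq_conv id_apply)
  moreover have "set g \<subseteq> carrier L" using monicD(1,2)[OF g(1)] by (auto simp: poly_carrier_iff)
  ultimately have gK: "set g \<subseteq> K" using fixed_imp_mem by blast
  then have "g \<in> carrier (K[X])"
    using monicD(2,3)[OF g(1)] one_not_zero by (simp add: univ_poly_carrier[symmetric] polynomial_def)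
  moreover have "eval g x = \<zero>"
  proof -
    have fc: "finprod ?P (\<lambda>y. [\<one>, \<ominus> y]) (orb x - {x}) \<in> carrier ?P"
      using lin oc by (intro PL.finprod_closed) auto
    have "g = [\<one>, \<ominus> x] \<otimes>\<^bsub>?P\<^esub> finprod ?P (\<lambda>y. [\<one>, \<ominus> y]) (orb x - {x})"
      unfolding g_def using PL.finprod_insert[of "orb x - {x}" x "\<lambda>y. [\<one>, \<ominus> y]"] ofin oc lin orb_self[of x] x
      by (auto simp: insert_absorb)
    then show ?thesis
      using eval_mult(1)[OF lin[OF x] fc x] x eval_closed[OF fc x] by (simp add: r_neg)
  qed
  ultimately show "degree (Irr K x) \<le> card (orb x)"
    using Irr_degree_le[OF x _ monicD(2)[OF g(1)]] g(2) by simp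
qed

section \<open>Discriminants of Galois-stable sets\<close>

definition off_diagonal :: "'a set \<Rightarrow> ('a \<times> 'a) set" where
  "off_diagonal F = (SIGMA x:F. F - {x})"

text \<open>The product runs over ordered pairs, so it is invariant under permutations without a
  sign, and its logarithmic absolute value is the off-diagonal double sum in the energy of
  \<open>F\<close>.\<close>

definition discriminant :: "'a set \<Rightarrow> 'a" where
  "discriminant F = finprod L (\<lambda>xy. fst xy \<ominus> snd xy) (off_diagonal F)"

lemma off_diagonal_diff:
  assumes "F \<subseteq> carrier L" "xy \<in> off_diagonal F"
  shows "fst xy \<ominus> snd xy \<in> carrier L" "fst xy \<ominus> snd xy \<noteq> \<zero>"
proof -
  obtain x y where xy: "xy = (x, y)" "x \<in> carrier L" "y \<in> carrier L" "x \<noteq> y"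
    using assms by (auto simp: off_diagonal_def)
  then show "fst xy \<ominus> snd xy \<in> carrier L" "fst xy \<ominus> snd xy \<noteq> \<zero>" by simp_all
qed

lemma discriminant_mem:
  assumes F: "finite F" "F \<subseteq> carrier L" and inv: "\<And>\<phi>. \<phi> \<in> G \<Longrightarrow> \<phi> ` F = F"
  shows "discriminant F \<in> K" "discriminant F \<noteq> \<zero>"
proof -
  let ?I = "off_diagonal F" and ?f = "\<lambda>xy. fst xy \<ominus> snd xy"
  have fin: "finite ?I" using F by (simp add: off_diagonal_def)
  have cl: "?f \<in> ?I \<rightarrow> carrier L"
    using F(2) by (auto simp: off_diagonal_def intro!: minus_closed)
  show "discriminant F \<noteq> \<zero>"
    unfolding discriminant_def by (intro finprod_nonzero fin) (simp add: off_diagonal_diff[OF F(2)])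
  have "discriminant F \<in> carrier L" unfolding discriminant_def using cl by (intro finprod_closed)
  moreover have "\<phi> (discriminant F) = discriminant F" if \<phi>: "\<phi> \<in> G" for \<phi>
  proof -
    interpret S: ring_hom_ring L L \<phi> using G_hom_ring[OF \<phi>] .
    interpret M: ring_hom_cring L L \<phi>
      by (intro ring_hom_cring.intro ring_hom_cring_axioms.intro is_cring GD(2)[OF \<phi>])
    have inj: "inj_on \<phi> F" using GD(4)[OF \<phi>] F(2) by (auto simp: bij_betw_def intro: inj_on_subset)
    have sub: "map_prod \<phi> \<phi> ` ?I \<subseteq> ?I"
      using inv[OF \<phi>] inj by (auto simp: off_diagonal_def inj_on_def)
    have injI: "inj_on (map_prod \<phi> \<phi>) ?I"
      using inj by (auto simp: off_diagonal_def inj_on_def)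
    have img: "map_prod \<phi> \<phi> ` ?I = ?I" using endo_inj_surj[OF fin sub injI] .
    have "\<phi> (discriminant F) = finprod L (\<phi> \<circ> ?f) ?I"
      unfolding discriminant_def using cl by (intro M.hom_finprod)
    also have "\<dots> = finprod L (\<lambda>xy. ?f (map_prod \<phi> \<phi> xy)) ?I"
    proof (intro finprod_cong' refl)
      fix xy assume "xy \<in> ?I"
      then have xy: "fst xy \<in> carrier L" "snd xy \<in> carrier L" using F(2) by (auto simp: off_diagonal_def)
      then show "(\<phi> \<circ> ?f) xy = ?f (map_prod \<phi> \<phi> xy)" by (simp add: minus_eq)
    next
      show "(\<lambda>xy. ?f (map_prod \<phi> \<phi> xy)) \<in> ?I \<rightarrow> carrier L"
      proof
        fix xy assume "xy \<in> ?I"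
        then have "fst xy \<in> carrier L" "snd xy \<in> carrier L" using F(2) by (auto simp: off_diagonal_def)
        then show "?f (map_prod \<phi> \<phi> xy) \<in> carrier L" by simp
      qed
    qed
    also have "\<dots> = finprod L ?f (map_prod \<phi> \<phi> ` ?I)"
      using cl sub injI by (intro finprod_reindex[symmetric]) auto
    finally show ?thesis by (simp add: img discriminant_def)
  qed
  ultimately show "discriminant F \<in> K" by (rule fixed_imp_mem)
qed

lemma abs_discriminant:
  assumes "ultrametric_field L \<nu>" and F: "finite F" "F \<subseteq> carrier L"
  shows "ln (\<nu> (discriminant F)) = (\<Sum>x\<in>F. \<Sum>y\<in>F - {x}. ln (\<nu> (x \<ominus> y)))"
proof -
  interpret V: ultrametric_field L \<nu> using assms(1) .
  have fin: "finite (off_diagonal F)" using F by (simp add: off_diagonal_def)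
  have "\<nu> (discriminant F) = (\<Prod>xy\<in>off_diagonal F. \<nu> (fst xy \<ominus> snd xy))"
    unfolding discriminant_def using fin F(2) by (intro V.abs_finprod) (auto simp: off_diagonal_def intro!: minus_closed)
  also have "ln \<dots> = (\<Sum>xy\<in>off_diagonal F. ln (\<nu> (fst xy \<ominus> snd xy)))"
    by (intro ln_prod) (simp_all add: fin V.abs_eq_0 off_diagonal_diff[OF F(2)])
  also have "\<dots> = (\<Sum>x\<in>F. \<Sum>y\<in>F - {x}. ln (\<nu> (x \<ominus> y)))"
    unfolding off_diagonal_def using F(1) by (subst sum.Sigma) (auto simp: split_beta)
  finally show ?thesis .
qed

end


section \<open>Global heights and equidistribution\<close>

text \<open>The place data after pulling back to the closure: ultrametric absolute values that
  satisfy the product formula on \<open>K\<close> and are nontrivial on the closure.\<close>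

locale global_heights = perfect_closure L K p for L (structure) and K p +
  fixes \<Omega> :: "'v set" and nrm :: "'v \<Rightarrow> 'a \<Rightarrow> real" and d :: nat
  assumes ultrametric_place: "v \<in> \<Omega> \<Longrightarrow> ultrametric_field L (nrm v)"
    and finite_support: "\<lbrakk>x \<in> K; x \<noteq> \<zero>\<rbrakk> \<Longrightarrow> finite {v \<in> \<Omega>. nrm v x \<noteq> 1}"
    and product_formula: "\<lbrakk>x \<in> K; x \<noteq> \<zero>\<rbrakk> \<Longrightarrow> (\<Prod>v\<in>{v \<in> \<Omega>. nrm v x \<noteq> 1}. nrm v x) = 1"
    and nontrivial_place: "v \<in> \<Omega> \<Longrightarrow> \<exists>x\<in>carrier L. 1 < nrm v x"
    and degree_ge_2: "d \<ge> 2"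
begin

lemma unicritical_place: "v \<in> \<Omega> \<Longrightarrow> unicritical L (nrm v) d"
  using ultrametric_place degree_ge_2 by (simp add: unicritical_def unicritical_axioms_def)

abbreviation lh :: "'v \<Rightarrow> 'a \<Rightarrow> 'a \<Rightarrow> real" where
  "lh v x z \<equiv> local_height L (nrm v) d z x"

abbreviation orbit_point :: "'a \<Rightarrow> 'a \<Rightarrow> nat \<Rightarrow> 'a" where
  "orbit_point x z n \<equiv> (unicrit L d z ^^ n) x"

section \<open>Heights as finite sums over places\<close>

lemma K_mem_carrier: "x \<in> K \<Longrightarrow> x \<in> carrier L"
  using K_closed(1) by blast

text \<open>Otherwise the leading term of the minimal polynomial would strictly dominate the other
  terms at \<open>y\<close>, and their sum could not be 0.\<close>

lemma abs_root_le_1: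
  assumes v: "v \<in> \<Omega>" and y: "y \<in> carrier L" and le: "\<And>c. c \<in> set (Irr K y) \<Longrightarrow> nrm v c \<le> 1"
  shows "nrm v y \<le> 1"
proof (rule ccontr)
  interpret V: ultrametric_field L "nrm v" using ultrametric_place[OF v] .
  note P = Irr_props[OF y]
  assume "\<not> nrm v y \<le> 1"
  then have gt: "1 < nrm v y" by simp
  have bound: "nrm v (eval cs y) \<le> nrm v y ^ (length cs - 1)"
    if "set cs \<subseteq> carrier L" "\<And>c. c \<in> set cs \<Longrightarrow> nrm v c \<le> 1" for cs
    using that
  proof (induction cs)
    \<comment> \<open>The exponent is a truncated difference: for the empty list the bound is 1 and
      the value is 0.\<close>
    case Nil
    then show ?case using V.abs_eq_0[of \<zero>] by simp
  next
    case (Cons c cs)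
    have cl: "c \<in> carrier L" "eval cs y \<in> carrier L" using Cons y by (auto intro: eval_in_carrier)
    have "nrm v (c \<otimes> y [^] length cs) \<le> 1 * nrm v y ^ length cs"
      unfolding V.abs_mult[OF cl(1) nat_pow_closed[OF y]] V.abs_pow[OF y]
      using Cons(3)[of c] gt by (intro mult_right_mono) auto
    moreover have "nrm v (eval cs y) \<le> nrm v y ^ (length cs - 1)"
      using Cons by simp
    moreover have "nrm v y ^ (length cs - 1) \<le> nrm v y ^ length cs"
      using gt by (intro power_increasing) auto
    ultimately show ?case
      using V.abs_add[of "c \<otimes> y [^] length cs" "eval cs y"] cl y by simp
  qed
  obtain cs where cs: "Irr K y = \<one> # cs" using P(3,7) by (cases "Irr K y") auto
  have sub: "set cs \<subseteq> carrier L" using P(8) cs K_closed(1) by auto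
  have "cs \<noteq> []" using P(6) cs by auto
  have "nrm v (eval cs y) \<le> nrm v y ^ (length cs - 1)"
    using bound[OF sub] le cs by simp
  also have "\<dots> < nrm v y ^ length cs"
    using gt \<open>cs \<noteq> []\<close> by (intro power_strict_increasing) auto
  finally have "nrm v (y [^] length cs \<oplus> eval cs y) = nrm v y ^ length cs"
    using V.abs_add_dominant[of "y [^] length cs" "eval cs y"] sub y eval_in_carrier[OF sub y] V.abs_pow[OF y] by simp
  moreover have "y [^] length cs \<oplus> eval cs y = \<zero>" using P(4) cs y by simp
  ultimately show False using V.abs_eq_0[of \<zero>] gt by simp
qed

lemma finite_large_K: "c \<in> K \<Longrightarrow> finite {v \<in> \<Omega>. 1 < nrm v c}"
proof (cases "c = \<zero>")
  case True
  then have "{v \<in> \<Omega>. 1 < nrm v c} = {}"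
    using ultrametric_field.abs_eq_0[OF ultrametric_place, of _ \<zero>] by auto
  then show ?thesis by (simp only: finite.emptyI)
next
  assume "c \<in> K"
  case False
  from finite_support[OF \<open>c \<in> K\<close> False] show ?thesis by (rule rev_finite_subset) auto
qed

lemma finite_large:
  assumes y: "y \<in> carrier L"
  shows "finite {v \<in> \<Omega>. 1 < nrm v y}"
proof (rule finite_subset)
  show "{v \<in> \<Omega>. 1 < nrm v y} \<subseteq> (\<Union>c\<in>set (Irr K y). {v \<in> \<Omega>. 1 < nrm v c})"
    using abs_root_le_1[OF _ y] by force
  show "finite (\<Union>c\<in>set (Irr K y). {v \<in> \<Omega>. 1 < nrm v c})"
    using finite_large_K Irr_props(8)[OF y] by blast
qed

lemma weil_height_eq:
  assumes x: "x \<in> carrier L" and S: "finite S" "S \<subseteq> \<Omega>"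
    and small: "\<And>v y. \<lbrakk>v \<in> \<Omega> - S; y \<in> orb x\<rbrakk> \<Longrightarrow> nrm v y \<le> 1"
  shows "weil_height L K \<Omega> nrm x = (\<Sum>v\<in>S. \<Sum>y\<in>orb x. log_plus (nrm v y)) / real (card (orb x))"
proof -
  have "(\<Sum>\<^sub>\<infinity>v\<in>\<Omega>. \<Sum>y\<in>orb x. log_plus (nrm v y)) = (\<Sum>\<^sub>\<infinity>v\<in>S. \<Sum>y\<in>orb x. log_plus (nrm v y))"
    using S small by (intro infsum_cong_neutral) (auto simp: log_plus_def max.absorb2 intro!: sum.neutral)
  then show ?thesis
    unfolding weil_height_def dim_generate_field[OF x] card_orb[OF x, symmetric] using S by simp
qed

lemma iterate_Suc: "orbit_point x z (Suc n) = orbit_point x z n [^] d \<oplus> z"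
  by (simp add: unicrit_def[of L d z "orbit_point x z n"])

lemma equivariant_iterate:
  assumes x: "x \<in> K" and z: "z \<in> carrier L" and \<phi>: "\<phi> \<in> G"
  shows "orbit_point x (\<phi> z) n = \<phi> (orbit_point x z n)"
proof (induction n)
  case 0
  then show ?case using GD(3)[OF \<phi> x] by simp
next
  case (Suc n)
  interpret S: ring_hom_ring L L \<phi> using G_hom_ring[OF \<phi>] .
  have "orbit_point x z n \<in> carrier L"
    using K_mem_carrier[OF x] z by (induction n) (auto simp: unicrit_def)
  then show ?case unfolding iterate_Suc using Suc z S.hom_nat_pow by simp
qed

lemma iterate_closed: "\<lbrakk>x \<in> carrier L; z \<in> carrier L\<rbrakk> \<Longrightarrow> orbit_point x z n \<in> carrier L"
  by (induction n) (auto simp: unicrit_def)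

lemma iterate_le_1:
  assumes v: "v \<in> \<Omega>" and xz: "x \<in> carrier L" "z \<in> carrier L" "nrm v x \<le> 1" "nrm v z \<le> 1"
  shows "nrm v (orbit_point x z n) \<le> 1"
proof (induction n)
  case (Suc n)
  interpret V: ultrametric_field L "nrm v" using ultrametric_place[OF v] .
  have c: "orbit_point x z n \<in> carrier L" using iterate_closed xz by simp
  have "nrm v (orbit_point x z n) ^ d \<le> 1" using Suc V.abs_nonneg[OF c] by (intro power_le_one)
  then show ?case
    unfolding iterate_Suc using V.abs_add[of "orbit_point x z n [^] d" z] c xz by (simp add: V.abs_pow)
qed (use xz in simp)

text \<open>One finite set of places serves all iterates, because integrality of \<open>x\<close>
  and of the parameter is inherited by the orbit. By \<open>orb_average\<close> the average over
  conjugates of an iterate becomes one over conjugates of the parameter, and the limit passes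
  through finite sums.\<close>

lemma global_height_eq:
  assumes x: "x \<in> K" and z: "z \<in> carrier L" and S: "finite S" "S \<subseteq> \<Omega>"
    and small: "\<And>v. v \<in> \<Omega> - S \<Longrightarrow> nrm v x \<le> 1" "\<And>v y. \<lbrakk>v \<in> \<Omega> - S; y \<in> orb z\<rbrakk> \<Longrightarrow> nrm v y \<le> 1"
  shows "global_height L K \<Omega> nrm d z x = (\<Sum>v\<in>S. \<Sum>y\<in>orb z. lh v x y) / real (card (orb z))"
proof -
  have xc: "x \<in> carrier L" using K_mem_carrier[OF x] .
  have img: "orb (orbit_point x z n) = (\<lambda>y. orbit_point x y n) ` orb z" for n
    using equivariant_iterate[OF x z] by (auto simp: galois_orbit_def image_image)
  have weil: "weil_height L K \<Omega> nrm (orbit_point x z n)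
      = (\<Sum>v\<in>S. \<Sum>y\<in>orb z. log_plus (nrm v (orbit_point x y n))) / real (card (orb z))" for n
  proof -
    have "weil_height L K \<Omega> nrm (orbit_point x z n)
      = (\<Sum>v\<in>S. \<Sum>y\<in>orb (orbit_point x z n). log_plus (nrm v y)) / real (card (orb (orbit_point x z n)))"
    proof (rule weil_height_eq[OF iterate_closed[OF xc z] S])
      fix v y assume v: "v \<in> \<Omega> - S" and "y \<in> orb (orbit_point x z n)"
      then obtain z' where z': "z' \<in> orb z" "y = orbit_point x z' n" unfolding img by blast
      show "nrm v y \<le> 1"
        unfolding z'(2) using v small z'(1) orb_closed[OF z] xc by (intro iterate_le_1) auto
    qed
    also have "\<dots> = (\<Sum>v\<in>S. (\<Sum>y\<in>orb (orbit_point x z n). log_plus (nrm v y)) / real (card (orb (orbit_point x z n))))"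
      by (simp add: sum_divide_distrib)
    also have "\<dots> = (\<Sum>v\<in>S. (\<Sum>y\<in>orb z. log_plus (nrm v (orbit_point x y n))) / real (card (orb z)))"
      using orb_average[of z "\<lambda>y. orbit_point x y n", OF z iterate_closed[OF xc] equivariant_iterate[OF x]]
      by (intro sum.cong refl) simp
    finally show ?thesis by (simp add: sum_divide_distrib)
  qed
  have "(\<lambda>n. (\<Sum>v\<in>S. \<Sum>y\<in>orb z. log_plus (nrm v (orbit_point x y n)) / real d ^ n) / real (card (orb z)))
      \<longlonglongrightarrow> (\<Sum>v\<in>S. \<Sum>y\<in>orb z. lh v x y) / real (card (orb z))"
  proof (intro tendsto_divide tendsto_sum tendsto_const)
    fix v y assume "v \<in> S" "y \<in> orb z"
    then have v: "v \<in> \<Omega>" and y: "y \<in> carrier L" using S orb_closed[OF z] by auto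
    show "(\<lambda>n. log_plus (nrm v (orbit_point x y n)) / real d ^ n) \<longlonglongrightarrow> lh v x y"
      using unicritical.local_height_tendsto[OF unicritical_place[OF v] xc y] .
  next
    show "real (card (orb z)) \<noteq> 0" using orb_finite[OF z] orb_self[of z] by (auto simp: card_eq_0_iff)
  qed
  moreover have "(\<Sum>v\<in>S. \<Sum>y\<in>orb z. log_plus (nrm v (orbit_point x y n)) / real d ^ n) / real (card (orb z))
      = weil_height L K \<Omega> nrm (orbit_point x z n) / real d ^ n" for n
    unfolding weil by (simp add: sum_divide_distrib[symmetric] mult.commute)
  ultimately show ?thesis unfolding global_height_def by (intro limI) simp
qed

lemma local_heights_le_global_height:
  assumes x: "x \<in> K" and z: "z \<in> carrier L" and T: "finite T" "T \<subseteq> \<Omega>"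
  shows "(\<Sum>v\<in>T. \<Sum>y\<in>orb z. lh v x y) \<le> real (card (orb z)) * global_height L K \<Omega> nrm d z x"
proof -
  \<comment> \<open>Beyond \<open>T\<close>, this contains every place where \<open>x\<close> or a
    conjugate of \<open>z\<close> is not integral, so the sum over \<open>S\<close> is the whole
    height; the added terms are nonnegative.\<close>
  define S where "S = T \<union> {v \<in> \<Omega>. 1 < nrm v x} \<union> (\<Union>y\<in>orb z. {v \<in> \<Omega>. 1 < nrm v y})"
  have xc: "x \<in> carrier L" using K_mem_carrier[OF x] .
  have S: "finite S" "S \<subseteq> \<Omega>"
    using T finite_large[OF xc] finite_large orb_finite[OF z] orb_closed[OF z] by (auto simp: S_def)
  have pos: "real (card (orb z)) > 0"
    using orb_finite[OF z] orb_self[of z] by (auto simp: card_gt_0_iff)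
  have "(\<Sum>v\<in>T. \<Sum>y\<in>orb z. lh v x y) \<le> (\<Sum>v\<in>S. \<Sum>y\<in>orb z. lh v x y)"
  proof (rule sum_mono2[OF S(1)])
    show "T \<subseteq> S" by (auto simp: S_def)
    fix v assume "v \<in> S - T"
    then have v: "v \<in> \<Omega>" using S by auto
    show "0 \<le> (\<Sum>y\<in>orb z. lh v x y)"
      using orb_closed[OF z] xc unicritical.local_height_nonneg[OF unicritical_place[OF v]]
      by (intro sum_nonneg) auto
  qed
  also have "\<dots> = real (card (orb z)) * global_height L K \<Omega> nrm d z x"
  proof -
    have "global_height L K \<Omega> nrm d z x = (\<Sum>v\<in>S. \<Sum>y\<in>orb z. lh v x y) / real (card (orb z))"
      using S by (intro global_height_eq[OF x z]) (force simp: S_def)+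
    then show ?thesis using pos by simp
  qed
  finally show ?thesis .
qed

text \<open>The bound is required for all finite \<open>T\<close> because the places where the
  discriminant of \<open>F\<close> is not a unit are known only once \<open>F\<close> is
  chosen.\<close>

definition small_stable :: "'a \<Rightarrow> 'a \<Rightarrow> real \<Rightarrow> nat \<Rightarrow> 'a set \<Rightarrow> bool" where
  "small_stable x y \<eta> M F \<longleftrightarrow> finite F \<and> F \<subseteq> carrier L \<and> (\<forall>\<phi>\<in>G. \<phi> ` F = F) \<and> card F \<ge> M \<and>
    (\<forall>T. finite T \<longrightarrow> T \<subseteq> \<Omega> \<longrightarrow> (\<Sum>v\<in>T. \<Sum>z\<in>F. lh v x z + lh v y z) \<le> \<eta> * real (card F))"

text \<open>The sets are unions of Galois orbits of the \<open>lam n\<close>.\<close>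

lemma small_stable_sets:
  assumes x: "x \<in> K" and y: "y \<in> K" and lam: "range lam \<subseteq> carrier L" "infinite (range (lam :: nat \<Rightarrow> 'a))"
    and lim: "(\<lambda>n. global_height L K \<Omega> nrm d (lam n) x) \<longlonglongrightarrow> 0"
      "(\<lambda>n. global_height L K \<Omega> nrm d (lam n) y) \<longlonglongrightarrow> 0"
    and \<eta>: "\<eta> > 0"
  shows "\<exists>F. small_stable x y \<eta> M F"
proof -
  define H where "H z = global_height L K \<Omega> nrm d z x + global_height L K \<Omega> nrm d z y" for z
  have "(\<lambda>n. H (lam n)) \<longlonglongrightarrow> 0 + 0" unfolding H_def using lim by (intro tendsto_add)
  then have "eventually (\<lambda>n. H (lam n) < \<eta>) sequentially"
    using \<eta> by (intro order_tendstoD(2)) auto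
  then obtain n0 where n0: "\<And>n. n \<ge> n0 \<Longrightarrow> H (lam n) < \<eta>" by (auto simp: eventually_sequentially)
  define A where "A = lam ` {n0..}"
  have "{..<n0} \<union> {n0..} = UNIV" by auto
  then have "range lam = lam ` {..<n0} \<union> A" unfolding A_def by (metis image_Un)
  then have A: "infinite A" "A \<subseteq> carrier L" using lam by (auto simp: A_def)
  have Asmall: "H z < \<eta>" if "z \<in> A" for z using that n0 by (auto simp: A_def)
  \<comment> \<open>Orbits are finite, so infinitely many parameters meet infinitely many orbits.
    Any \<open>M\<close> of these are disjoint and nonempty, hence have at least \<open>M\<close>
    elements together.\<close>
  have "infinite (orb ` A)"
  proof
    assume "finite (orb ` A)"
    moreover have "finite B" if "B \<in> orb ` A" for B using that A orb_finite by auto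
    ultimately have "finite (\<Union>(orb ` A))" by blast
    moreover have "A \<subseteq> \<Union>(orb ` A)" using orb_self by blast
    ultimately show False using A finite_subset by blast
  qed
  then obtain Os where Os: "finite Os" "card Os = M" "Os \<subseteq> orb ` A"
    using infinite_arbitrarily_large by blast
  have O: "finite B" "B \<subseteq> carrier L" "B \<noteq> {}" if "B \<in> Os" for B
  proof -
    obtain u where u: "u \<in> A" "B = orb u" using \<open>B \<in> Os\<close> Os(3) by blast
    then have "u \<in> carrier L" using A by blast
    then show "finite B" "B \<subseteq> carrier L" "B \<noteq> {}"
      using orb_finite[of u] orb_closed[of u] orb_self[of u] unfolding u(2) by blast+
  qed
  have disj: "B \<inter> B' = {}" if BB: "B \<in> Os" "B' \<in> Os" "B \<noteq> B'" for B B'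
  proof (rule ccontr)
    assume "B \<inter> B' \<noteq> {}"
    then obtain u where u: "u \<in> B" "u \<in> B'" by blast
    obtain z z' where "z \<in> A" "B = orb z" "z' \<in> A" "B' = orb z'" using BB Os(3) by blast
    then show False using orb_trans[of z u] orb_trans[of z' u] u A(2) BB(3) by auto
  qed
  define F where "F = \<Union>Os"
  have cardF: "card F = (\<Sum>B\<in>Os. card B)"
    unfolding F_def using O disj by (intro card_Union_disjoint) (auto simp: pairwise_def disjnt_def)
  have "(\<Sum>B\<in>Os. 1) \<le> (\<Sum>B\<in>Os. card B)"
    using O by (intro sum_mono) (simp add: Suc_leI card_gt_0_iff)
  then have "M \<le> card F" using Os(2) cardF by simp
  moreover have "finite F" "F \<subseteq> carrier L" using O Os(1) by (auto simp: F_def)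
  moreover have "\<phi> ` F = F" if "\<phi> \<in> G" for \<phi>
  proof -
    have "\<phi> ` B = B" if "B \<in> Os" for B
    proof -
      obtain u where "u \<in> A" "B = orb u" using \<open>B \<in> Os\<close> Os(3) by blast
      then show ?thesis using A(2) orb_image[OF _ \<open>\<phi> \<in> G\<close>, of u] by blast
    qed
    then show ?thesis by (simp add: F_def image_Union)
  qed
  moreover have "(\<Sum>v\<in>T. \<Sum>z\<in>F. lh v x z + lh v y z) \<le> \<eta> * real (card F)"
    if T: "finite T" "T \<subseteq> \<Omega>" for T
  proof -
    have "(\<Sum>v\<in>T. \<Sum>z\<in>F. lh v x z + lh v y z) = (\<Sum>v\<in>T. \<Sum>B\<in>Os. \<Sum>z\<in>B. lh v x z + lh v y z)"
      unfolding F_def using O disj by (intro sum.cong refl) (subst sum.Union_disjoint, auto)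
    also have "\<dots> = (\<Sum>B\<in>Os. \<Sum>v\<in>T. \<Sum>z\<in>B. lh v x z + lh v y z)" by (rule sum.swap)
    also have "\<dots> \<le> (\<Sum>B\<in>Os. \<eta> * real (card B))"
    proof (rule sum_mono)
      fix B assume "B \<in> Os"
      then obtain z where z: "z \<in> A" "B = orb z" using Os(3) by blast
      have zc: "z \<in> carrier L" using z A by blast
      have "(\<Sum>v\<in>T. \<Sum>u\<in>B. lh v x u + lh v y u) \<le> real (card B) * H z"
        using local_heights_le_global_height[OF x zc T] local_heights_le_global_height[OF y zc T]
        by (simp add: z(2) H_def sum.distrib distrib_left)
      also have "\<dots> \<le> real (card B) * \<eta>" using Asmall[OF z(1)] by (intro mult_left_mono) auto
      finally show "(\<Sum>v\<in>T. \<Sum>u\<in>B. lh v x u + lh v y u) \<le> \<eta> * real (card B)" by (simp add: mult.commute)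
    qed
    also have "\<dots> = \<eta> * real (card F)" by (simp add: cardF sum_distrib_left)
    finally show ?thesis .
  qed
  ultimately show ?thesis
    unfolding small_stable_def by (intro exI[of _ F] conjI allI impI ballI) simp_all
qed

section \<open>Root measures and their energies at the places\<close>

definition roots_of_iterate :: "'a \<Rightarrow> nat \<Rightarrow> nat \<Rightarrow> 'a" where
  "roots_of_iterate x n = (SOME a. (\<forall>j<d ^ n. a j \<in> carrier L \<and> orbit_point x (a j) (Suc n) = \<zero>) \<and>
    (\<forall>\<nu> z. ultrametric_field L \<nu> \<longrightarrow> z \<in> carrier L \<longrightarrow>
      \<nu> (orbit_point x z (Suc n)) = (\<Prod>j<d ^ n. \<nu> (z \<ominus> a j))))"

lemma roots_of_iterate:
  assumes "x \<in> carrier L"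
  shows "j < d ^ n \<Longrightarrow> roots_of_iterate x n j \<in> carrier L"
    and "j < d ^ n \<Longrightarrow> orbit_point x (roots_of_iterate x n j) (Suc n) = \<zero>"
    and "\<lbrakk>v \<in> \<Omega>; z \<in> carrier L\<rbrakk> \<Longrightarrow>
      nrm v (orbit_point x z (Suc n)) = (\<Prod>j<d ^ n. nrm v (z \<ominus> roots_of_iterate x n j))"
  using someI_ex[OF unicrit_iterate_roots[OF assms degree_ge_2, of n]] ultrametric_place
  unfolding roots_of_iterate_def[symmetric] by simp_all

definition dst :: "'v \<Rightarrow> 'a \<Rightarrow> 'a \<Rightarrow> real" where
  "dst v x y = nrm v (x \<ominus> y)"

lemma ultrametric_dst:
  assumes "v \<in> \<Omega>"
  shows "ultrametric (carrier L) (dst v)"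
proof -
  interpret V: ultrametric_field L "nrm v" using ultrametric_place[OF assms] .
  show ?thesis unfolding dst_def[abs_def] by (rule V.ultrametric_axioms)
qed

definition radii :: "'v \<Rightarrow> 'a \<Rightarrow> nat \<Rightarrow> nat \<Rightarrow> real" where
  "radii v x n = (SOME r. ultrametric.balanced (carrier L) (dst v) (d ^ n) (roots_of_iterate x n) r)"

lemma radii:
  assumes "v \<in> \<Omega>" "x \<in> carrier L"
  shows "ultrametric.balanced (carrier L) (dst v) (d ^ n) (roots_of_iterate x n) (radii v x n)"
  unfolding radii_def
  using someI_ex[OF ultrametric.balanced_exists[OF ultrametric_dst[OF assms(1)], of "d ^ n" "roots_of_iterate x n"]]
    roots_of_iterate(1)[OF assms(2)] by blast

lemma bnd_eq_1: "\<lbrakk>v \<in> \<Omega>; x \<in> carrier L; nrm v x \<le> 1\<rbrakk> \<Longrightarrow> unicritical.bnd (nrm v) d x = 1"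
  using unicritical.bnd_def[OF unicritical_place] power_le_one[of "nrm v x" d]
    ultrametric_field.abs_nonneg[OF ultrametric_place] by (simp add: max.absorb1)

lemma root_bound:
  assumes "v \<in> \<Omega>" "x \<in> carrier L" "j < d ^ n"
  shows "nrm v (roots_of_iterate x n j) \<le> unicritical.bnd (nrm v) d x"
  using unicritical.zero_of_iterate_bounded[OF unicritical_place[OF assms(1)] assms(2)
      roots_of_iterate(1)[OF assms(2,3)], of "Suc n"] roots_of_iterate(2)[OF assms(2,3)] by simp

text \<open>All roots lie in the unit disc, so radius 1 is balanced and is the radius by uniqueness.
  The root measure is then the unit mass on the closed unit disc.\<close>

lemma radii_eq_1:
  assumes v: "v \<in> \<Omega>" and x: "x \<in> carrier L" "nrm v x \<le> 1" and l: "l < d ^ n"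
  shows "radii v x n l = 1"
proof -
  interpret U: ultrametric "carrier L" "dst v" using ultrametric_dst[OF v] .
  interpret V: ultrametric_field L "nrm v" using ultrametric_place[OF v] .
  let ?a = "roots_of_iterate x n"
  have "dst v (?a l) (?a j) \<le> 1" if "j < d ^ n" for j
    using V.abs_diff[OF roots_of_iterate(1)[OF x(1) l] roots_of_iterate(1)[OF x(1) that]]
      root_bound[OF v x(1) l] root_bound[OF v x(1) that] bnd_eq_1[OF v x] by (simp add: dst_def)
  then have "(\<Prod>j<d ^ n. max (dst v (?a l) (?a j)) 1) = 1"
    by (intro prod.neutral) auto
  then show ?thesis using U.balanced_unique[OF radii[OF v x(1)] l, of 1] by simp
qed

definition mutual_energy :: "'v \<Rightarrow> 'a \<Rightarrow> 'a \<Rightarrow> nat \<Rightarrow> real" where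
  "mutual_energy v x y n = (\<Sum>i<d ^ n. \<Sum>j<d ^ n. ultrametric.disc_kernel (dst v)
      (roots_of_iterate x n i, radii v x n i) (roots_of_iterate y n j, radii v y n j)) / (real (d ^ n))\<^sup>2"

lemma truncated_abs: "v \<in> \<Omega> \<Longrightarrow> x \<in> carrier L \<Longrightarrow> z \<in> carrier L \<Longrightarrow>
    ln (max 1 (\<Prod>j<d ^ n. dst v z (roots_of_iterate x n j))) = log_plus (nrm v (orbit_point x z (Suc n)))"
  using roots_of_iterate(3)[of x v z n] by (simp add: log_plus_def dst_def max.commute)

text \<open>Here \<open>e\<close> is the fattening radius. It does not depend on \<open>F\<close>,
  so its contribution tends to 0 as \<open>F\<close> grows; it is 1 at places where \<open>x\<close>
  and \<open>y\<close> are integral, so the sum of its logarithms over all places is finite.\<close>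

definition energy_bound :: "'v \<Rightarrow> 'a \<Rightarrow> 'a \<Rightarrow> nat \<Rightarrow> real \<Rightarrow> bool" where
  "energy_bound v x y n e \<longleftrightarrow> 0 < e \<and> (nrm v x \<le> 1 \<longrightarrow> nrm v y \<le> 1 \<longrightarrow> e = 1) \<and> 0 \<le> mutual_energy v x y n \<and>
      (\<forall>F. finite F \<longrightarrow> F \<noteq> {} \<longrightarrow> F \<subseteq> carrier L \<longrightarrow>
        ln (nrm v (discriminant F)) / (real (card F))\<^sup>2 + ln e / real (card F)
        \<le> (\<Sum>z\<in>F. real d * (lh v x z + lh v y z)
          + (ln (unicritical.bnd (nrm v) d x) + ln (unicritical.bnd (nrm v) d y)) / real (d ^ n)) / real (card F) - mutual_energy v x y n / 2)"

lemma local_energy_bound: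
  assumes v: "v \<in> \<Omega>" and x: "x \<in> carrier L" and y: "y \<in> carrier L"
  shows "\<exists>\<epsilon>. energy_bound v x y n \<epsilon>"
proof -
  interpret U: ultrametric "carrier L" "dst v" using ultrametric_dst[OF v] .
  interpret V: unicritical L "nrm v" d using unicritical_place[OF v] .
  let ?a = "roots_of_iterate x n" and ?b = "roots_of_iterate y n"
  let ?r = "radii v x n" and ?s = "radii v y n" and ?N = "d ^ n"
  note ra = radii[OF v x, of n] and rb = radii[OF v y, of n]
  have N: "?N > 0" using degree_ge_2 by simp
  \<comment> \<open>The fattening radius is the least element, so it is at most every radius of
    either root measure.\<close>
  define E where "E = insert 1 (?r ` {..<?N} \<union> ?s ` {..<?N})"
  define \<epsilon> where "\<epsilon> = Min E"
  have E: "finite E" "E \<noteq> {}" by (auto simp: E_def)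
  have "0 < e" if "e \<in> E" for e using that U.balancedD(2)[OF ra] U.balancedD(2)[OF rb] by (auto simp: E_def)
  then have pos: "0 < \<epsilon>" using E by (simp add: \<epsilon>_def)
  have le: "\<epsilon> \<le> e" if "e \<in> E" for e using E that by (simp add: \<epsilon>_def)
  have one: "\<epsilon> = 1" if "nrm v x \<le> 1" "nrm v y \<le> 1"
  proof -
    have "E \<subseteq> {1}" using radii_eq_1[OF v x that(1)] radii_eq_1[OF v y that(2)] by (auto simp: E_def)
    then have "E = {1}" using E(2) by blast
    then show ?thesis by (simp add: \<epsilon>_def)
  qed
  \<comment> \<open>The potential is divided by \<open>d ^ n\<close>, but the local height
    approximates the iterate \<open>Suc n\<close> divided by \<open>d ^ Suc n\<close>; hence the
    factor \<open>d\<close>.\<close>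
  have height: "log_plus (nrm v (orbit_point u z (Suc n))) / real ?N
      \<le> real d * lh v u z + ln (V.bnd u) / real ?N" if "u \<in> carrier L" "z \<in> carrier L" for u z
  proof -
    have "log_plus (nrm v (orbit_point u z (Suc n))) / real d ^ Suc n \<le> lh v u z + ln (V.bnd u) / real d ^ Suc n"
      using V.local_height_approx[OF that, of "Suc n"] by (simp add: abs_le_iff)
    then have "real d * (log_plus (nrm v (orbit_point u z (Suc n))) / real d ^ Suc n)
        \<le> real d * (lh v u z + ln (V.bnd u) / real d ^ Suc n)"
      by (intro mult_left_mono) auto
    then show ?thesis using degree_ge_2 by (simp add: distrib_left)
  qed
  have F: "ln (nrm v (discriminant F)) / (real (card F))\<^sup>2 + ln \<epsilon> / real (card F)
      \<le> (\<Sum>z\<in>F. real d * (lh v x z + lh v y z) + (ln (V.bnd x) + ln (V.bnd y)) / real ?N) / real (card F)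
        - mutual_energy v x y n / 2"
    and nonneg: "(\<Sum>i<?N. ln (max 1 (\<Prod>j<?N. dst v (?a i) (?b j)))) \<le> mutual_energy v x y n * (real ?N)\<^sup>2"
    if F: "finite F" "F \<noteq> {}" "F \<subseteq> carrier L" for F
  proof -
    have posd: "0 < dst v z z'" if "z \<in> F" "z' \<in> F" "z \<noteq> z'" for z z'
    proof -
      have "z \<in> carrier L" "z' \<in> carrier L" using that F(3) by auto
      then show ?thesis using V.abs_pos[of "z \<ominus> z'"] that(3) by (simp add: dst_def)
    qed
    have mem: "\<epsilon> \<le> ?r j" "\<epsilon> \<le> ?s j" if "j < ?N" for j using that by (auto simp: E_def intro!: le)
    have e1: "(\<Sum>z\<in>F. \<Sum>u\<in>F - {z}. ln (dst v z u)) / (real (card F))\<^sup>2 + ln \<epsilon> / real (card F)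
      \<le> (\<Sum>z\<in>F. ln (max 1 (\<Prod>j<?N. dst v z (?a j))) + ln (max 1 (\<Prod>j<?N. dst v z (?b j)))) / (real (card F) * real ?N)
        - mutual_energy v x y n / 2"
      unfolding mutual_energy_def
      by (rule U.finite_set_energy(1)[OF F _ N ra rb pos]) (erule posd mem | assumption)+
    have e2: "(\<Sum>i<?N. ln (max 1 (\<Prod>j<?N. dst v (?a i) (?b j)))) \<le> mutual_energy v x y n * (real ?N)\<^sup>2"
      unfolding mutual_energy_def
      by (rule U.finite_set_energy(2)[OF F _ N ra rb pos]) (erule posd mem | assumption)+
    show "(\<Sum>i<?N. ln (max 1 (\<Prod>j<?N. dst v (?a i) (?b j)))) \<le> mutual_energy v x y n * (real ?N)\<^sup>2"
      using e2 by simp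
    have "(\<Sum>z\<in>F. ln (max 1 (\<Prod>j<?N. dst v z (?a j))) + ln (max 1 (\<Prod>j<?N. dst v z (?b j)))) / (real (card F) * real ?N)
        = (\<Sum>z\<in>F. log_plus (nrm v (orbit_point x z (Suc n))) / real ?N
             + log_plus (nrm v (orbit_point y z (Suc n))) / real ?N) / real (card F)"
      using F(3) truncated_abs[OF v x] truncated_abs[OF v y]
      by (simp add: subset_iff sum_divide_distrib add_divide_distrib[symmetric] mult.commute)
    also have "\<dots> \<le> (\<Sum>z\<in>F. real d * (lh v x z + lh v y z) + (ln (V.bnd x) + ln (V.bnd y)) / real ?N) / real (card F)"
    proof (intro divide_right_mono sum_mono)
      fix z assume "z \<in> F"
      then have z: "z \<in> carrier L" using F by auto
      show "log_plus (nrm v (orbit_point x z (Suc n))) / real ?N + log_plus (nrm v (orbit_point y z (Suc n))) / real ?N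
        \<le> real d * (lh v x z + lh v y z) + (ln (V.bnd x) + ln (V.bnd y)) / real ?N"
        using height[OF x z] height[OF y z] by (simp add: distrib_left add_divide_distrib)
    qed simp
    finally have "(\<Sum>z\<in>F. ln (max 1 (\<Prod>j<?N. dst v z (?a j))) + ln (max 1 (\<Prod>j<?N. dst v z (?b j)))) / (real (card F) * real ?N)
      \<le> (\<Sum>z\<in>F. real d * (lh v x z + lh v y z) + (ln (V.bnd x) + ln (V.bnd y)) / real ?N) / real (card F)" .
    then show "ln (nrm v (discriminant F)) / (real (card F))\<^sup>2 + ln \<epsilon> / real (card F)
      \<le> (\<Sum>z\<in>F. real d * (lh v x z + lh v y z) + (ln (V.bnd x) + ln (V.bnd y)) / real ?N) / real (card F)
        - mutual_energy v x y n / 2"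
      unfolding abs_discriminant[OF ultrametric_place[OF v] F(1,3)] dst_def[symmetric]
      by (intro order_trans[OF e1 diff_right_mono])
  qed
  have "0 \<le> (\<Sum>i<?N. ln (max 1 (\<Prod>j<?N. dst v (?a i) (?b j))))" by (intro sum_nonneg) simp
  \<comment> \<open>The second inequality does not involve \<open>F\<close>, so any nonempty finite
    set may be inserted.\<close>
  also have "\<dots> \<le> mutual_energy v x y n * (real ?N)\<^sup>2" using nonneg[of "{\<zero>}"] by simp
  finally have "0 \<le> mutual_energy v x y n" using N degree_ge_2 by (auto simp: zero_le_mult_iff)
  then show ?thesis unfolding energy_bound_def using pos one F by (intro exI[of _ \<epsilon>]) auto
qed

text \<open>Summing the local bounds over all places, the product formula removes the discriminant.\<close>

lemma mutual_energy_bound: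
  assumes x: "x \<in> K" and y: "y \<in> K" and w: "w \<in> \<Omega>"
    and small: "\<And>\<eta> M. \<eta> > 0 \<Longrightarrow> \<exists>F. small_stable x y \<eta> M F"
  shows "\<exists>C\<ge>0. \<forall>n. 0 \<le> mutual_energy w x y n \<and> mutual_energy w x y n \<le> C / real (d ^ n)"
proof -
  have xc: "x \<in> carrier L" and yc: "y \<in> carrier L" using K_mem_carrier x y by auto
  define B where "B v = ln (unicritical.bnd (nrm v) d x) + ln (unicritical.bnd (nrm v) d y)" for v
  define S where "S = {v \<in> \<Omega>. 1 < nrm v x} \<union> {v \<in> \<Omega>. 1 < nrm v y}"
  have S: "finite S" "S \<subseteq> \<Omega>" using finite_large xc yc by (auto simp: S_def)
  have B0: "0 \<le> B v" if "v \<in> \<Omega>" for v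
    using unicritical.bnd_ge_1[OF unicritical_place[OF that]] by (simp add: B_def)
  have Bout: "B v = 0" if "v \<in> \<Omega>" "v \<notin> S" for v
    using that bnd_eq_1[of v x] bnd_eq_1[of v y] xc yc by (auto simp: B_def S_def)
  define C where "C = (\<Sum>v\<in>S. B v)"
  have C0: "0 \<le> C" using B0 S by (auto simp: C_def intro: sum_nonneg)
  have "0 \<le> mutual_energy w x y n \<and> mutual_energy w x y n \<le> 2 * C / real (d ^ n)" for n
  proof -
    let ?N = "real (d ^ n)"
    have "\<forall>v\<in>\<Omega>. \<exists>e. energy_bound v x y n e"
      by (intro ballI local_energy_bound[OF _ xc yc])
    from bchoice[OF this] obtain \<epsilon> where "\<forall>v\<in>\<Omega>. energy_bound v x y n (\<epsilon> v)" by (elim exE)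
    then have P: "energy_bound v x y n (\<epsilon> v)" if "v \<in> \<Omega>" for v using that by simp
    have \<epsilon>: "0 < \<epsilon> v" "nrm v x \<le> 1 \<Longrightarrow> nrm v y \<le> 1 \<Longrightarrow> \<epsilon> v = 1" "0 \<le> mutual_energy v x y n"
      "\<lbrakk>finite F; F \<noteq> {}; F \<subseteq> carrier L\<rbrakk> \<Longrightarrow>
        ln (nrm v (discriminant F)) / (real (card F))\<^sup>2 + ln (\<epsilon> v) / real (card F)
        \<le> (\<Sum>z\<in>F. real d * (lh v x z + lh v y z) + B v / ?N) / real (card F) - mutual_energy v x y n / 2"
      if "v \<in> \<Omega>" for v F
      using P[OF that] unfolding energy_bound_def B_def by simp_all
    have \<epsilon>out: "ln (\<epsilon> v) = 0" if "v \<in> \<Omega>" "v \<notin> S" for v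
      using that \<epsilon>(2)[of v] by (auto simp: S_def)
    define k where "k = \<bar>\<Sum>v\<in>S. ln (\<epsilon> v)\<bar>"
    have "mutual_energy w x y n / 2 \<le> C / ?N + e" if e: "e > 0" for e
    proof -
      \<comment> \<open>The error \<open>e\<close> is shared equally. More than \<open>M\<close>
        elements in \<open>F\<close> push the fattening cost \<open>k / card F\<close> below
        \<open>e / 2\<close>; the heights, which enter with the factor \<open>d\<close>, get the
        bound \<open>e / (2 * d)\<close>.\<close>
      obtain M where M: "2 * k / e < real M" using reals_Archimedean2 by blast
      have "e / (2 * real d) > 0" using e degree_ge_2 by simp
      from small[OF this, of "Suc M"] obtain F where Fall: "small_stable x y (e / (2 * real d)) (Suc M) F"
        by (elim exE)
      from Fall have F: "finite F" "F \<subseteq> carrier L" "\<And>\<phi>. \<phi> \<in> G \<Longrightarrow> \<phi> ` F = F" "card F \<ge> Suc M"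
        by (simp_all add: small_stable_def)
      from Fall have FT: "(\<Sum>v\<in>T. \<Sum>z\<in>F. lh v x z + lh v y z) \<le> e / (2 * real d) * real (card F)"
        if "finite T" "T \<subseteq> \<Omega>" for T
        using that by (simp add: small_stable_def)
      let ?m = "real (card F)"
      have m: "?m > 0" "F \<noteq> {}" using F(4) by auto
      define \<Delta> where "\<Delta> = discriminant F"
      have \<Delta>: "\<Delta> \<in> K" "\<Delta> \<noteq> \<zero>" unfolding \<Delta>_def using discriminant_mem[OF F(1-3)] by auto
      \<comment> \<open>A finite set outside which nothing contributes to the constants or to the
        discriminant, and which contains the place of interest \<open>w\<close>.\<close>
      define T where "T = S \<union> {w} \<union> {v \<in> \<Omega>. nrm v \<Delta> \<noteq> 1}"
      have T: "finite T" "T \<subseteq> \<Omega>" "S \<subseteq> T" "w \<in> T" using S w finite_support[OF \<Delta>] by (auto simp: T_def)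
      have lnpos: "0 < nrm v \<Delta>" if "v \<in> \<Omega>" for v
        using ultrametric_field.abs_pos[OF ultrametric_place[OF that] K_mem_carrier[OF \<Delta>(1)] \<Delta>(2)] .
      have "(\<Sum>v\<in>T. ln (nrm v \<Delta>)) = (\<Sum>v\<in>{v \<in> \<Omega>. nrm v \<Delta> \<noteq> 1}. ln (nrm v \<Delta>))"
        using T(1,2) by (intro sum.mono_neutral_right) (auto simp: T_def)
      also have "\<dots> = ln (\<Prod>v\<in>{v \<in> \<Omega>. nrm v \<Delta> \<noteq> 1}. nrm v \<Delta>)"
        using finite_support[OF \<Delta>] lnpos by (intro ln_prod[symmetric]) (auto simp: less_imp_neq[symmetric])
      also have "\<dots> = 0" using product_formula[OF \<Delta>] by simp
      finally have prod0: "(\<Sum>v\<in>T. ln (nrm v \<Delta>)) = 0" .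
      have "(\<Sum>v\<in>T. ln (nrm v \<Delta>) / ?m\<^sup>2 + ln (\<epsilon> v) / ?m)
        \<le> (\<Sum>v\<in>T. (\<Sum>z\<in>F. real d * (lh v x z + lh v y z) + B v / ?N) / ?m - mutual_energy v x y n / 2)"
        using \<epsilon>(4)[OF _ F(1) m(2) F(2)] T(2) unfolding \<Delta>_def by (intro sum_mono) auto
      also have "\<dots> = real d * (\<Sum>v\<in>T. \<Sum>z\<in>F. lh v x z + lh v y z) / ?m + (\<Sum>v\<in>T. B v) / ?N
          - (\<Sum>v\<in>T. mutual_energy v x y n) / 2"
      proof -
        have "(\<Sum>z\<in>F. real d * (lh v x z + lh v y z) + B v / ?N) / ?m
            = real d * (\<Sum>z\<in>F. lh v x z + lh v y z) / ?m + B v / ?N" for v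
          using m(1) by (simp add: sum.distrib[of "\<lambda>z. real d * (lh v x z + lh v y z)"]
              sum_distrib_left[symmetric] add_divide_distrib)
        then show ?thesis
          by (simp add: sum_subtractf sum.distrib[of "\<lambda>v. real d * _ v / _"] sum_divide_distrib[symmetric] sum_distrib_left[symmetric])
      qed
      finally have main: "(\<Sum>v\<in>T. ln (nrm v \<Delta>) / ?m\<^sup>2 + ln (\<epsilon> v) / ?m)
        \<le> real d * (\<Sum>v\<in>T. \<Sum>z\<in>F. lh v x z + lh v y z) / ?m + (\<Sum>v\<in>T. B v) / ?N
          - (\<Sum>v\<in>T. mutual_energy v x y n) / 2" .
      have BT: "(\<Sum>v\<in>T. B v) = C"
        unfolding C_def using T Bout by (intro sum.mono_neutral_right) auto
      \<comment> \<open>The mutual energies at the other places are nonnegative and can be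
        discarded.\<close>
      have "mutual_energy w x y n \<le> (\<Sum>v\<in>T. mutual_energy v x y n)"
        using T \<epsilon>(3) by (intro member_le_sum) auto
      moreover have "real d * (\<Sum>v\<in>T. \<Sum>z\<in>F. lh v x z + lh v y z) / ?m \<le> e / 2"
      proof -
        have "real d * (\<Sum>v\<in>T. \<Sum>z\<in>F. lh v x z + lh v y z) \<le> real d * (e / (2 * real d) * ?m)"
          using FT[OF T(1,2)] by (intro mult_left_mono) auto
        also have "\<dots> = e / 2 * ?m" using degree_ge_2 by simp
        finally show ?thesis using m(1) by (simp add: pos_divide_le_eq)
      qed
      moreover have "- (e / 2) \<le> (\<Sum>v\<in>T. ln (nrm v \<Delta>) / ?m\<^sup>2 + ln (\<epsilon> v) / ?m)"
      proof -
        have "(\<Sum>v\<in>T. ln (\<epsilon> v)) = (\<Sum>v\<in>S. ln (\<epsilon> v))"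
          using T \<epsilon>out by (intro sum.mono_neutral_right) auto
        then have eq: "(\<Sum>v\<in>T. ln (nrm v \<Delta>) / ?m\<^sup>2 + ln (\<epsilon> v) / ?m) = (\<Sum>v\<in>S. ln (\<epsilon> v)) / ?m"
          using prod0 by (simp add: sum.distrib sum_divide_distrib[symmetric])
        have "- k \<le> (\<Sum>v\<in>S. ln (\<epsilon> v))" by (simp add: k_def)
        moreover have "k \<le> e / 2 * ?m"
        proof -
          have "2 * k / e < ?m" using M F(4) by linarith
          then show ?thesis using e by (simp add: field_simps)
        qed
        ultimately have "- (e / 2) * ?m \<le> (\<Sum>v\<in>S. ln (\<epsilon> v))" by linarith
        then show ?thesis unfolding eq using m(1) by (simp only: pos_le_divide_eq)
      qed
      ultimately show ?thesis using main[unfolded BT] by linarith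
    qed
    then have "mutual_energy w x y n / 2 \<le> C / ?N" by (rule field_le_epsilon)
    then show ?thesis using \<epsilon>(3)[OF w] by (simp add: mult.commute)
  qed
  then show ?thesis using C0 by (intro exI[of _ "2 * C"]) simp
qed

text \<open>Within distance \<open>t\<close> of \<open>z\<close> the truncated absolute value of the
  iterate is constant, and the absolute values are dense because the closure contains all roots of
  an element of absolute value above 1. So the disc of radius \<open>t\<close> has the same
  potential as its centre. Allowing \<open>b\<close> to exceed the bound for \<open>x\<close> lets
  one \<open>t\<close> serve two starting points.\<close>

lemma local_potential:
  assumes v: "v \<in> \<Omega>" and x: "x \<in> carrier L" and z: "z \<in> carrier L"
    and b: "unicritical.bnd (nrm v) d x \<le> b" and t: "t = 1 / b ^ Suc n"
  shows "ln (\<Prod>j<d ^ n. max (dst v z (roots_of_iterate x n j)) (max t (radii v x n j)))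
    = log_plus (nrm v (orbit_point x z (Suc n)))"
proof -
  interpret U: ultrametric "carrier L" "dst v" using ultrametric_dst[OF v] .
  interpret V: unicritical L "nrm v" d using unicritical_place[OF v] .
  have b1: "1 \<le> b" using b V.bnd_ge_1[of x] by linarith
  then have t0: "0 < t" using t by simp
  have "(\<Prod>j<d ^ n. max (dst v z (roots_of_iterate x n j)) (max t (radii v x n j)))
      = max 1 (\<Prod>j<d ^ n. dst v z (roots_of_iterate x n j))"
  proof (rule U.balanced_potential_disc[OF radii[OF v x] z t0])
    fix u assume u: "u \<in> carrier L" "dst v z u \<le> t"
    have "nrm v (z \<ominus> u) * V.bnd x ^ Suc n \<le> t * b ^ Suc n"
      using u z b V.bnd_ge_1[of x] t0 V.abs_nonneg[of "z \<ominus> u"]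
      by (intro mult_mono power_mono) (auto simp: dst_def)
    also have "\<dots> = 1" using t b1 by simp
    finally have "nrm v (z \<ominus> u) * V.bnd x ^ Suc n \<le> 1" .
    from V.truncated_abs_locally_constant[OF x z u(1) _ this]
    have "max 1 (nrm v (orbit_point x u (Suc n))) = max 1 (nrm v (orbit_point x z (Suc n)))" by simp
    then show "max 1 (\<Prod>j<d ^ n. dst v u (roots_of_iterate x n j))
        = max 1 (\<Prod>j<d ^ n. dst v z (roots_of_iterate x n j))"
      unfolding dst_def using roots_of_iterate(3)[OF x v u(1), of n] roots_of_iterate(3)[OF x v z, of n] by simp
  next
    fix s assume s: "0 \<le> s" "s < t"
    obtain c where c: "c \<in> carrier L" "1 < nrm v c" using nontrivial_place[OF v] by blast
    obtain u where u: "u \<in> carrier L" "s < nrm v u" "nrm v u < t"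
      using V.value_group_dense[OF c exists_nth_root[OF c(1)] s] by blast
    have "z \<ominus> (z \<ominus> u) = u" using z u(1) by algebra
    then show "\<exists>u\<in>carrier L. s < dst v z u \<and> dst v z u < t"
      using u z by (intro bexI[of _ "z \<ominus> u"]) (auto simp: dst_def)
  qed
  then show ?thesis using truncated_abs[OF v x z] by simp
qed

text \<open>The square of the difference of the potentials is at most a constant times
  \<open>(ln T - ln t) / d ^ n\<close>. Since \<open>t\<close> is \<open>1 / b ^ Suc n\<close>, the
  numerator grows only linearly in \<open>n\<close>.\<close>

theorem local_heights_eq:
  assumes x: "x \<in> K" and y: "y \<in> K" and lam: "range lam \<subseteq> carrier L" "infinite (range (lam :: nat \<Rightarrow> 'a))"
    and lim: "(\<lambda>n. global_height L K \<Omega> nrm d (lam n) x) \<longlonglongrightarrow> 0"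
      "(\<lambda>n. global_height L K \<Omega> nrm d (lam n) y) \<longlonglongrightarrow> 0"
    and w: "w \<in> \<Omega>" and z: "z \<in> carrier L"
  shows "lh w x z = lh w y z"
proof -
  interpret U: ultrametric "carrier L" "dst w" using ultrametric_dst[OF w] .
  interpret V: unicritical L "nrm w" d using unicritical_place[OF w] .
  have xc: "x \<in> carrier L" and yc: "y \<in> carrier L" using K_mem_carrier x y by auto
  obtain C where C: "0 \<le> C" "\<And>n. 0 \<le> mutual_energy w x y n" "\<And>n. mutual_energy w x y n \<le> C / real (d ^ n)"
    using mutual_energy_bound[OF x y w small_stable_sets[OF x y lam lim]] by blast
  define b where "b = max (V.bnd x) (V.bnd y)"
  \<comment> \<open>Bounds the distance from \<open>z\<close> to the roots at every level; the added
    1 ensures \<open>t < T\<close>.\<close>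
  define T where "T = max b (nrm w z) + 1"
  have b1: "1 \<le> b" using V.bnd_ge_1[of x] by (simp add: b_def)
  then have T1: "1 < T" by (simp add: T_def)
  define D where "D n = (log_plus (nrm w (orbit_point x z (Suc n))) - log_plus (nrm w (orbit_point y z (Suc n)))) / real (d ^ n)" for n
  have bound: "(D n)\<^sup>2 \<le> 2 * (C / real (d ^ n)) * (ln T + real (Suc n) * ln b)" for n
  proof -
    define t where "t = 1 / b ^ Suc n"
    have t: "0 < t" "t \<le> 1" using b1 one_le_power[OF b1, of "Suc n"] by (simp_all add: t_def)
    have far: "dst w z (roots_of_iterate u n j) \<le> T"
      if "u \<in> carrier L" "V.bnd u \<le> b" "j < d ^ n" for u j
      using V.abs_diff[OF z roots_of_iterate(1)[OF that(1,3)]] root_bound[OF w that(1,3)] that(2)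
      unfolding dst_def T_def by linarith
    have N: "0 < d ^ n" using degree_ge_2 by simp
    have "(D n)\<^sup>2 \<le> 2 * mutual_energy w x y n * (ln T - ln t)"
      using U.potential_difference[OF z t(1) N radii[OF w xc] radii[OF w yc] _ _ far[OF xc] far[OF yc]] t T1
        local_potential[OF w xc z _ t_def] local_potential[OF w yc z _ t_def]
      unfolding D_def mutual_energy_def by (simp add: b_def)
    also have "\<dots> \<le> 2 * (C / real (d ^ n)) * (ln T - ln t)"
      using C(3)[of n] t T1 by (intro mult_right_mono) auto
    also have "ln T - ln t = ln T + real (Suc n) * ln b"
      using b1 by (simp add: t_def ln_div ln_realpow del: power_Suc)
    finally show ?thesis .
  qed
  have d1: "1 < real d" using degree_ge_2 by simp
  have "(\<lambda>n. 2 * C * (ln T / real d ^ n) + 2 * C * ln b * real d * (real (Suc n) / real d ^ Suc n)) \<longlonglongrightarrow> 2 * C * 0 + 2 * C * ln b * real d * 0"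
    using LIMSEQ_divide_realpow_zero[OF d1, of "ln T"] lim_n_over_pown[of "real d"] d1
    by (intro tendsto_add tendsto_mult tendsto_const LIMSEQ_Suc[of "\<lambda>n. real n / real d ^ n"]) auto
  moreover have "2 * (C / real (d ^ n)) * (ln T + real (Suc n) * ln b)
      = 2 * C * (ln T / real d ^ n) + 2 * C * ln b * real d * (real (Suc n) / real d ^ Suc n)" for n
    using d1 by (simp add: field_simps)
  ultimately have lim0: "(\<lambda>n. 2 * (C / real (d ^ n)) * (ln T + real (Suc n) * ln b)) \<longlonglongrightarrow> 0" by simp
  have sq: "(\<lambda>n. (D n)\<^sup>2) \<longlonglongrightarrow> 0"
    by (rule tendsto_sandwich[OF _ _ tendsto_const lim0]) (simp, intro always_eventually allI bound)
  have Deq: "D n = real d * (log_plus (nrm w (orbit_point x z (Suc n))) / real d ^ Suc n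
      - log_plus (nrm w (orbit_point y z (Suc n))) / real d ^ Suc n)" for n
    using d1 by (simp add: D_def field_simps)
  have "(\<lambda>n. real d * (log_plus (nrm w (orbit_point x z (Suc n))) / real d ^ Suc n
      - log_plus (nrm w (orbit_point y z (Suc n))) / real d ^ Suc n)) \<longlonglongrightarrow> real d * (lh w x z - lh w y z)"
    using LIMSEQ_Suc[OF V.local_height_tendsto[OF xc z]] LIMSEQ_Suc[OF V.local_height_tendsto[OF yc z]]
    by (intro tendsto_mult tendsto_diff tendsto_const)
  then have "D \<longlonglongrightarrow> real d * (lh w x z - lh w y z)" by (subst (asm) Deq[symmetric])
  then have "(\<lambda>n. (D n)\<^sup>2) \<longlonglongrightarrow> (real d * (lh w x z - lh w y z))\<^sup>2" by (intro tendsto_power)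
  then have "(real d * (lh w x z - lh w y z))\<^sup>2 = 0" using LIMSEQ_unique[OF _ sq] by blast
  then show ?thesis using d1 by simp
qed

end


section \<open>Conclusion\<close>

lemma unicrit_hom:
  assumes h: "h \<in> ring_hom R S" and R: "ring R" "ring S" and x: "x \<in> carrier R" "l \<in> carrier R"
  shows "(unicrit S d (h l) ^^ n) (h x) = h ((unicrit R d l ^^ n) x)"
proof (induction n)
  case (Suc n)
  interpret H: ring_hom_ring R S h using ring_hom_ringI2[OF R h] .
  have "(unicrit R d l ^^ n) x \<in> carrier R"
    using x by (induction n) (auto simp: unicrit_def)
  then show ?case using Suc x H.hom_nat_pow by (simp add: unicrit_def[of R d l "(unicrit R d l ^^ n) x"] unicrit_def[of S])
qed simp

lemma absolute_value_pullback:
  assumes h: "h \<in> ring_hom R S" and R: "field R" "field S" and \<nu>: "absolute_value S (carrier S) \<nu>"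
  shows "absolute_value R (carrier R) (\<lambda>x. \<nu> (h x))"
proof -
  interpret R: field R by fact
  interpret S: field S by fact
  interpret H: ring_hom_ring R S h using ring_hom_ringI2[OF R.ring_axioms S.ring_axioms h] .
  have "h x = \<zero>\<^bsub>S\<^esub> \<longleftrightarrow> x = \<zero>\<^bsub>R\<^esub>" if "x \<in> carrier R" for x
    using inj_onD[OF non_trivial_field_hom_is_inj[OF h R], of x "\<zero>\<^bsub>R\<^esub>"] that by auto
  then show ?thesis using \<nu> by (simp add: absolute_value_def)
qed

theorem theorem4p1:
  fixes p d :: nat
    and Lbar :: "'a ring"
    and L \<Omega> t \<alpha> \<beta>
    and nv :: "('a \<Rightarrow> real) set \<Rightarrow> 'a \<Rightarrow> real"
    and C :: "('a \<Rightarrow> real) set \<Rightarrow> 'c ring"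
    and absC :: "('a \<Rightarrow> real) set \<Rightarrow> 'c \<Rightarrow> real"
    and emb :: "('a \<Rightarrow> real) set \<Rightarrow> 'a \<Rightarrow> 'c"
    and lam :: "nat \<Rightarrow> 'a"
  assumes "prime p"
    and "algebraic_closure Lbar L"
    and "add_pow Lbar p \<one>\<^bsub>Lbar\<^esub> = \<zero>\<^bsub>Lbar\<^esub>"
    and "t \<in> carrier Lbar"
    and "ring.transcendental Lbar (constants Lbar) t"
    and "perf_rat_field p Lbar t \<subseteq> L"
    and "ring.finite_dimension Lbar (perf_rat_field p Lbar t) L"
    and \<Omega>: "\<Omega> = places_above Lbar (rat_field Lbar t) L"
    and "normalized_abs Lbar L \<Omega> nv"
    and "\<And>v. v \<in> \<Omega> \<Longrightarrow> algebraically_closed (C v)"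
    and "\<And>v. v \<in> \<Omega> \<Longrightarrow> absolute_value (C v) (carrier (C v)) (absC v)"
    and "\<And>v. v \<in> \<Omega> \<Longrightarrow> complete_abs (C v) (absC v)"
    and "\<And>v. v \<in> \<Omega> \<Longrightarrow> emb v \<in> ring_hom Lbar (C v)"
    and "\<And>v x. \<lbrakk>v \<in> \<Omega>; x \<in> L\<rbrakk> \<Longrightarrow> absC v (emb v x) = nv v x"
    and "d \<ge> 2"
    and "\<alpha> \<in> L" and "\<beta> \<in> L"
    and "range lam \<subseteq> carrier Lbar"
    and "infinite (range lam)"
    and "(\<lambda>n. global_height Lbar L \<Omega> (\<lambda>v y. absC v (emb v y)) d (lam n) \<alpha>) \<longlonglongrightarrow> 0"
    and "(\<lambda>n. global_height Lbar L \<Omega> (\<lambda>v y. absC v (emb v y)) d (lam n) \<beta>) \<longlonglongrightarrow> 0"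
  shows "\<forall>l\<in>carrier Lbar. \<forall>v\<in>\<Omega>.
           local_height (C v) (absC v) d (emb v l) (emb v \<alpha>) =
           local_height (C v) (absC v) d (emb v l) (emb v \<beta>)"
proof -
  interpret A: algebraic_closure Lbar L by fact
  interpret P: prime_char_field Lbar p
    using assms(1,3) by unfold_locales auto
  have roots: "\<exists>y\<in>carrier Lbar. y [^]\<^bsub>Lbar\<^esub> p = x" if "x \<in> carrier Lbar" for x
    using A.exists_nth_root[OF that P.p_pos] .
  \<comment> \<open>\<open>L\<close> is a finite extension of the field generated by the constants
    and all \<open>p\<close>-power roots of \<open>t\<close>, which is perfect.\<close>
  have perf: "P.perfect L"
    using P.finite_extension_perfect[OF P.perf_rat_field_perfect(1)[OF roots] A.subfield_axioms
        P.perf_rat_field_perfect(2)[OF roots] assms(7)] .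
  interpret PC: perfect_closure Lbar L p by unfold_locales (rule perf)
  define nrm where "nrm v y = absC v (emb v y)" for v y
  have field_C: "field (C v)" if "v \<in> \<Omega>" for v
    using algebraically_closed.axioms(1)[OF assms(10)[OF that]] .
  have abs: "absolute_value Lbar (carrier Lbar) (nrm v)" if "v \<in> \<Omega>" for v
    unfolding nrm_def using absolute_value_pullback[OF assms(13)[OF that] A.field_axioms field_C[OF that] assms(11)[OF that]] .
  have um: "ultrametric_field Lbar (nrm v)" if "v \<in> \<Omega>" for v
    using abs[OF that] P.absolute_value_ultrametric[OF abs[OF that]] by unfold_locales auto
  have nv: "nrm v x = nv v x" if "v \<in> \<Omega>" "x \<in> L" for v x
    using assms(14)[OF that] by (simp add: nrm_def)
  have eq: "{v \<in> \<Omega>. nrm v x \<noteq> 1} = {v \<in> \<Omega>. nv v x \<noteq> 1}" if "x \<in> L" for x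
    using nv that by auto
  have norm: "finite {v \<in> \<Omega>. nv v x \<noteq> 1}" "(\<Prod>v\<in>{v \<in> \<Omega>. nv v x \<noteq> 1}. nv v x) = 1"
    if "x \<in> L" "x \<noteq> \<zero>\<^bsub>Lbar\<^esub>" for x
    using assms(9) that by (auto simp: normalized_abs_def)
  \<comment> \<open>Some element of \<open>L\<close> has absolute value different from 1; it or its
    inverse has absolute value above 1.\<close>
  have nontrivial: "\<exists>x\<in>carrier Lbar. 1 < nrm v x" if v: "v \<in> \<Omega>" for v
  proof -
    interpret V: ultrametric_field Lbar "nrm v" using um[OF v] .
    have "v \<in> places Lbar L" using v by (simp add: \<Omega> places_above_def)
    then have "v \<subseteq> nontrivial_abs_values Lbar L" by (auto simp: places_def quotient_def)
    moreover have "nv v \<in> v" using assms(9) v by (simp add: normalized_abs_def)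
    ultimately have "nontrivial_abs Lbar L (nv v)" by (auto simp: nontrivial_abs_values_def)
    then obtain x where x: "x \<in> L" "x \<noteq> \<zero>\<^bsub>Lbar\<^esub>" "nrm v x \<noteq> 1"
      using nv[OF v] by (auto simp: nontrivial_abs_def)
    have xc: "x \<in> carrier Lbar" using x(1) A.K_closed(1) by blast
    have inv: "inv\<^bsub>Lbar\<^esub> x \<in> carrier Lbar" using xc x(2) by (simp add: A.field_Units)
    show ?thesis
    proof (cases "1 < nrm v x")
      case False
      then have "1 < inverse (nrm v x)" using V.abs_pos[OF xc x(2)] x(3) by (simp add: one_less_inverse)
      then show ?thesis using V.abs_inv[OF xc x(2)] inv by (intro bexI[of _ "inv\<^bsub>Lbar\<^esub> x"]) auto
    qed (use xc in blast)
  qed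
  interpret H: global_heights Lbar L p \<Omega> nrm d
  proof (intro global_heights.intro global_heights_axioms.intro PC.perfect_closure_axioms)
    show "finite {v \<in> \<Omega>. nrm v x \<noteq> 1}" "(\<Prod>v\<in>{v \<in> \<Omega>. nrm v x \<noteq> 1}. nrm v x) = 1"
      if "x \<in> L" "x \<noteq> \<zero>\<^bsub>Lbar\<^esub>" for x
    proof -
      show "finite {v \<in> \<Omega>. nrm v x \<noteq> 1}" using norm[OF that] eq[OF that(1)] by simp
      have "(\<Prod>v\<in>{v \<in> \<Omega>. nrm v x \<noteq> 1}. nrm v x) = (\<Prod>v\<in>{v \<in> \<Omega>. nv v x \<noteq> 1}. nv v x)"
        using eq[OF that(1)] nv that(1) by (intro prod.cong) auto
      then show "(\<Prod>v\<in>{v \<in> \<Omega>. nrm v x \<noteq> 1}. nrm v x) = 1" using norm[OF that] by simp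
    qed
  qed (use um nontrivial assms(15) in blast)+
  \<comment> \<open>The embeddings commute with iteration, so local heights in the fields
    \<open>C v\<close> are those of the pulled-back absolute values.\<close>
  have local: "local_height (C v) (absC v) d (emb v l) (emb v x) = local_height Lbar (nrm v) d l x"
    if "v \<in> \<Omega>" "l \<in> carrier Lbar" "x \<in> L" for v l x
  proof -
    have "x \<in> carrier Lbar" using that(3) A.K_closed(1) by blast
    then show ?thesis
      unfolding local_height_def nrm_def
      using unicrit_hom[OF assms(13)[OF that(1)] A.ring_axioms _ _ that(2)] field.is_ring[OF field_C[OF that(1)]]
      by simp
  qed
  have "global_height Lbar L \<Omega> (\<lambda>v y. absC v (emb v y)) = global_height Lbar L \<Omega> nrm"
    by (simp add: nrm_def[abs_def])
  then have "local_height Lbar (nrm v) d l \<alpha> = local_height Lbar (nrm v) d l \<beta>"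
    if "l \<in> carrier Lbar" "v \<in> \<Omega>" for l v
    using H.local_heights_eq[OF assms(16,17,18,19) _ _ that(2,1)] assms(20,21) by simp
  then show ?thesis using local assms(16,17) by simp
qed

end
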